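(* Fix positive integers $k$ and $d$. The multiple nested boxes problem with $k$ piles (on $n$ boxes in dimension $d$) can be solved in time $O(n^{k+1-\varepsilon})$ for some $\varepsilon>0$.
   Context: A box in dimension $d$ is given by its size $(b_1,\ldots,b_d)$. Box $a=(a_1,\ldots,a_d)$ fits into box $b=(b_1,\ldots,b_d)$ if $a_i\le b_i$ for all $1\le i\le d$ (no rotation). Multiple nested boxes problem: given $n$ boxes in dimension $d$ and $k$ piles, find the maximum number of boxes that can be distributed among the $k$ piles so that within each pile every box fits into the next one. *)

theory Defs
  imports Complex_Main "HOL-Library.Landau_Symbols"
begin

section \<open>The multiple nested boxes problem\<close>

definition fits :: "nat list \<Rightarrow> nat list \<Rightarrow> bool" where
  "fits a b \<longleftrightarrow> list_all2 (\<le>) a b"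

text \<open>Boxes are referred to by their index in the list \<open>bs\<close>, so that several boxes may have
  the same size. A pile is a possibly empty list of indices; the last box is the outermost one.
  No box is used twice, and boxes may be left out.\<close>

definition distribution :: "nat \<Rightarrow> nat list list \<Rightarrow> nat list list \<Rightarrow> bool" where
  "distribution k bs piles \<longleftrightarrow>
     length piles = k \<and>
     distinct (concat piles) \<and>
     set (concat piles) \<subseteq> {..<length bs} \<and>
     (\<forall>pile \<in> set piles. successively (\<lambda>i j. fits (bs ! i) (bs ! j)) pile)"

definition max_nested_boxes :: "nat \<Rightarrow> nat list list \<Rightarrow> nat" where
  "max_nested_boxes k bs = Max {length (concat piles) | piles. distribution k bs piles}"

lemma finite_distributions: "finite {piles. distribution k bs piles}"
proof (rule finite_subset)
  let ?P = "{xs. set xs \<subseteq> {..<length bs} \<and> length xs \<le> length bs}"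
  show "{piles. distribution k bs piles} \<subseteq> {ps. set ps \<subseteq> ?P \<and> length ps = k}"
  proof clarify
    fix ps assume d: "distribution k bs ps"
    have "set p \<subseteq> {..<length bs}" "length p \<le> length bs" if "p \<in> set ps" for p
    proof -
      show s: "set p \<subseteq> {..<length bs}"
        using d that unfolding distribution_def by auto
      have "distinct p"
        using d that unfolding distribution_def by (auto simp: distinct_concat_iff)
      then have "length p = card (set p)" by (simp add: distinct_card)
      also have "\<dots> \<le> length bs" using card_mono[OF _ s] by simp
      finally show "length p \<le> length bs" .
    qed
    then show "set ps \<subseteq> ?P \<and> length ps = k"
      using d unfolding distribution_def by blast
  qed
  show "finite {ps. set ps \<subseteq> ?P \<and> length ps = k}"
    by (intro finite_lists_length_eq finite_lists_length_le) simp
qed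

lemma distribution_replicate_Nil: "distribution k bs (replicate k [])"
  by (auto simp: distribution_def concat_replicate_trivial)

lemma max_nested_boxes_ge:
  "distribution k bs piles \<Longrightarrow> length (concat piles) \<le> max_nested_boxes k bs"
  unfolding max_nested_boxes_def setcompr_eq_image
  using finite_distributions[of k bs] by (intro Max_ge finite_imageI imageI) simp_all

lemma max_nested_boxes_attained:
  "\<exists>piles. distribution k bs piles \<and> length (concat piles) = max_nested_boxes k bs"
proof -
  have "max_nested_boxes k bs \<in> (\<lambda>ps. length (concat ps)) ` {ps. distribution k bs ps}"
    unfolding max_nested_boxes_def setcompr_eq_image
    using finite_distributions[of k bs] distribution_replicate_Nil[of k bs]
    by (intro Max_in finite_imageI) auto
  then show ?thesis by auto
qed

section \<open>The word RAM\<close>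

text \<open>A word RAM with \<open>w\<close>-bit words, in the form of a structured language with registers and an
  indirectly addressed memory; both hold words. A program is a finite syntax tree that does not
  depend on the input or on \<open>w\<close>, so it uses a constant number of registers. Arithmetic is modulo
  \<open>2 ^ w\<close>, division by zero yields 0 (and \<open>x mod 0 = x\<close>).\<close>

datatype binop =
  Add | Sub | Mult | Div | Mod | BitAnd | BitOr | BitXor | Less | Equal

datatype exp =
    Const nat
  | Reg nat
  | Load exp
  | Bin binop exp exp

datatype com =
    Skip
  | Assign nat exp
  | Store exp exp
  | Seq com com
  | Cond exp com com
  | While exp com

type_synonym state = "(nat \<Rightarrow> nat) \<times> (nat \<Rightarrow> nat)"

fun eval_binop :: "nat \<Rightarrow> binop \<Rightarrow> nat \<Rightarrow> nat \<Rightarrow> nat" where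
  "eval_binop w Add a b = (a + b) mod 2 ^ w"
| "eval_binop w Sub a b = nat ((int a - int b) mod 2 ^ w)"
| "eval_binop w Mult a b = (a * b) mod 2 ^ w"
| "eval_binop w Div a b = a div b"
| "eval_binop w Mod a b = a mod b"
| "eval_binop w BitAnd a b = and a b"
| "eval_binop w BitOr a b = or a b"
| "eval_binop w BitXor a b = xor a b"
| "eval_binop w Less a b = (of_bool (a < b)) mod 2 ^ w"
| "eval_binop w Equal a b = (of_bool (a = b)) mod 2 ^ w"

fun eval :: "nat \<Rightarrow> exp \<Rightarrow> state \<Rightarrow> nat" where
  "eval w (Const a) s = a mod 2 ^ w"
| "eval w (Reg x) s = fst s x"
| "eval w (Load e) s = snd s (eval w e s)"
| "eval w (Bin f e1 e2) s = eval_binop w f (eval w e1 s) (eval w e2 s)"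

text \<open>Every operation takes one unit of time.\<close>

fun cost :: "exp \<Rightarrow> nat" where
  "cost (Const a) = 1"
| "cost (Reg x) = 1"
| "cost (Load e) = 1 + cost e"
| "cost (Bin f e1 e2) = 1 + cost e1 + cost e2"

text \<open>\<open>exec w c s t s'\<close>: started in state \<open>s\<close>, the program \<open>c\<close> halts after \<open>t\<close> time units in
  state \<open>s'\<close>. A non-zero word counts as true.\<close>

inductive exec :: "nat \<Rightarrow> com \<Rightarrow> state \<Rightarrow> nat \<Rightarrow> state \<Rightarrow> bool" for w :: nat where
  Skip: "exec w Skip s 1 s"
| Assign: "exec w (Assign x e) s (1 + cost e) ((fst s)(x := eval w e s), snd s)"
| Store: "exec w (Store a e) s (1 + cost a + cost e)
    (fst s, (snd s)(eval w a s := eval w e s))"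
| Seq: "exec w c1 s t1 s1 \<Longrightarrow> exec w c2 s1 t2 s2 \<Longrightarrow> exec w (Seq c1 c2) s (t1 + t2) s2"
| CondTrue: "eval w e s \<noteq> 0 \<Longrightarrow> exec w c1 s t s1 \<Longrightarrow>
    exec w (Cond e c1 c2) s (1 + cost e + t) s1"
| CondFalse: "eval w e s = 0 \<Longrightarrow> exec w c2 s t s1 \<Longrightarrow>
    exec w (Cond e c1 c2) s (1 + cost e + t) s1"
| WhileFalse: "eval w e s = 0 \<Longrightarrow> exec w (While e c) s (1 + cost e) s"
| WhileTrue: "eval w e s \<noteq> 0 \<Longrightarrow> exec w c s t1 s1 \<Longrightarrow> exec w (While e c) s1 t2 s2 \<Longrightarrow>
    exec w (While e c) s (1 + cost e + t1 + t2) s2"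

section \<open>Solving the problem on the word RAM\<close>

text \<open>Register 0 holds the number of boxes, memory cell \<open>i * d + j\<close> holds coordinate \<open>j\<close> of
  box \<open>i\<close>, and everything else is 0.\<close>

definition input_state :: "nat list list \<Rightarrow> state" where
  "input_state bs =
     ((\<lambda>x. if x = 0 then length bs else 0),
      (\<lambda>a. if a < length (concat bs) then concat bs ! a else 0))"

text \<open>The program \<open>p\<close> leaves the answer in register 0 within time \<open>T n\<close> on all instances with
  \<open>n\<close> boxes. As usual for the word RAM, the word size is at least a constant multiple of
  \<open>log n\<close> and each coordinate fits into one word; \<open>T\<close> may not depend on the word size.\<close>

definition solves_nested_boxes :: "nat \<Rightarrow> nat \<Rightarrow> com \<Rightarrow> (nat \<Rightarrow> nat) \<Rightarrow> bool" where
  "solves_nested_boxes k d p T \<longleftrightarrow>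
     (\<exists>c. \<forall>w n bs. (n + 2) ^ c \<le> 2 ^ w \<longrightarrow> length bs = n \<longrightarrow>
        (\<forall>b \<in> set bs. length b = d \<and> (\<forall>x \<in> set b. x < 2 ^ w)) \<longrightarrow>
        (\<exists>t s. exec w p (input_state bs) t s \<and> t \<le> T n \<and> fst s 0 = max_nested_boxes k bs))"

end

theory Submission
  imports Defs
begin

text \<open>
  Sort the boxes so that every box comes after the boxes that fit into it. A distribution is then
  built up by scanning the boxes in this order, and it suffices to know, for each tuple
  \<open>(j\<^sub>0, \<dots>, j\<^sub>k\<^sub>-\<^sub>1)\<close> of outermost boxes of the piles, the maximal number of boxes used so far. If
  \<open>t\<close> is the latest box in the tuple, say on pile \<open>m\<close>, the value is one more than the maximum over
  all \<open>j\<^sub>m\<close> that fit into \<open>t\<close>, the other piles being unchanged. Hence there are \<open>O(n ^ k)\<close>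
  dominance-maximum queries and insertions.

  Replacing coordinates by ranks, a query \<open>j \<le> t\<close> in one coordinate splits into \<open>O(log n)\<close> nodes of
  a complete binary tree: \<open>x < y\<close> iff on some level the ancestor of \<open>y\<close> is a right child whose left
  sibling is an ancestor of \<open>x\<close>. In \<open>d\<close> dimensions one stores a maximum for every \<open>d\<close>-tuple of nodes,
  so that queries and insertions take time \<open>O((log n) ^ d)\<close>; these tables need no initialisation
  because the memory is zero. The total time is \<open>O(n ^ k (log n) ^ d)\<close>.
\<close>

section \<open>Running time and correctness of programs\<close>

text \<open>Trying all n predecessors for each of the n^k tuples would cost n^(k+1); the tables
  replace this scan by a polylogarithmic query, and (log n)^d is O(n^(1/2)) for every fixed d. Three
  points shape the construction. The time bound may not depend on the word size, so coordinates are
  only copied and compared, and all trees are built over ranks below a power of two N with n + 2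
  \<le> N \<le> 2(n + 1). Boxes of equal size fit into each other, so the order of processing is
  topological only up to ties; queries ask for dominance in all d coordinates and do not mention
  positions, and the order in which tuples are entered, together with a test for t among the other
  entries, ensures that only earlier boxes are found. Finally, any pile may be the next to grow:
  each tuple is entered into k tables, where table i is split according to the other k - 1 entries
  and searched by the i-th one. The tables are sparse but of polynomial size, which is what a word
  size of c log n pays for.\<close>

definition runs :: "nat \<Rightarrow> com \<Rightarrow> (nat \<Rightarrow> nat) \<Rightarrow> (nat \<Rightarrow> nat) \<Rightarrow> nat \<Rightarrow>
    (nat \<Rightarrow> (nat \<Rightarrow> nat) \<Rightarrow> (nat \<Rightarrow> nat) \<Rightarrow> bool) \<Rightarrow> bool" where
  "runs w c r m t Q \<longleftrightarrow> (\<exists>t' s'. exec w c (r, m) t' s' \<and> Q (t + t') (fst s') (snd s'))"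

inductive_cases exec_SkipE: "exec w Skip s t s'"
inductive_cases exec_AssignE: "exec w (Assign x e) s t s'"
inductive_cases exec_StoreE: "exec w (Store a e) s t s'"
inductive_cases exec_SeqE: "exec w (Seq c1 c2) s t s'"
inductive_cases exec_CondE: "exec w (Cond e c1 c2) s t s'"

lemma exec_Skip_iff: "exec w Skip s t s' \<longleftrightarrow> t = 1 \<and> s' = s"
  by (auto elim: exec_SkipE intro: exec.Skip[simplified])

lemma exec_Assign_iff:
  "exec w (Assign x e) s t s' \<longleftrightarrow> t = 1 + cost e \<and> s' = ((fst s)(x := eval w e s), snd s)"
  using exec.Assign[of w x e s] by (auto elim: exec_AssignE)

lemma exec_Store_iff:
  "exec w (Store a e) s t s' \<longleftrightarrow>
     t = 1 + cost a + cost e \<and> s' = (fst s, (snd s)(eval w a s := eval w e s))"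
  using exec.Store[of w a e s] by (auto elim: exec_StoreE)

lemma exec_Seq_iff:
  "exec w (Seq c1 c2) s t s' \<longleftrightarrow>
     (\<exists>t1 t2 s1. t = t1 + t2 \<and> exec w c1 s t1 s1 \<and> exec w c2 s1 t2 s')"
  by (blast elim: exec_SeqE intro: exec.Seq)

lemma exec_Cond_iff:
  "exec w (Cond e c1 c2) s t s' \<longleftrightarrow>
     (\<exists>t'. t = 1 + cost e + t' \<and> exec w (if eval w e s \<noteq> 0 then c1 else c2) s t' s')"
  (is "?l = ?r")
proof
  show "?l \<Longrightarrow> ?r" by (erule exec_CondE) auto
  show "?r \<Longrightarrow> ?l"
    using exec.CondTrue[of w e s c1 _ s' c2] exec.CondFalse[of w e s c2 _ s' c1]
    by (auto split: if_splits)
qed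

text \<open>\<open>runs\<close> is a weakest precondition with a clock: \<open>t\<close> is the time
  spent before \<open>c\<close>, and \<open>Q\<close> sees the total. With this and the next four
  equations as simp rules, the simplifier executes loop-free code symbolically.\<close>

lemma runs_Skip [simp]: "runs w Skip r m t Q \<longleftrightarrow> Q (t + 1) r m"
  unfolding runs_def exec_Skip_iff by simp

lemma runs_Assign [simp]:
  "runs w (Assign x e) r m t Q \<longleftrightarrow> Q (t + (1 + cost e)) (r(x := eval w e (r, m))) m"
  unfolding runs_def exec_Assign_iff by simp

lemma runs_Store [simp]:
  "runs w (Store a e) r m t Q \<longleftrightarrow>
     Q (t + (1 + cost a + cost e)) r (m(eval w a (r, m) := eval w e (r, m)))"
  unfolding runs_def exec_Store_iff by simp

lemma runs_Seq [simp]: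
  "runs w (Seq c1 c2) r m t Q \<longleftrightarrow> runs w c1 r m t (\<lambda>t r m. runs w c2 r m t Q)"
  unfolding runs_def exec_Seq_iff by (simp only: prod.collapse add.assoc) blast

lemma runs_Cond [simp]:
  "runs w (Cond e c1 c2) r m t Q \<longleftrightarrow>
     (if eval w e (r, m) \<noteq> 0 then runs w c1 r m (t + (1 + cost e)) Q
      else runs w c2 r m (t + (1 + cost e)) Q)"
  unfolding runs_def exec_Cond_iff by (simp only: add.assoc split: if_split) blast

lemma runs_conseq:
  "runs w c r m t P \<Longrightarrow> (\<And>t r m. P t r m \<Longrightarrow> Q t r m) \<Longrightarrow> runs w c r m t Q"
  unfolding runs_def by blast

text \<open>Specifications are proved for a clock that starts at 0; this rule moves them to any
  starting time.\<close>

lemma runs_call: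
  assumes "runs w c r m 0 P" "\<And>t' r m. P t' r m \<Longrightarrow> Q (t + t') r m"
  shows "runs w c r m t Q"
  using assms unfolding runs_def by fastforce

section \<open>Counted loops\<close>

definition For :: "nat \<Rightarrow> exp \<Rightarrow> com \<Rightarrow> com" where
  "For x b c = Seq (Assign x (Const 0))
     (While (Bin Less (Reg x) b) (Seq c (Assign x (Bin Add (Reg x) (Const 1)))))"

text \<open>The start value \<open>i\<close> is arbitrary for the sake of induction on
  \<open>B - i\<close>. A round costs at most \<open>T\<close> for the body,
  \<open>cost b + 3\<close> for the guard and 4 for the increment; the final summand is the failing
  guard. The body must return the counter \<open>x\<close> with the value \<open>i\<close>.\<close>

lemma runs_While:
  assumes "i \<le> B" "I i r m" "B < 2 ^ w"
    and I: "\<And>i r m. I i r m \<Longrightarrow> r x = i \<and> eval w b (r, m) = B"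
    and step: "\<And>i r m. i < B \<Longrightarrow> I i r m \<Longrightarrow>
      runs w c r m 0 (\<lambda>t r' m'. t \<le> T \<and> r' x = i \<and> I (Suc i) (r'(x := Suc i)) m')"
    and Q: "\<And>t' r m. t' \<le> t + (B - i) * (T + cost b + 7) + (cost b + 3) \<Longrightarrow> I B r m \<Longrightarrow> Q t' r m"
  shows "runs w (While (Bin Less (Reg x) b) (Seq c (Assign x (Bin Add (Reg x) (Const 1)))))
     r m t Q"
  using assms(1,2) Q
proof (induction "B - i" arbitrary: i r m t)
  case 0
  then have "i = B" by simp
  moreover have "r x = B" "eval w b (r, m) = B" using I[OF 0(3)] \<open>i = B\<close> by auto
  ultimately have "exec w (While (Bin Less (Reg x) b) (Seq c (Assign x (Bin Add (Reg x) (Const 1)))))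
     (r, m) (1 + cost (Bin Less (Reg x) b)) (r, m)"
    by (intro exec.WhileFalse) simp
  moreover have "Q (t + (1 + cost (Bin Less (Reg x) b))) r m"
    using 0 \<open>i = B\<close> by simp
  ultimately show ?case unfolding runs_def by fastforce
next
  case (Suc d)
  let ?W = "While (Bin Less (Reg x) b) (Seq c (Assign x (Bin Add (Reg x) (Const 1))))"
  have iB: "i < B" using Suc(2) by simp
  have r: "r x = i" "eval w b (r, m) = B" using I[OF Suc(4)] by auto
  obtain t1 r1 m1 where e1: "exec w c (r, m) t1 (r1, m1)" and t1: "t1 \<le> T" "r1 x = i"
     "I (Suc i) (r1(x := Suc i)) m1"
    using step[OF iB Suc(4)] unfolding runs_def by fastforce
  have w: "(2::nat) ^ w > 1" "0 < w" using iB \<open>B < 2 ^ w\<close> by (linarith, cases w) auto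
  have ev: "eval w (Bin Add (Reg x) (Const 1)) (r1, m1) = Suc i"
    using t1(2) iB \<open>B < 2 ^ w\<close> w by simp
  have e2: "exec w (Seq c (Assign x (Bin Add (Reg x) (Const 1)))) (r, m) (t1 + 4)
      (r1(x := Suc i), m1)"
    using exec.Seq[OF e1 exec.Assign[of w x "Bin Add (Reg x) (Const 1)"]] ev
    by (simp add: eval_nat_numeral)
  have "runs w ?W (r1(x := Suc i)) m1 (t + (cost b + 3 + (t1 + 4))) Q"
  proof (rule Suc(1))
    show "d = B - Suc i" using Suc(2) by simp
    show "Suc i \<le> B" using iB by simp
    show "I (Suc i) (r1(x := Suc i)) m1" by (fact t1)
    fix t' r m assume t': "t' \<le> t + (cost b + 3 + (t1 + 4)) +
      (B - Suc i) * (T + cost b + 7) + (cost b + 3)" and IB: "I B r m"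
    have "(B - i) * (T + cost b + 7) = (B - Suc i) * (T + cost b + 7) + (T + cost b + 7)"
      using iB by (metis Suc_diff_Suc mult_Suc add.commute)
    then show "Q t' r m" using t' t1(1) by (intro Suc(5)[OF _ IB]) linarith
  qed
  then obtain t2 r2 m2 where e3: "exec w ?W (r1(x := Suc i), m1) t2 (r2, m2)"
    and q: "Q (t + (cost b + 3 + (t1 + 4)) + t2) r2 m2"
    unfolding runs_def by fastforce
  have "eval w (Bin Less (Reg x) b) (r, m) \<noteq> 0"
    using r iB w by simp
  from exec.WhileTrue[OF this e2 e3] have
    "exec w ?W (r, m) (cost b + 3 + (t1 + 4) + t2) (r2, m2)" by (simp add: add_ac eval_nat_numeral)
  with q show ?case unfolding runs_def
    by (intro exI[of _ "cost b + 3 + (t1 + 4) + t2"] exI[of _ "(r2, m2)"]) (simp add: add.assoc)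
qed

lemma runs_For:
  assumes "I 0 (r(x := 0)) m" "B < 2 ^ w"
    and I: "\<And>i r m. I i r m \<Longrightarrow> r x = i \<and> eval w b (r, m) = B"
    and step: "\<And>i r m. i < B \<Longrightarrow> I i r m \<Longrightarrow>
      runs w c r m 0 (\<lambda>t r' m'. t \<le> T \<and> r' x = i \<and> I (Suc i) (r'(x := Suc i)) m')"
    and Q: "\<And>t' r m. t' \<le> t + B * (T + cost b + 7) + (cost b + 5) \<Longrightarrow> I B r m \<Longrightarrow> Q t' r m"
  shows "runs w (For x b c) r m t Q"
  unfolding For_def runs_Seq runs_Assign
proof (rule runs_While[of 0 B I, OF _ _ assms(2) I step])
  show "I 0 (r(x := eval w (Const 0) (r, m))) m" using assms(1) by simp
qed (use Q in \<open>auto simp: add_ac\<close>)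

lemma eval_binop_Sub: "b \<le> a \<Longrightarrow> a < 2 ^ w \<Longrightarrow> eval_binop w Sub a b = a - b"
  by (simp add: of_nat_diff[symmetric] del: of_nat_diff)

lemma of_bool_mod: "0 < w \<Longrightarrow> of_bool P mod (2::nat) ^ w = of_bool P"
  by (cases P) (auto simp: mod_less)

section \<open>Binary trees and positional notation\<close>

lemma trie_sound:
  fixes a b :: nat
  assumes "a div 2 ^ l = b div 2 ^ l - 1" "b div 2 ^ l \<ge> 1"
  shows "a < b"
proof (rule ccontr)
  assume "\<not> a < b"
  then have "b div 2 ^ l \<le> a div 2 ^ l" by (simp add: div_le_mono)
  then show False using assms by simp
qed

text \<open>Take the highest level below \<open>L\<close> on which the ancestors differ. There they
  share their parent, so \<open>a\<close> lies below the left child and \<open>b\<close> below the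
  right child, whose number is odd.\<close>

lemma trie_complete:
  fixes a b :: nat
  assumes "a < b" "a div 2 ^ L = b div 2 ^ L"
  shows "\<exists>l<L. odd (b div 2 ^ l) \<and> a div 2 ^ l = b div 2 ^ l - 1"
  using assms(2)
proof (induction L)
  case 0
  then show ?case using assms(1) by simp
next
  case (Suc L)
  show ?case
  proof (cases "a div 2 ^ L = b div 2 ^ L")
    case True
    then show ?thesis using Suc.IH less_Suc_eq by blast
  next
    case False
    let ?a = "a div 2 ^ L" and ?b = "b div 2 ^ L"
    have "?a < ?b" using False assms(1) div_le_mono[of a b "2 ^ L"] by simp
    moreover have "?a div 2 = ?b div 2"
      using Suc.prems by (simp add: div_mult2_eq mult.commute[of 2])
    moreover have "odd y \<and> x = y - 1" if "x < y" "x div 2 = y div 2" for x y :: nat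
      using that by presburger
    ultimately have "odd ?b \<and> ?a = ?b - 1" by blast
    then show ?thesis by blast
  qed
qed

text \<open>Digit 0 is the most significant, in the order in which \<open>node_prog\<close>
  accumulates a tuple of nodes. In \<open>code\<close> it is the least significant, so that single
  digits can be cleared and set arithmetically.\<close>

fun horner :: "nat \<Rightarrow> (nat \<Rightarrow> nat) \<Rightarrow> nat \<Rightarrow> nat" where
  "horner B f 0 = 0"
| "horner B f (Suc c) = horner B f c * B + f c"

lemma horner_less: "(\<And>i. i < c \<Longrightarrow> f i < B) \<Longrightarrow> horner B f c < B ^ c"
proof (induction c)
  case (Suc c)
  then have "horner B f c < B ^ c" and f: "f c < B" by auto
  then have "horner B f c + 1 \<le> B ^ c" by simp
  then have "(horner B f c + 1) * B \<le> B ^ c * B" by (rule mult_le_mono1)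
  then show ?case using f by (simp add: mult.commute)
qed simp

lemma horner_inj:
  assumes "horner B f c = horner B g c" "\<And>i. i < c \<Longrightarrow> f i < B" "\<And>i. i < c \<Longrightarrow> g i < B" "i < c"
  shows "f i = g i"
  using assms
proof (induction c)
  case (Suc c)
  have e: "horner B f c * B + f c = horner B g c * B + g c" and "f c < B" "g c < B"
    using Suc.prems by auto
  have "(x * B + y) mod B = y" if "y < B" for x y using that by simp
  from this[OF \<open>f c < B\<close>, of "horner B f c"] this[OF \<open>g c < B\<close>, of "horner B g c"]
  have fg: "f c = g c" unfolding e by (rule trans[OF sym])
  then have "horner B f c = horner B g c" using e \<open>f c < B\<close> by simp
  then show ?case using Suc fg less_Suc_eq by metis
qed simp

lemma horner_cong: "(\<And>i. i < c \<Longrightarrow> f i = g i) \<Longrightarrow> horner B f c = horner B g c"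
  by (induction c) auto

section \<open>Tuples of positions as numbers in base \<open>N\<close>\<close>

definition dig :: "nat \<Rightarrow> nat \<Rightarrow> nat \<Rightarrow> nat" where
  "dig N J i = J div N ^ i mod N"

definition code :: "nat \<Rightarrow> nat \<Rightarrow> (nat \<Rightarrow> nat) \<Rightarrow> nat" where
  "code N k f = (\<Sum>i<k. f i * N ^ i)"

lemma code_Suc [simp]: "code N (Suc k) f = code N k f + f k * N ^ k"
  and code_0 [simp]: "code N 0 f = 0"
  by (simp_all add: code_def)

lemma code_less: "(\<And>i. i < k \<Longrightarrow> f i < N) \<Longrightarrow> code N k f < N ^ k"
proof (induction k)
  case (Suc k)
  then have "code N k f < N ^ k" and f: "f k + 1 \<le> N" by (auto simp: Suc_leI)
  moreover have "(f k + 1) * N ^ k \<le> N * N ^ k" using f by (rule mult_le_mono1)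
  ultimately show ?case by simp
qed simp

lemma dig_code: "(\<And>i. i < k \<Longrightarrow> f i < N) \<Longrightarrow> i < k \<Longrightarrow> dig N (code N k f) i = f i"
proof (induction k)
  case (Suc k)
  have c: "code N k f < N ^ k" using Suc.prems by (intro code_less) simp
  have N: "N > 0" using Suc.prems(1)[of k] by simp
  show ?case
  proof (cases "i = k")
    case True
    then show ?thesis using c N Suc.prems(1)[of k] by (simp add: dig_def)
  next
    case False
    then have ik: "i < k" using Suc.prems by simp
    then have "N ^ k = N ^ i * (N * N ^ (k - Suc i))"
      by (simp add: power_add[symmetric] flip: power_Suc)
    then have "code N (Suc k) f = code N k f + N ^ i * (N * (f k * N ^ (k - Suc i)))"
      by simp
    then have "code N (Suc k) f div N ^ i = code N k f div N ^ i + N * (f k * N ^ (k - Suc i))"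
      using N by (simp del: code_Suc)
    then have "dig N (code N (Suc k) f) i = dig N (code N k f) i"
      by (simp add: dig_def del: code_Suc)
    then show ?thesis using Suc.IH[OF _ ik] Suc.prems(1) by simp
  qed
qed simp

lemma code_dig: "code N k (dig N J) = J mod N ^ k"
proof (induction k)
  case (Suc k)
  show ?case using mod_mult2_eq[of J "N ^ k" N] Suc
    by (simp add: dig_def mult.commute)
qed simp

lemma code_cong: "(\<And>i. i < k \<Longrightarrow> f i = g i) \<Longrightarrow> code N k f = code N k g"
  by (simp add: code_def)

lemma code_upd: "m < k \<Longrightarrow> code N k (f(m := t)) = code N k (f(m := 0)) + t * N ^ m"
  by (simp add: code_def sum.remove[of "{..<k}" m])

text \<open>The numeral of \<open>R\<close> with a digit 0 inserted at place \<open>m\<close>. As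
  \<open>R\<close> runs through the numbers below \<open>N ^ (k - 1)\<close>, this enumerates the
  entries of the other piles, with pile \<open>m\<close> left blank.\<close>

definition insert0 :: "nat \<Rightarrow> nat \<Rightarrow> nat \<Rightarrow> nat" where
  "insert0 N m R = R mod N ^ m + R div N ^ m * (N ^ m * N)"

lemma insert0_code:
  assumes "m < k" and that: "\<And>i. i < k - 1 \<Longrightarrow> f i < N"
  shows "insert0 N m (code N (k - 1) f) =
    code N k (\<lambda>i. if i < m then f i else if i = m then 0 else f (i - 1))"
proof -
  \<comment> \<open>\<open>e\<close> is the number of digits above place \<open>m\<close>; both
    sides are split into \<open>m\<close> low and \<open>e\<close> high digits.\<close>
  obtain e where k: "k = Suc (m + e)" using assms less_imp_Suc_add by blast
  have s: "code N (m + e) f = code N m f + N ^ m * code N e (\<lambda>i. f (m + i))" for e f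
    by (induction e) (simp_all add: algebra_simps power_add)
  have "code N m f < N ^ m" using that k by (intro code_less) simp
  then have "insert0 N m (code N (k - 1) f) = code N m f + code N e (\<lambda>i. f (m + i)) * (N ^ m * N)"
    using k by (cases "N ^ m = 0") (simp_all add: insert0_def s)
  moreover have "code N k g = code N m g + N ^ m * (g m + N * code N e (\<lambda>i. g (Suc (m + i))))" for g
  proof -
    have "code N (Suc e) h = h 0 + N * code N e (\<lambda>i. h (Suc i))" for h
      by (induction e) (simp_all add: algebra_simps)
    then show ?thesis using s[of "Suc e" g] k by (simp del: code_Suc)
  qed
  ultimately show ?thesis
    by (simp add: algebra_simps cong: code_cong)
qed

lemma insert0_digits:
  assumes "R < N ^ (k - 1)" "m < k" "N > 0"
  obtains f where "insert0 N m R = code N k f" "\<And>i. f i < N" "f m = 0"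
proof -
  define f where "f = (\<lambda>i. if i < m then dig N R i else if i = m then 0 else dig N R (i - 1))"
  have d: "dig N R i < N" for i using assms by (simp add: dig_def)
  have "R = code N (k - 1) (dig N R)" using assms(1) by (simp add: code_dig)
  then have "insert0 N m R = code N k f"
    using insert0_code[OF assms(2), of "dig N R" N] d unfolding f_def by simp
  moreover have "f i < N" for i using d assms by (simp add: f_def)
  ultimately show thesis using that by (simp add: f_def)
qed

lemma insert0_less: "R < N ^ (k - 1) \<Longrightarrow> m < k \<Longrightarrow> N > 0 \<Longrightarrow> insert0 N m R < N ^ k"
  by (metis insert0_digits code_less)

lemma insert0_surj:
  assumes "\<And>i. i < k \<Longrightarrow> f i < N" "m < k" "f m = 0"
  shows "\<exists>R<N ^ (k - 1). code N k f = insert0 N m R"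
proof -
  let ?g = "\<lambda>i. if i < m then f i else f (Suc i)"
  have g: "\<And>i. i < k - 1 \<Longrightarrow> ?g i < N" using assms(1,2) by auto
  have "insert0 N m (code N (k - 1) ?g) = code N k f"
    using assms(2,3) by (subst insert0_code[OF assms(2) g]) (auto intro!: code_cong)
  then show ?thesis using code_less[of "k - 1" ?g N, OF g] by metis
qed

lemma insert0_inj: "insert0 N m R = insert0 N m R' \<Longrightarrow> N > 0 \<Longrightarrow> R = R'"
proof -
  assume e: "insert0 N m R = insert0 N m R'" and "N > 0"
  have "insert0 N m x mod N ^ m = x mod N ^ m" for x
  proof -
    have "insert0 N m x = x mod N ^ m + N ^ m * (x div N ^ m * N)" by (simp add: insert0_def)
    then show ?thesis by simp
  qed
  moreover have "insert0 N m x div (N ^ m * N) = x div N ^ m" for x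
  proof -
    have "x mod N ^ m < N ^ m" using \<open>N > 0\<close> by simp
    also have "N ^ m \<le> N ^ m * N" using \<open>N > 0\<close> by simp
    finally show ?thesis using \<open>N > 0\<close> by (simp add: insert0_def)
  qed
  ultimately have "R mod N ^ m = R' mod N ^ m" "R div N ^ m = R' div N ^ m" using e by metis+
  then show ?thesis by (metis div_mult_mod_eq)
qed

section \<open>Winner trees\<close>

definition better :: "(nat \<Rightarrow> nat) \<Rightarrow> nat \<Rightarrow> nat \<Rightarrow> nat" where
  "better K a b = (if a = 0 \<or> b \<noteq> 0 \<and> K b < K a then b else a)"

text \<open>By induction on the height \<open>l\<close>, node \<open>v\<close> holds an element of
  least key among the members of \<open>A\<close> below it, and 0 if there are none. This is why 0
  may not belong to \<open>A\<close>: in \<open>better\<close> it marks an empty subtree.\<close>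

lemma tournament:
  fixes N :: nat
  assumes N: "N = 2 ^ L"
    and cons: "\<And>v. 1 \<le> v \<Longrightarrow> v < N \<Longrightarrow> T v = better K (T (2 * v)) (T (2 * v + 1))"
    and leaf: "\<And>x. x < N \<Longrightarrow> T (N + x) = (if x \<in> A then x else 0)"
    and A: "A \<subseteq> {1..<N}"
  shows "A = {} \<and> T 1 = 0 \<or> T 1 \<in> A \<and> (\<forall>x\<in>A. K (T 1) \<le> K x)"
proof -
  define S where "S v l = {x\<in>A. (N + x) div 2 ^ l = v}" for v l
  define P where "P v l \<longleftrightarrow> (S v l = {} \<and> T v = 0 \<or> T v \<in> S v l \<and> (\<forall>x\<in>S v l. K (T v) \<le> K x))"
    for v l
  have "\<forall>v. 2 ^ (L - l) \<le> v \<longrightarrow> v < 2 * 2 ^ (L - l) \<longrightarrow> P v l" if "l \<le> L" for l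
    using that
  proof (induction l)
    case 0
    show ?case
    proof (intro allI impI)
      fix v :: nat assume v: "2 ^ (L - 0) \<le> v" "v < 2 * 2 ^ (L - 0)"
      then obtain x where x: "v = N + x" "x < N" using N le_Suc_ex by fastforce
      have "S v 0 = (if x \<in> A then {x} else {})" using x by (auto simp: S_def)
      moreover have "x \<noteq> 0" if "x \<in> A" using A that by auto
      ultimately show "P v 0" using leaf[OF x(2)] x by (auto simp: P_def)
    qed
  next
    case (Suc l)
    show ?case
    proof (intro allI impI)
      fix v :: nat assume v: "2 ^ (L - Suc l) \<le> v" "v < 2 * 2 ^ (L - Suc l)"
      have e: "(2::nat) ^ (L - l) = 2 * 2 ^ (L - Suc l)"
        using Suc.prems by (simp add: Suc_diff_Suc flip: power_Suc)
      have "P (2 * v) l" "P (2 * v + 1) l" using Suc v unfolding e by auto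
      moreover have "S v (Suc l) = S (2 * v) l \<union> S (2 * v + 1) l"
      proof -
        have "a div 2 ^ Suc l = v \<longleftrightarrow> a div 2 ^ l = 2 * v \<or> a div 2 ^ l = 2 * v + 1" for a
        proof -
          have "x div 2 = v \<longleftrightarrow> x = 2 * v \<or> x = 2 * v + 1" for x :: nat by presburger
          then show ?thesis unfolding power_Suc2 div_mult2_eq .
        qed
        then show ?thesis unfolding S_def by auto
      qed
      moreover have "T v = better K (T (2 * v)) (T (2 * v + 1))"
      proof (rule cons)
        have "(2::nat) ^ (L - l) \<le> 2 ^ L" by simp
        then show "v < N" using v e N by linarith
        have "(1::nat) \<le> 2 ^ (L - Suc l)" by simp
        then show "1 \<le> v" using v by linarith
      qed
      moreover have "0 \<notin> S w l" for w using A by (auto simp: S_def)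
      ultimately show "P v (Suc l)"
        unfolding P_def better_def by (auto intro: order.trans less_imp_le)
    qed
  qed
  from this[of L] have "P 1 L" by simp
  moreover have "S 1 L = A"
  proof -
    have "(N + x) div 2 ^ L = 1" if "x < N" for x using that N by simp
    then show ?thesis using A unfolding S_def by auto
  qed
  ultimately show ?thesis by (simp add: P_def)
qed

section \<open>Scanning the boxes in order\<close>

text \<open>
  \<open>js i\<close> is the position of the outermost box of pile \<open>i\<close> (0 if the pile is empty) and \<open>v\<close> the number
  of boxes used, when boxes are added in increasing order of position.
\<close>

inductive reach :: "nat \<Rightarrow> nat \<Rightarrow> (nat \<Rightarrow> nat \<Rightarrow> bool) \<Rightarrow> (nat \<Rightarrow> nat) \<Rightarrow> nat \<Rightarrow> bool"
  for k n le where
  reach_0: "reach k n le (\<lambda>_. 0) 0"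
| reach_step: "reach k n le js v \<Longrightarrow> m < k \<Longrightarrow> 1 \<le> t \<Longrightarrow> t \<le> n \<Longrightarrow> \<forall>i<k. js i < t \<Longrightarrow>
    le (js m) t \<Longrightarrow> reach k n le (js(m := t)) (Suc v)"

lemma reach_le: "reach k n le js v \<Longrightarrow> js i \<le> n"
  by (induction rule: reach.induct) auto

lemma reach_zero: "reach k n le js v \<Longrightarrow> k \<le> i \<Longrightarrow> js i = 0"
  by (induction rule: reach.induct) auto

lemma transp_fits: "transp fits"
proof -
  have "transp (list_all2 ((\<le>) :: nat \<Rightarrow> nat \<Rightarrow> bool))" by (intro list.rel_transp) simp
  then show ?thesis by (simp add: transp_def fits_def)
qed

text \<open>A topological order up to ties: boxes of equal size fit into each other, so
  \<open>topo\<close> cannot forbid that a later box fits into an earlier one, but makes the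
  relation mutual in that case. Position 0 is a virtual box at the bottom of each pile;
  \<open>ord\<close> maps the other positions to indices in the list.\<close>

locale topological =
  fixes n :: nat and bs :: "nat list list" and ord :: "nat \<Rightarrow> nat" and le :: "nat \<Rightarrow> nat \<Rightarrow> bool"
  assumes len: "length bs = n"
    and bij: "bij_betw ord {1..n} {..<n}"
    and le0: "le 0 t"
    and le: "1 \<le> p \<Longrightarrow> p \<le> n \<Longrightarrow> 1 \<le> t \<Longrightarrow> t \<le> n \<Longrightarrow> le p t \<longleftrightarrow> fits (bs ! ord p) (bs ! ord t)"
    and topo: "1 \<le> p \<Longrightarrow> p < t \<Longrightarrow> t \<le> n \<Longrightarrow> le t p \<Longrightarrow> le p t"
begin

text \<open>Each step of \<open>reach\<close> appends box \<open>ord t\<close> to pile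
  \<open>m\<close>. The invariant that pile \<open>i\<close> only uses positions up to
  \<open>js i\<close> makes this box fresh, since \<open>t\<close> exceeds every
  \<open>js i\<close>.\<close>

lemma reach_distribution:
  assumes "reach k n le js v"
  shows "\<exists>piles. distribution k bs piles \<and> length (concat piles) = v \<and>
    (\<forall>i<k. set (piles ! i) \<subseteq> ord ` {1..js i} \<and>
       (if js i = 0 then piles ! i = [] else piles ! i \<noteq> [] \<and> last (piles ! i) = ord (js i)))"
  using assms
proof induction
  case reach_0
  show ?case
    by (intro exI[of _ "replicate k []"]) (simp add: distribution_replicate_Nil)
next
  case (reach_step js v m t)
  then obtain ps where ps: "distribution k bs ps" "length (concat ps) = v"
    and inv: "\<And>i. i < k \<Longrightarrow> set (ps ! i) \<subseteq> ord ` {1..js i} \<and>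
       (if js i = 0 then ps ! i = [] else ps ! i \<noteq> [] \<and> last (ps ! i) = ord (js i))"
    by blast
  have lps: "length ps = k" using ps(1) by (simp add: distribution_def)
  have tn: "t \<in> {1..n}" using reach_step by simp
  have js_t: "js i < t" if "i < k" for i using reach_step that by blast
  let ?p = "ps ! m @ [ord t]"
  let ?ps = "ps[m := ?p]"
  have split: "ps = take m ps @ ps ! m # drop (Suc m) ps"
    using lps reach_step by (simp add: id_take_nth_drop[symmetric])
  have split': "?ps = take m ps @ ?p # drop (Suc m) ps"
    using lps reach_step by (simp add: upd_conv_take_nth_drop)
  have new: "ord t \<notin> set (concat ps)"
  proof
    assume "ord t \<in> set (concat ps)"
    then obtain p where "p \<in> set ps" "ord t \<in> set p" by auto
    then obtain i where "i < k" "ord t \<in> set (ps ! i)"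
      using lps by (metis in_set_conv_nth)
    then obtain p where "p \<in> {1..js i}" "ord p = ord t" using inv by fastforce
    moreover have "p \<in> {1..n}" "p \<noteq> t" using calculation js_t[OF \<open>i < k\<close>] tn by auto
    ultimately show False using bij tn by (meson bij_betw_imp_inj_on inj_onD)
  qed
  let ?A = "concat (take m ps)" and ?B = "concat (drop (Suc m) ps)"
  have c: "concat ps = ?A @ ps ! m @ ?B" by (subst split) simp
  have c': "concat ?ps = ?A @ ps ! m @ ord t # ?B" by (subst split') simp
  have set: "set (concat ?ps) = insert (ord t) (set (concat ps))"
    and l: "length (concat ?ps) = Suc (length (concat ps))"
    and d: "distinct (concat ?ps) \<longleftrightarrow> distinct (ord t # concat ps)"
    unfolding c c' by auto
  have "successively (\<lambda>i j. fits (bs ! i) (bs ! j)) ?p"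
  proof -
    have "successively (\<lambda>i j. fits (bs ! i) (bs ! j)) (ps ! m)"
      using ps(1) lps reach_step(2) by (simp add: distribution_def)
    moreover have "fits (bs ! last (ps ! m)) (bs ! ord t)" if "ps ! m \<noteq> []"
    proof -
      have "js m \<noteq> 0" "last (ps ! m) = ord (js m)" using inv[OF reach_step(2)] that by (auto split: if_splits)
      then show ?thesis using le[of "js m" t] js_t[OF reach_step(2)] tn reach_step by simp
    qed
    ultimately show ?thesis by (auto simp: successively_append_iff)
  qed
  moreover have "set ?ps \<subseteq> insert ?p (set ps)" by (rule set_update_subset_insert)
  moreover have "ord t < n" using bij tn by (auto dest: bij_betwE)
  ultimately have D: "distribution k bs ?ps"
    using ps(1) new set d len unfolding distribution_def by auto
  have L: "length (concat ?ps) = Suc v" using l ps(2) by simp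
  have I: "set (?ps ! i) \<subseteq> ord ` {1..(js(m := t)) i} \<and>
       (if (js(m := t)) i = 0 then ?ps ! i = [] else ?ps ! i \<noteq> [] \<and> last (?ps ! i) = ord ((js(m := t)) i))"
    if "i < k" for i
  proof (cases "i = m")
    case True
    have "set (ps ! m) \<subseteq> ord ` {1..t}"
      using inv[OF reach_step(2)] js_t[OF reach_step(2)] by fastforce
    then show ?thesis using True lps that tn by auto
  next
    case False
    then show ?thesis using inv[OF that] by simp
  qed
  show ?case by (rule exI[of _ ?ps]) (intro conjI D L allI impI I)
qed

text \<open>A distribution is replayed by increasing position. The order inside a pile need not be
  that of positions, but by transitivity any two boxes of a pile are comparable, and
  \<open>topo\<close> turns a comparison in the wrong direction into the right one.\<close>

lemma distribution_reach:
  assumes "distribution k bs ps"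
  shows "\<exists>js. reach k n le js (length (concat ps))"
proof -
  define E where "E m t = {p\<in>{1..t}. ord p \<in> set (ps ! m)}" for m t
  define js where "js t m = (if m < k then Max (insert 0 (E m t)) else 0)" for t m
  have lps: "length ps = k" and dist: "distinct (concat ps)"
    and sub: "set (concat ps) \<subseteq> {..<n}"
    using assms len by (auto simp: distribution_def)
  have finE [simp]: "finite (E m t)" for m t by (simp add: E_def)
  have inj: "p = q" if "ord p = ord q" "p \<in> {1..n}" "q \<in> {1..n}" for p q
    using bij that by (meson bij_betw_imp_inj_on inj_onD)
  have disj: False if "i < j" "j < k" "e \<in> set (ps ! i)" "e \<in> set (ps ! j)" for i j e
  proof -
    have "ps ! i = take j ps ! i" "ps ! j = drop j ps ! 0" using that lps by simp_all
    then have "ps ! i \<in> set (take j ps)" "ps ! j \<in> set (drop j ps)"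
      using that lps by (metis length_take min.absorb4 nth_mem,
        metis length_drop nth_mem zero_less_diff)
    then have "e \<in> set (concat (take j ps))" "e \<in> set (concat (drop j ps))" using that by auto
    moreover have "distinct (concat (take j ps) @ concat (drop j ps))"
      using dist by (metis append_take_drop_id concat_append)
    ultimately show False by auto
  qed
  have uniq: "i = j" if "i < k" "j < k" "e \<in> set (ps ! i)" "e \<in> set (ps ! j)" for i j e
    using disj that by (metis nat_neq_iff)
  have comp: "le p t" if pE: "p \<in> E m n" "t \<in> E m n" and that: "p < t" "m < k" for p t m
  proof -
    have pt: "p \<in> {1..n}" "t \<in> {1..n}" using pE by (auto simp: E_def)
    have "sorted_wrt (\<lambda>i j. fits (bs ! i) (bs ! j)) (ps ! m)"
    proof -
      have "transp (\<lambda>i j. fits (bs ! i) (bs ! j))" using transp_fits by (auto simp: transp_def)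
      then show ?thesis
        using assms lps that(2) by (simp add: distribution_def flip: successively_conv_sorted_wrt)
    qed
    moreover obtain x y where xy: "x < length (ps ! m)" "ps ! m ! x = ord p"
      "y < length (ps ! m)" "ps ! m ! y = ord t"
      using pE unfolding E_def in_set_conv_nth by blast
    moreover have "x \<noteq> y" using inj[OF _ pt] \<open>p < t\<close> xy by auto
    ultimately have "fits (bs ! ord p) (bs ! ord t) \<or> fits (bs ! ord t) (bs ! ord p)"
      unfolding sorted_wrt_iff_nth_less by (metis nat_neq_iff)
    then have "le p t \<or> le t p" using le[of p t] le[of t p] pt by auto
    then show ?thesis using topo[of p t] pt that(1) by auto
  qed
  \<comment> \<open>The boxes used so far are counted as pairs of a pile and a position, so that at
    \<open>t = n\<close> a bijection with the set of all boxes used gives the length.\<close>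
  have R: "reach k n le (js t) (card (SIGMA m:{..<k}. E m t))" if "t \<le> n" for t
    using that
  proof (induction t)
    case 0
    have "js 0 = (\<lambda>_. 0)" by (auto simp: js_def E_def)
    moreover have "(SIGMA m:{..<k}. E m 0) = {}" by (auto simp: E_def)
    ultimately show ?case by (simp add: reach_0)
  next
    case (Suc t)
    have Esuc: "E m (Suc t) = (if ord (Suc t) \<in> set (ps ! m) then insert (Suc t) (E m t) else E m t)"
      for m by (auto simp: E_def le_Suc_eq)
    have jst: "js t m < Suc t" for m
      unfolding js_def by (auto simp: E_def less_Suc_eq_le)
    show ?case
    proof (cases "\<exists>m<k. ord (Suc t) \<in> set (ps ! m)")
      case False
      then have "js (Suc t) = js t" by (auto simp: js_def Esuc)
      moreover have "(SIGMA m:{..<k}. E m (Suc t)) = (SIGMA m:{..<k}. E m t)"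
        using False by (auto simp: Esuc)
      ultimately show ?thesis using Suc.IH Suc.prems by (simp only: Suc_leD)
    next
      case True
      then obtain m where m: "m < k" "ord (Suc t) \<in> set (ps ! m)" by blast
      then have o: "ord (Suc t) \<in> set (ps ! i) \<longleftrightarrow> i = m" if "i < k" for i
        using uniq that by blast
      have "Max (insert 0 (insert (Suc t) (E m t))) = Suc t"
        by (rule Max_eqI) (auto simp: E_def)
      then have 1: "js (Suc t) = (js t)(m := Suc t)"
        using m o by (auto simp: js_def Esuc fun_eq_iff)
      have 2: "(SIGMA m:{..<k}. E m (Suc t)) = insert (m, Suc t) (SIGMA m:{..<k}. E m t)"
        using m o by (auto simp: Esuc split: if_splits)
      have "(m, Suc t) \<notin> (SIGMA m:{..<k}. E m t)" by (auto simp: E_def)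
      then have 3: "card (SIGMA m:{..<k}. E m (Suc t)) = Suc (card (SIGMA m:{..<k}. E m t))"
        unfolding 2 by (intro card_insert_disjoint finite_SigmaI) simp_all
      show ?thesis unfolding 1 3
      proof (rule reach_step)
        show "le (js t m) (Suc t)"
        proof (cases "js t m = 0")
          case False
          then have "js t m \<in> E m t"
            using m Max_in[of "insert 0 (E m t)"] by (auto simp: js_def)
          then show ?thesis using comp[of "js t m" m "Suc t"] jst m Suc.prems
            by (auto simp: E_def)
        qed (simp add: le0)
      qed (use Suc.IH Suc.prems m(1) jst in \<open>simp_all only: Suc_leD, simp_all\<close>)
    qed
  qed
  have "bij_betw (\<lambda>(m, p). ord p) (SIGMA m:{..<k}. E m n) (set (concat ps))"
  proof (intro bij_betw_imageI)
    show "inj_on (\<lambda>(m, p). ord p) (SIGMA m:{..<k}. E m n)"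
    proof (rule inj_onI, clarify)
      fix m p m' p' assume "m < k" "m' < k" "p \<in> E m n" "p' \<in> E m' n" "ord p = ord p'"
      then show "m = m' \<and> p = p'" using inj[of p p'] uniq[of m m' "ord p"] by (auto simp: E_def)
    qed
    have "e \<in> (\<lambda>(m, p). ord p) ` (SIGMA m:{..<k}. E m n)" if e: "e \<in> set (concat ps)" for e
    proof -
      obtain q where q: "q \<in> set ps" "e \<in> set q" using e by auto
      then obtain m where m: "m < k" "e \<in> set (ps ! m)"
        using lps by (metis in_set_conv_nth)
      have "e \<in> ord ` {1..n}" using e sub bij_betw_imp_surj_on[OF bij] by blast
      then obtain p where p: "p \<in> {1..n}" "e = ord p" by blast
      show ?thesis using m p by (intro image_eqI[of _ _ "(m, p)"]) (auto simp: E_def)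
    qed
    moreover have "ord p \<in> set (concat ps)" if "m < k" "p \<in> E m n" for m p
      using that lps by (auto simp: E_def)
    ultimately show "(\<lambda>(m, p). ord p) ` (SIGMA m:{..<k}. E m n) = set (concat ps)" by auto
  qed
  then have "card (SIGMA m:{..<k}. E m n) = length (concat ps)"
    by (rule trans[OF bij_betw_same_card distinct_card[OF dist]])
  with R[OF order.refl] have "reach k n le (js n) (length (concat ps))" by (simp only:)
  then show ?thesis by (rule exI[of _ "js n"])
qed

lemma max_nested_boxes_eqI:
  assumes "reach k n le js v" "\<And>js' v'. reach k n le js' v' \<Longrightarrow> v' \<le> v"
  shows "max_nested_boxes k bs = v"
proof (rule antisym)
  from reach_distribution[OF assms(1)]
  obtain ps where "distribution k bs ps" "length (concat ps) = v" by (elim exE conjE)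
  then show "v \<le> max_nested_boxes k bs" using max_nested_boxes_ge[of k bs ps] by simp
  from max_nested_boxes_attained[of k bs]
  obtain ps where ps: "distribution k bs ps" "length (concat ps) = max_nested_boxes k bs"
    by (elim exE conjE)
  from distribution_reach[OF ps(1)] obtain js where "reach k n le js (max_nested_boxes k bs)"
    unfolding ps(2) by (elim exE)
  then show "max_nested_boxes k bs \<le> v" by (rule assms(2))
qed

end

section \<open>Dominance queries\<close>

definition At :: "exp \<Rightarrow> exp \<Rightarrow> exp" where
  "At tg e = Bin Add (Bin Mult tg (Reg 4)) e"

lemma cost_At [simp]: "cost (At tg e) = 3 + cost tg + cost e"
  by (simp add: At_def)

notation Seq (infixr ";;" 60)

text \<open>Register 34 is a vector of levels in base \<open>L\<close>, 32 a box and 35 the shift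
  \<delta>. The tuple of nodes is accumulated in 36; 37 stays 1 as long as every node seen has an
  odd number, that is, is a right child.\<close>

definition node_prog :: "nat \<Rightarrow> com" where
  "node_prog d =
    Assign 36 (Const 0) ;; Assign 37 (Const 1) ;; Assign 39 (Reg 34) ;;
    For 38 (Const d)
      (Assign 40 (Bin Div
          (Bin Add (Bin Add (Reg 5) (Load (At (Const 5) (Bin Add (Bin Mult (Reg 38) (Reg 5)) (Reg 32))))) (Reg 35))
          (Load (At (Const 2) (Bin Mod (Reg 39) (Reg 2))))) ;;
       Assign 36 (Bin Add (Bin Mult (Reg 36) (Bin Add (Reg 5) (Reg 5))) (Bin Sub (Reg 40) (Reg 35))) ;;
       Assign 37 (Bin BitAnd (Reg 37) (Bin Mod (Reg 40) (Const 2))) ;;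
       Assign 39 (Bin Div (Reg 39) (Reg 2)))"

text \<open>Register 30 is the region, 31 the code of the other piles, 32 the box and 33 the value.
  All \<open>L ^ d\<close> vectors of levels are visited, so the value reaches every tuple of proper
  or improper ancestors below the roots.\<close>

definition update_prog :: "nat \<Rightarrow> com" where
  "update_prog d =
    Assign 35 (Const 0) ;;
    For 34 (Reg 3)
      (node_prog d ;;
       Assign 43 (At (Reg 30) (Bin Add (Bin Mult (Reg 31) (Reg 6)) (Reg 36))) ;;
       Cond (Bin Less (Load (Reg 43)) (Reg 33)) (Store (Reg 43) (Reg 33)) Skip)"

definition query_prog :: "nat \<Rightarrow> com" where
  "query_prog d =
    Assign 33 (Const 0) ;; Assign 35 (Const 1) ;;
    For 34 (Reg 3)
      (node_prog d ;;
       Assign 43 (At (Reg 30) (Bin Add (Bin Mult (Reg 31) (Reg 6)) (Reg 36))) ;;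
       Cond (Bin BitAnd (Reg 37) (Bin Less (Reg 33) (Load (Reg 43))))
        (Assign 33 (Load (Reg 43))) Skip)"

text \<open>Any pile may be the next one to grow, so the tuple in register 20, with its value in 21,
  is entered into the tables of all \<open>k\<close> piles.\<close>

definition insert_prog :: "nat \<Rightarrow> nat \<Rightarrow> com" where
  "insert_prog k d =
    Assign 23 (Const 1) ;;
    For 22 (Const k)
      (Assign 24 (Bin Mod (Bin Div (Reg 20) (Reg 23)) (Reg 5)) ;;
       Assign 30 (Bin Add (Const 7) (Reg 22)) ;;
       Assign 31 (Bin Sub (Reg 20) (Bin Mult (Reg 24) (Reg 23))) ;;
       Assign 32 (Load (At (Const 4) (Reg 24))) ;;
       Assign 33 (Reg 21) ;;
       update_prog d ;;
       Assign 23 (Bin Mult (Reg 23) (Reg 5)))"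

lemma and_of_bool: "and (of_bool P) (of_bool Q :: nat) = of_bool (P \<and> Q)"
  by (cases P; cases Q) simp_all

text \<open>
  Address \<open>adr a y\<close> is cell \<open>y < M\<close> of region \<open>a\<close>. The regions are: 0 the input, 2 the powers of two,
  3 the sort keys, 4 the boxes in the order of processing, 5 the ranks, 6 the tournament tree,
  \<open>7 + i\<close> the table of pile \<open>i\<close>. Boxes are numbered from 1; box 0 stands for the bottom of a pile.
  Registers below 10 hold the constants listed in \<open>glob\<close>. A subprogram only changes registers above
  those of its callers, so that most specifications say which initial segment of the registers is kept.
\<close>

locale ram =
  fixes w k d n L :: nat
  assumes k1: "1 \<le> k" and d1: "1 \<le> d" and nL: "n + 2 \<le> 2 ^ L"
    and big: "(8 + k + d) * (2 * 2 ^ L) ^ (k + d) < 2 ^ w"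
begin

definition N :: nat where "N = 2 ^ L"
text \<open>A region has to hold \<open>D\<close> nodes for each of \<open>N ^ k\<close> codes,
  whence the exponent. Together with \<open>big\<close>, which provides for \<open>8 + k + d\<close>
  regions, this keeps addresses and intermediate results from wrapping around.\<close>

definition M :: nat where "M = (2 * N) ^ (k + d)"
definition D :: nat where "D = (2 * N) ^ d"
definition adr :: "nat \<Rightarrow> nat \<Rightarrow> nat" where "adr a x = a * M + x"

text \<open>Leaves 0 to \<open>n + 1\<close> are needed: ranks go up to \<open>n\<close>, and
  queries look at the next leaf.\<close>

lemma nN: "n + 2 \<le> N" using nL by (simp add: N_def)
lemma N2: "2 \<le> N" using nN by simp
lemma L1: "1 \<le> L" using nL by (cases "L = 0") auto
lemma LN: "L < N" by (simp add: N_def)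

lemma pow_le: "a \<le> k \<Longrightarrow> b \<le> d \<Longrightarrow> N ^ a * (2 * N) ^ b \<le> M"
proof -
  assume "a \<le> k" "b \<le> d"
  then have "N ^ a \<le> N ^ k" "(2 * N) ^ b \<le> (2 * N) ^ d"
    using N2 by (intro power_increasing; simp)+
  moreover have "N ^ k \<le> (2 * N) ^ k" by (intro power_mono) auto
  ultimately show ?thesis unfolding M_def power_add by (intro mult_le_mono) linarith+
qed

lemma N2M: "4 * N \<le> M"
proof -
  have "(2 * N) ^ 2 \<le> M" unfolding M_def using N2 k1 d1 by (intro power_increasing) auto
  moreover have "4 * N \<le> (2 * N) ^ 2" using N2 by (simp add: power2_eq_square)
  ultimately show ?thesis by linarith
qed

lemma M8: "8 \<le> M" using N2M N2 by simp

lemma powN: "N ^ k < M" "D < M"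
proof -
  have "N ^ k < (2 * N) ^ k" using N2 k1 by (intro power_strict_mono) auto
  also have "\<dots> \<le> M" unfolding M_def using N2 by (intro power_increasing) auto
  finally show "N ^ k < M" .
  show "D < M" unfolding M_def D_def using N2 k1 d1 by (intro power_strict_increasing) auto
qed

text \<open>Since \<open>d \<le> 2 ^ d\<close>, a region has room for \<open>d\<close> rows of
  \<open>N\<close> ranks, and also for the \<open>n * d\<close> words of input.\<close>

lemma dN: "d * N \<le> D"
proof -
  have "d \<le> 2 ^ d" using less_exp[of d] by simp
  moreover have "N ^ 1 \<le> N ^ d" using N2 d1 by (intro power_increasing) auto
  ultimately show ?thesis unfolding D_def power_mult_distrib by (intro mult_le_mono) auto
qed

lemma rkM: "c < d \<Longrightarrow> u < N \<Longrightarrow> c * N + u < M"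
proof -
  assume "c < d" "u < N"
  then have "c * N + u < (c + 1) * N" by simp
  also have "\<dots> \<le> d * N" using \<open>c < d\<close> by (intro mult_le_mono1) simp
  finally show ?thesis using dN powN by linarith
qed

lemma lim: "x \<le> (8 + k + d) * M \<Longrightarrow> x < 2 ^ w"
  using big by (simp add: M_def N_def)

lemma limM: "x \<le> 8 * M \<Longrightarrow> x < 2 ^ w"
  by (rule lim) (simp add: add_mult_distrib)

lemma w0: "0 < w" using limM[of 1] M8 by (cases w) auto

lemma kdw: "k + d < 2 ^ w"
proof (rule lim)
  have "(k + d) * 1 \<le> (8 + k + d) * M" using M8 by (intro mult_le_mono) auto
  then show "k + d \<le> (8 + k + d) * M" by simp
qed

lemma ev_kd [simp]: "eval w (Const k) s = k" "eval w (Const d) s = d" "eval w (Const (k + d)) s = k + d"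
  "eval w (Const (k - 1)) s = k - 1"
  using kdw by (simp_all)
lemma ev_Const8: "a \<le> 8 \<Longrightarrow> eval w (Const a) s = a"
  using limM[of a] M8 by simp

text \<open>Up to \<open>8 * M\<close> the modular operations are exact. The defining equations of
  addition, subtraction and multiplication are removed from the simplifier below, so that each
  evaluation comes with a proof that nothing wraps around.\<close>

lemma ev_Add: "a \<le> 4 * M \<Longrightarrow> b \<le> 4 * M \<Longrightarrow> eval_binop w Add a b = a + b"
  using limM[of "a + b"] by simp
lemma ev_Mult: "a * b \<le> 8 * M \<Longrightarrow> eval_binop w Mult a b = a * b"
  using limM[of "a * b"] by simp
lemma ev_Sub: "b \<le> a \<Longrightarrow> a \<le> 8 * M \<Longrightarrow> eval_binop w Sub a b = a - b"
  using limM[of a] by (simp add: eval_binop_Sub del: eval_binop.simps)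
lemma ev_Less: "eval_binop w Less a b = of_bool (a < b)"
  and ev_Equal: "eval_binop w Equal a b = of_bool (a = b)"
  using w0 by (simp_all add: of_bool_mod)

lemma ev_At: "r 4 = M \<Longrightarrow> eval w tg (r, m) < 7 + k \<Longrightarrow> eval w e (r, m) < M \<Longrightarrow>
    eval w (At tg e) (r, m) = adr (eval w tg (r, m)) (eval w e (r, m))"
proof -
  assume a: "r 4 = M" "eval w tg (r, m) < 7 + k" "eval w e (r, m) < M"
  have "eval w tg (r, m) * M + eval w e (r, m) < 2 ^ w"
  proof (rule lim)
    have "eval w tg (r, m) * M \<le> (7 + k) * M" using a by (intro mult_le_mono1) simp
    then show "eval w tg (r, m) * M + eval w e (r, m) \<le> (8 + k + d) * M"
      using a unfolding add_mult_distrib by linarith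
  qed
  then show ?thesis using a by (simp add: At_def adr_def)
qed

lemma adr_eq: "x < M \<Longrightarrow> y < M \<Longrightarrow> adr a x = adr b y \<longleftrightarrow> a = b \<and> x = y"
proof -
  assume "x < M" "y < M"
  then have "adr a x div M = a" "adr b y div M = b" "adr a x mod M = x" "adr b y mod M = y"
    by (simp_all add: adr_def)
  then show ?thesis by metis
qed

lemmas ev = ev_Const8 ev_Less ev_Equal ev_At

declare eval_binop.simps [simp del] eval_binop.simps(4-8) [simp]
declare eval.simps(1) [simp del]

definition glob :: "(nat \<Rightarrow> nat) \<Rightarrow> bool" where
  "glob r \<longleftrightarrow> r 0 = n \<and> r 5 = N \<and> r 2 = L \<and> r 3 = L ^ d \<and> r 4 = M \<and> r 6 = D \<and> r 7 = N ^ (k - 1)"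

lemma glob_cong: "glob r \<Longrightarrow> (\<And>i. i < 10 \<Longrightarrow> r' i = r i) \<Longrightarrow> glob r'"
  by (simp add: glob_def)

text \<open>
  \<open>nodev x \<delta> l c\<close> is the ancestor of leaf \<open>x c + \<delta>\<close> in heap numbering, on the level given by digit \<open>c\<close>
  of \<open>l\<close> in base \<open>L\<close>. Insertions use \<open>\<delta> = 0\<close>; queries use \<open>\<delta> = 1\<close>, which turns \<open>\<le>\<close> into \<open><\<close>, and move
  from a right child \<open>v\<close> to its sibling \<open>v - 1\<close>.
\<close>

definition nodev :: "(nat \<Rightarrow> nat) \<Rightarrow> nat \<Rightarrow> nat \<Rightarrow> nat \<Rightarrow> nat" where
  "nodev x \<delta> l c = (N + x c + \<delta>) div 2 ^ dig L l c"
definition nodez :: "(nat \<Rightarrow> nat) \<Rightarrow> nat \<Rightarrow> nat \<Rightarrow> nat" where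
  "nodez x \<delta> l = horner (2 * N) (\<lambda>c. nodev x \<delta> l c - \<delta>) d"
definition nodeok :: "(nat \<Rightarrow> nat) \<Rightarrow> nat \<Rightarrow> nat \<Rightarrow> bool" where
  "nodeok x \<delta> l \<longleftrightarrow> (\<forall>c<d. odd (nodev x \<delta> l c))"

lemma dig_L: "dig L l c < L" using L1 by (simp add: dig_def)

lemma nodev_bounds: "x c + \<delta> < N \<Longrightarrow> 2 \<le> nodev x \<delta> l c \<and> nodev x \<delta> l c < 2 * N"
proof
  assume x: "x c + \<delta> < N"
  have "Suc (dig L l c) \<le> L" using dig_L by (simp add: Suc_leI)
  then have "(2::nat) ^ Suc (dig L l c) \<le> N" unfolding N_def by (intro power_increasing) simp_all
  then have "2 * 2 ^ dig L l c \<le> N + x c + \<delta>" by simp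
  then show "2 \<le> nodev x \<delta> l c" unfolding nodev_def
    by (simp add: less_eq_div_iff_mult_less_eq)
  show "nodev x \<delta> l c < 2 * N" unfolding nodev_def using x
    by (intro le_less_trans[OF div_le_dividend]) simp
qed

lemma nodez_less: "(\<And>c. c < d \<Longrightarrow> x c + \<delta> < N) \<Longrightarrow> nodez x \<delta> l < D"
  unfolding nodez_def D_def using nodev_bounds by (intro horner_less) (meson diff_le_self le_less_trans)

definition pow_ok :: "(nat \<Rightarrow> nat) \<Rightarrow> bool" where
  "pow_ok m \<longleftrightarrow> (\<forall>l<L. m (adr 2 l) = 2 ^ l)"

lemma node_spec:
  assumes g: "glob r" and p: "pow_ok m" and x: "\<And>c. c < d \<Longrightarrow> x c = m (adr 5 (c * N + r 32))"
    and xN: "\<And>c. c < d \<Longrightarrow> x c + r 35 < N" and d: "r 35 \<le> 1" and u: "r 32 < N"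
  shows "runs w (node_prog d) r m 0 (\<lambda>t r' m'. t \<le> 80 * d + 20 \<and> m' = m \<and> (\<forall>i<36. r' i = r i) \<and>
     r' 36 = nodez x (r 35) (r 34) \<and> r' 37 = of_bool (nodeok x (r 35) (r 34)))"
proof -
  let ?v = "\<lambda>c. nodev x (r 35) (r 34) c"
  let ?h = "\<lambda>i. horner (2 * N) (\<lambda>c. ?v c - r 35) i"
  let ?I = "\<lambda>i r' m'. m' = m \<and> (\<forall>i<36. r' i = r i) \<and> r' 38 = i \<and> i \<le> d \<and>
     r' 36 = ?h i \<and> r' 37 = of_bool (\<forall>c<i. odd (?v c)) \<and> r' 39 = r 34 div L ^ i"
  \<comment> \<open>The partial code has to stay below \<open>M\<close> even after multiplication by
    \<open>2 * N\<close>, so that the exact rules of arithmetic apply.\<close>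
  have hl: "?h i < (2 * N) ^ i" "?h i * (2 * N) < M" "?v i - r 35 < 2 * N" if "i < d" for i
  proof -
    show a: "?h i < (2 * N) ^ i"
      using nodev_bounds xN that by (intro horner_less) (meson diff_le_self le_less_trans less_trans)
    show "?v i - r 35 < 2 * N" using nodev_bounds[of x i "r 35" "r 34", OF xN[OF that]] by linarith
    have "?h i * (2 * N) \<le> (2 * N) ^ i * (2 * N)" using a by (intro mult_le_mono1) simp
    also have "\<dots> = (2 * N) ^ Suc i" by simp
    also have "\<dots> \<le> D" unfolding D_def using that N2 by (intro power_increasing) auto
    also have "\<dots> < M" by (rule powN)
    finally show "?h i * (2 * N) < M" .
  qed
  show ?thesis
    unfolding node_prog_def runs_Seq runs_Assign
  proof (rule runs_For[where I = ?I and B = d and T = 60], goal_cases)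
    case (4 i r' m')
    then have i: "i < d" and I: "?I i r' m'" by blast+
    have r: "r' 5 = N" "r' 2 = L" "r' 4 = M" "r' 32 = r 32" "r' 35 = r 35"
      using I g by (auto simp: glob_def)
    have iN: "i * N + r 32 < M" using rkM i u by blast
    have iN': "i * N \<le> M" using iN by linarith
    have mL: "r 34 div L ^ i mod L < L" using L1 by simp
    have rM: "r 34 div L ^ i mod L < M" using mL LN N2M by linarith
    have pw: "m (adr 2 (r 34 div L ^ i mod L)) = 2 ^ dig L (r 34) i"
      using p mL by (simp add: pow_ok_def dig_def)
    have xm: "m (adr 5 (i * N + r 32)) = x i" using x[OF i] by simp
    have NM: "N \<le> M" "x i \<le> M" "r 35 \<le> M" "N + x i \<le> M" "r 32 \<le> M" "i \<le> d"
      using N2M N2 xN[OF i] d u i by linarith+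
    have vb: "r 35 \<le> ?v i" "?v i \<le> M"
      using nodev_bounds[of x i "r 35" "r 34", OF xN[OF i]] NM N2M d by linarith+
    have v: "(N + x i + r 35) div 2 ^ dig L (r 34) i = ?v i" by (rule nodev_def[symmetric])
    have h: "?h i * (N + N) \<le> M" "?h (Suc i) = ?h i * (N + N) + (?v i - r 35)"
      using hl[OF i] by (simp_all add: mult_2)
    have e: "r 34 div L ^ i div L = r 34 div L ^ Suc i"
      by (simp add: div_mult2_eq mult.commute[of L])
    have E: "eval_binop w Mult i N = i * N" "eval_binop w Add (i * N) (r 32) = i * N + r 32"
      "eval_binop w Add N (x i) = N + x i" "eval_binop w Add (N + x i) (r 35) = N + x i + r 35"
      "eval_binop w Add N N = N + N" "eval_binop w Mult (?h i) (N + N) = ?h i * (N + N)"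
      "eval_binop w Sub (?v i) (r 35) = ?v i - r 35"
      "eval_binop w Add (?h i * (N + N)) (?v i - r 35) = ?h (Suc i)"
      unfolding h(2) using iN iN' NM vb h(1) N2M
      by (intro ev_Add ev_Mult ev_Sub; linarith)+
    have b: "and (of_bool (\<forall>c<i. odd (?v c))) (?v i mod 2) = of_bool (\<forall>c<Suc i. odd (?v c))"
    proof -
      have "(\<forall>c<Suc i. odd (?v c)) \<longleftrightarrow> (\<forall>c<i. odd (?v c)) \<and> odd (?v i)"
        by (auto simp: less_Suc_eq)
      then show ?thesis by (simp only: and_of_bool mod_2_eq_odd)
    qed
    have r1: "r 5 = N" "r 2 = L" "r 4 = M" using g by (simp_all add: glob_def)
    show ?case
      using I i
      by (simp add: ev r r1 xm v e E pw iN rM b del: horner.simps power_Suc)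
  next
    case (5 t' r' m')
    then show ?case by (simp add: nodez_def nodeok_def)
  qed (use kdw in \<open>simp_all add: ev\<close>)
qed

definition cell :: "nat \<Rightarrow> nat \<Rightarrow> nat \<Rightarrow> nat" where
  "cell i J z = adr (7 + i) (J * D + z)"

lemma cell_bound: "J < N ^ k \<Longrightarrow> z < D \<Longrightarrow> J * D + z < M"
proof -
  assume "J < N ^ k" "z < D"
  then have "J * D + z < (J + 1) * D" by simp
  also have "\<dots> \<le> N ^ k * D" using \<open>J < N ^ k\<close> by (intro mult_le_mono1) simp
  also have "\<dots> \<le> M" unfolding D_def by (rule pow_le) simp_all
  finally show ?thesis .
qed

lemma cell_eq: "J < N ^ k \<Longrightarrow> z < D \<Longrightarrow> J' < N ^ k \<Longrightarrow> z' < D \<Longrightarrow>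
    cell i J z = cell i' J' z' \<longleftrightarrow> i = i' \<and> J = J' \<and> z = z'"
proof -
  assume a: "J < N ^ k" "z < D" "J' < N ^ k" "z' < D"
  let ?B = "D"
  have "(J * ?B + z) div ?B = J" "(J * ?B + z) mod ?B = z"
    "(J' * ?B + z') div ?B = J'" "(J' * ?B + z') mod ?B = z'" using a by simp_all
  then have "J * ?B + z = J' * ?B + z' \<longleftrightarrow> J = J' \<and> z = z'" by metis
  then show ?thesis using a by (simp add: cell_def adr_eq cell_bound)
qed

lemma cell_low: "a < 7 \<Longrightarrow> y < M \<Longrightarrow> J < N ^ k \<Longrightarrow> z < D \<Longrightarrow> adr a y \<noteq> cell i J z"
  by (simp add: cell_def adr_eq cell_bound)

text \<open>Written as a condition on the cell: \<open>max\<close> is idempotent, so it makes no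
  difference whether two level vectors lead to the same cell.\<close>

definition upd :: "(nat \<Rightarrow> nat) \<Rightarrow> nat \<Rightarrow> nat \<Rightarrow> (nat \<Rightarrow> nat) \<Rightarrow> nat \<Rightarrow> nat \<Rightarrow> nat \<Rightarrow> nat" where
  "upd m i J x v B = (\<lambda>a. if \<exists>l<B. a = cell i J (nodez x 0 l) then max (m a) v else m a)"

lemma upd_low:
  assumes "\<And>c. c < d \<Longrightarrow> x c < N" "J < N ^ k" "a < 7" "y < M"
  shows "upd m i J x v B (adr a y) = m (adr a y)"
proof -
  have "nodez x 0 l < D" for l using assms(1) by (intro nodez_less) simp
  then show ?thesis using cell_low assms by (auto simp: upd_def)
qed

lemma upd_Suc: "upd m i J x v (Suc B) =
    (let a = cell i J (nodez x 0 B); m' = upd m i J x v B in m'(a := max (m' a) v))"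
  by (auto simp: upd_def fun_eq_iff less_Suc_eq Let_def)

lemma Ld: "L ^ d \<le> M"
proof -
  have "L ^ d \<le> D" unfolding D_def using LN by (intro power_mono) auto
  then show ?thesis using powN by linarith
qed

lemma pow_ok_cong: "pow_ok m \<Longrightarrow> (\<And>y. y < M \<Longrightarrow> m' (adr 2 y) = m (adr 2 y)) \<Longrightarrow> pow_ok m'"
  using LN N2M by (auto simp: pow_ok_def)

lemma cell_expr:
  assumes "glob r" "r 30 = 7 + i" "i < k" "r 31 < N ^ k" "r 36 < D"
  shows "eval w (At (Reg 30) (Bin Add (Bin Mult (Reg 31) (Reg 6)) (Reg 36))) (r, m) =
    cell i (r 31) (r 36)"
proof -
  have r: "r 4 = M" "r 6 = D" using assms by (simp_all add: glob_def)
  have "r 31 * D + r 36 < M" using assms by (intro cell_bound)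
  moreover then have "eval_binop w Mult (r 31) D = r 31 * D"
     "eval_binop w Add (r 31 * D) (r 36) = r 31 * D + r 36"
    by (intro ev_Mult ev_Add; linarith)+
  ultimately show ?thesis using assms(2,3)
    by (simp add: ev r cell_def del: power_mult_distrib)
qed

lemma update_spec:
  assumes g: "glob r" and p: "pow_ok m" and x: "\<And>c. c < d \<Longrightarrow> x c = m (adr 5 (c * N + r 32))"
    and xN: "\<And>c. c < d \<Longrightarrow> x c < N" and u: "r 32 < N"
    and i: "r 30 = 7 + i" "i < k" and J: "r 31 < N ^ k"
  shows "runs w (update_prog d) r m 0 (\<lambda>t r' m'. t \<le> L ^ d * (80 * d + 60) + 10 \<and>
     (\<forall>j<34. r' j = r j) \<and> m' = upd m i (r 31) x (r 33) (L ^ d))"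
proof -
  let ?I = "\<lambda>l r' m'. (\<forall>j<34. r' j = r j) \<and> r' 34 = l \<and> r' 35 = 0 \<and>
    m' = upd m i (r 31) x (r 33) l"
  show ?thesis
    unfolding update_prog_def runs_Seq runs_Assign
  proof (rule runs_For[where I = ?I and B = "L ^ d" and T = "80 * d + 50"], goal_cases)
    case 1
    then show ?case by (simp add: upd_def ev)
  next
    case 2
    then show ?case using Ld by (intro limM) linarith
  next
    case (3 l r' m')
    then show ?case using g by (simp add: glob_def)
  next
    case (4 l r' m')
    then have r': "\<And>j. j < 34 \<Longrightarrow> r' j = r j" "r' 34 = l" "r' 35 = 0"
      and m': "m' = upd m i (r 31) x (r 33) l" by blast+
    have low: "m' (adr a y) = m (adr a y)" if "a < 7" "y < M" for a y
      unfolding m' using xN J that by (rule upd_low)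
    have g': "glob r'" using g r' by (auto intro: glob_cong)
    show ?case unfolding runs_Seq
    proof (rule runs_conseq[OF node_spec[where x = x, OF g']], goal_cases)
      case 1
      then show ?case using p low by (auto intro: pow_ok_cong)
    next
      case (2 c)
      then show ?case using x low rkM u r' by simp
    next
      case (6 t r'' m'')
      then have r'': "\<And>j. j < 36 \<Longrightarrow> r'' j = r' j" "m'' = m'" "r'' 36 = nodez x 0 l" "t \<le> 80 * d + 20"
        using r' by auto
      let ?a = "cell i (r 31) (nodez x 0 l)"
      have z: "nodez x 0 l < D" using xN by (intro nodez_less) simp
      have e: "eval w (At (Reg 30) (Bin Add (Bin Mult (Reg 31) (Reg 6)) (Reg 36))) (r'', m'') = ?a"
        using cell_expr[of r'' i m''] g' i J r' r'' z glob_cong[OF g', of r''] by simp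
      have "max (m' ?a) (r 33) = (if m' ?a < r 33 then r 33 else m' ?a)" by simp
      then have s: "upd m i (r 31) x (r 33) (Suc l) = (if m' ?a < r 33 then m'(?a := r 33) else m')"
        unfolding upd_Suc m'[symmetric] Let_def by auto
      show ?case unfolding runs_Assign runs_Cond runs_Seq e
        using r' r'' s by (simp add: ev)
    qed (use r' u xN in auto)
  next
    case (5 t' r' m')
    then show ?case by (simp add: algebra_simps)
  qed
qed

text \<open>The maximum is described in two halves, an upper bound and a witness unless the result
  is 0. They become completeness and soundness in \<open>query_trie\<close>.\<close>

lemma query_spec:
  assumes g: "glob r" and p: "pow_ok m" and x: "\<And>c. c < d \<Longrightarrow> x c = m (adr 5 (c * N + r 32))"
    and xN: "\<And>c. c < d \<Longrightarrow> x c + 1 < N" and u: "r 32 < N"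
    and i: "r 30 = 7 + i" "i < k" and J: "r 31 < N ^ k"
  shows "runs w (query_prog d) r m 0 (\<lambda>t r' m'. t \<le> L ^ d * (80 * d + 60) + 10 \<and>
     (\<forall>j<33. r' j = r j) \<and> m' = m \<and>
     (\<forall>l<L ^ d. nodeok x 1 l \<longrightarrow> m (cell i (r 31) (nodez x 1 l)) \<le> r' 33) \<and>
     (r' 33 = 0 \<or> (\<exists>l<L ^ d. nodeok x 1 l \<and> r' 33 = m (cell i (r 31) (nodez x 1 l)))))"
proof -
  let ?a = "\<lambda>l. cell i (r 31) (nodez x 1 l)"
  let ?I = "\<lambda>b r' m'. (\<forall>j<33. r' j = r j) \<and> r' 34 = b \<and> r' 35 = 1 \<and> m' = m \<and>
    (\<forall>l<b. nodeok x 1 l \<longrightarrow> m (?a l) \<le> r' 33) \<and> (r' 33 = 0 \<or> (\<exists>l<b. nodeok x 1 l \<and> r' 33 = m (?a l)))"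
  show ?thesis
    unfolding query_prog_def runs_Seq runs_Assign
  proof (rule runs_For[where I = ?I and B = "L ^ d" and T = "80 * d + 50"], goal_cases)
    case 1
    then show ?case by (simp add: ev)
  next
    case 2
    then show ?case using Ld by (intro limM) linarith
  next
    case (3 l r' m')
    then show ?case using g by (simp add: glob_def)
  next
    case (4 l r' m')
    then have r': "\<And>j. j < 33 \<Longrightarrow> r' j = r j" "r' 34 = l" "r' 35 = 1" "m' = m"
      and b: "\<And>j. j < l \<Longrightarrow> nodeok x 1 j \<Longrightarrow> m (?a j) \<le> r' 33"
       "r' 33 = 0 \<or> (\<exists>j<l. nodeok x 1 j \<and> r' 33 = m (?a j))" by blast+
    have g': "glob r'" using g r' by (auto intro: glob_cong)
    show ?case unfolding runs_Seq
    proof (rule runs_conseq[OF node_spec[where x = x, OF g']], goal_cases)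
      case (6 t r'' m'')
      then have r'': "\<And>j. j < 36 \<Longrightarrow> r'' j = r' j" "m'' = m" "r'' 36 = nodez x 1 l" "t \<le> 80 * d + 20"
        "r'' 37 = of_bool (nodeok x 1 l)"
        using r' by auto
      have z: "nodez x 1 l < D" using xN by (intro nodez_less) simp
      have e: "eval w (At (Reg 30) (Bin Add (Bin Mult (Reg 31) (Reg 6)) (Reg 36))) (r'', m'') = ?a l"
        using cell_expr[of r'' i m''] g' i J r' r'' z glob_cong[OF g', of r''] by simp
      show ?case
      proof (cases "nodeok x 1 l \<and> r' 33 < m (?a l)")
        case True
        have "\<forall>j<Suc l. nodeok x 1 j \<longrightarrow> m (?a j) \<le> m (?a l)"
          using b(1) True by (auto simp: less_Suc_eq dest: order.strict_trans2 less_imp_le intro: order.trans)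
        moreover have "\<exists>j<Suc l. nodeok x 1 j \<and> m (?a l) = m (?a j)" using True by blast
        ultimately show ?thesis unfolding runs_Assign runs_Cond runs_Seq e
          using r' r'' True by (simp add: ev and_of_bool)
      next
        case False
        then have "\<forall>j<Suc l. nodeok x 1 j \<longrightarrow> m (?a j) \<le> r' 33"
          using b(1) by (auto simp: less_Suc_eq)
        moreover have "r' 33 = 0 \<or> (\<exists>j<Suc l. nodeok x 1 j \<and> r' 33 = m (?a j))"
          using b(2) less_Suc_eq by blast
        ultimately show ?thesis unfolding runs_Assign runs_Cond runs_Seq e
          using r' r'' False by (simp add: ev and_of_bool del: de_Morgan_conj)
      qed
    qed (use r' u xN x p in auto)
  next
    case (5 t' r' m')
    then show ?case by (simp add: algebra_simps)
  qed
qed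

end

section \<open>Tables of tuples and correctness of dominance queries\<close>

context ram begin

text \<open>The code of \<open>J\<close> with entry \<open>i\<close> replaced by 0. It names the
  other piles and selects the part of table \<open>i\<close> to be searched.\<close>

definition rst :: "nat \<Rightarrow> nat \<Rightarrow> nat" where
  "rst J i = J - dig N J i * N ^ i"

lemma dig_le: "dig N J i * N ^ i \<le> J"
proof -
  have "dig N J i * N ^ i \<le> J div N ^ i * N ^ i" unfolding dig_def by (intro mult_le_mono1) simp
  also have "\<dots> \<le> J" by simp
  finally show ?thesis .
qed

text \<open>\<open>X p c\<close> is the rank in coordinate \<open>c\<close> of the box at position
  \<open>p\<close>, position 0 included. Queries shift the rank by 1, which is why
  \<open>X p c + 1\<close> has to be below \<open>N\<close>.\<close>

definition prep :: "(nat \<Rightarrow> nat) \<Rightarrow> (nat \<Rightarrow> nat \<Rightarrow> nat) \<Rightarrow> bool" where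
  "prep m X \<longleftrightarrow> pow_ok m \<and> (\<forall>p\<le>n. m (adr 4 p) < N \<and>
     (\<forall>c<d. X p c = m (adr 5 (c * N + m (adr 4 p))) \<and> X p c + 1 < N))"

lemma nM: "p \<le> n \<Longrightarrow> p < M" using nN N2M by linarith

lemma prep_cong:
  assumes "prep m X" "\<And>a y. a < 7 \<Longrightarrow> y < M \<Longrightarrow> m' (adr a y) = m (adr a y)"
  shows "prep m' X"
proof -
  have "m' (adr 4 p) = m (adr 4 p)" if "p \<le> n" for p using assms nM that by simp
  note o = this
  show ?thesis unfolding prep_def
  proof (intro conjI allI impI)
    show "pow_ok m'" using assms pow_ok_cong[of m m'] unfolding prep_def by simp
    fix p assume "p \<le> n"
    then have p: "m (adr 4 p) < N" "m' (adr 4 p) = m (adr 4 p)"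
      "\<And>c. c < d \<Longrightarrow> X p c = m (adr 5 (c * N + m (adr 4 p))) \<and> X p c + 1 < N"
      using assms(1) o unfolding prep_def by blast+
    then show "m' (adr 4 p) < N" by simp
    fix c assume "c < d"
    moreover have "m' (adr 5 (c * N + m (adr 4 p))) = m (adr 5 (c * N + m (adr 4 p)))"
      using assms(2) rkM[OF \<open>c < d\<close> p(1)] by simp
    ultimately show "X p c = m' (adr 5 (c * N + m' (adr 4 p)))" "X p c + 1 < N"
      using p(2) p(3)[OF \<open>c < d\<close>] by simp_all
  qed
qed

primrec ins :: "(nat \<Rightarrow> nat \<Rightarrow> nat) \<Rightarrow> (nat \<Rightarrow> nat) \<Rightarrow> nat \<Rightarrow> nat \<Rightarrow> nat \<Rightarrow> nat \<Rightarrow> nat" where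
  "ins X m J v 0 = m"
| "ins X m J v (Suc i) = upd (ins X m J v i) i (rst J i) (X (dig N J i)) v (L ^ d)"

lemma rst_less: "J < N ^ k \<Longrightarrow> rst J i < N ^ k"
  by (simp add: rst_def)

lemma ins_low:
  assumes "prep m X" "\<And>i. i < b \<Longrightarrow> dig N J i \<le> n" "J < N ^ k" "a < 7" "y < M"
  shows "ins X m J v b (adr a y) = m (adr a y)"
  using assms(2)
proof (induction b)
  case (Suc b)
  have "X (dig N J b) c < N" if "c < d" for c
    using assms(1) Suc.prems[of b] that by (force simp: prep_def)
  then have "ins X m J v (Suc b) (adr a y) = ins X m J v b (adr a y)"
    using assms rst_less by (simp add: upd_low)
  then show ?case using Suc by simp
qed simp

lemma insert_spec:
  assumes g: "glob r" and p: "prep m X" and J: "r 20 < N ^ k" and dn: "\<And>i. i < k \<Longrightarrow> dig N (r 20) i \<le> n"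
  shows "runs w (insert_prog k d) r m 0 (\<lambda>t r' m'. t \<le> k * (L ^ d * (80 * d + 60) + 80) + 10 \<and>
     (\<forall>j<22. r' j = r j) \<and> m' = ins X m (r 20) (r 21) k)"
proof -
  let ?I = "\<lambda>i r' m'. (\<forall>j<22. r' j = r j) \<and> r' 22 = i \<and> r' 23 = N ^ i \<and> m' = ins X m (r 20) (r 21) i"
  let ?T = "L ^ d * (80 * d + 60) + 60"
  have kw: "k < 2 ^ w" using kdw by linarith
  show ?thesis
    unfolding insert_prog_def runs_Seq runs_Assign
  proof (rule runs_For[where I = ?I and B = k and T = ?T], goal_cases)
    case (4 i r' m')
    then have r': "\<And>j. j < 22 \<Longrightarrow> r' j = r j" "r' 22 = i" "r' 23 = N ^ i"
      and m': "m' = ins X m (r 20) (r 21) i" and i: "i < k" by blast+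
    have g': "glob r'" using g r' by (auto intro: glob_cong)
    then have gr: "r 5 = N" "r 4 = M" using g by (simp_all add: glob_def)
    have low: "m' (adr a y) = m (adr a y)" if "a < 7" "y < M" for a y
      unfolding m' using dn i by (intro ins_low[OF p _ J that]) simp
    have p': "prep m' X" using p low by (rule prep_cong)
    let ?j = "dig N (r 20) i"
    have jn: "?j \<le> n" using dn i .
    have Ni: "N ^ i * N \<le> N ^ k"
      using i N2 power_increasing[of "Suc i" k N] by (simp add: mult.commute)
    have E: "eval_binop w Mult ?j (N ^ i) = ?j * N ^ i"
      "eval_binop w Sub (r 20) (?j * N ^ i) = rst (r 20) i"
      "eval_binop w Mult (N ^ i) N = N ^ Suc i"
      "eval_binop w Add 7 i = 7 + i"
    proof -
      have 1: "?j * N ^ i \<le> r 20" "r 20 \<le> M" using dig_le[of "r 20" i] J powN by linarith+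
      have "k \<le> M" using powN(1) less_exp[of k] power_mono[of 2 N k] N2 by linarith
      then show "eval_binop w Mult ?j (N ^ i) = ?j * N ^ i"
        "eval_binop w Sub (r 20) (?j * N ^ i) = rst (r 20) i"
        "eval_binop w Mult (N ^ i) N = N ^ Suc i" "eval_binop w Add 7 i = 7 + i"
        using 1 Ni powN i M8 unfolding rst_def power_Suc2
        by (intro ev_Mult ev_Sub ev_Add; linarith)+
    qed
    have e24: "r 20 div N ^ i mod N = ?j" by (simp add: dig_def)
    have x: "X ?j c = m' (adr 5 (c * N + m' (adr 4 ?j)))" "X ?j c < N" if "c < d" for c
      using p' jn that unfolding prep_def by force+
    have u: "m' (adr 4 ?j) < N" using p' jn unfolding prep_def by blast
    let ?r = "r'(24 := ?j, 30 := 7 + i, 31 := rst (r 20) i, 32 := m' (adr 4 ?j), 33 := r 21)"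
    have upd: "runs w (update_prog d) ?r m' 0 (\<lambda>t r'' m''. t \<le> L ^ d * (80 * d + 60) + 10 \<and>
       (\<forall>j<34. r'' j = ?r j) \<and> m'' = upd m' i (?r 31) (X ?j) (?r 33) (L ^ d))"
    proof (rule update_spec)
      show "glob ?r" using g' by (rule glob_cong) simp
      show "pow_ok m'" using p' by (simp add: prep_def)
      show "?r 31 < N ^ k" using rst_less[OF J] by simp
      show "X ?j c = m' (adr 5 (c * N + ?r 32))" if "c < d" for c using x(1)[OF that] by simp
      show "X ?j c < N" if "c < d" for c using that by (rule x)
    qed (simp_all add: u i)
    show ?case
      using i by (simp add: ev r' gr E e24 nM[OF jn] del: power_Suc)
        (rule runs_call[OF upd], auto simp: r' gr E m' simp del: power_Suc)
  qed (use kw in \<open>simp_all add: ev algebra_simps\<close>)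
qed

text \<open>\<open>S\<close> is the set of pairs inserted so far: a tuple (coded in base \<open>N\<close>) and its value.\<close>

definition trie :: "(nat \<Rightarrow> nat \<Rightarrow> nat) \<Rightarrow> (nat \<Rightarrow> nat) \<Rightarrow> (nat \<times> nat) set \<Rightarrow> bool" where
  "trie X m S \<longleftrightarrow>
    (\<forall>J v. (J, v) \<in> S \<longrightarrow> J < N ^ k \<and> (\<forall>i<k. dig N J i \<le> n) \<and>
      (\<forall>i<k. \<forall>l<L ^ d. v \<le> m (cell i (rst J i) (nodez (X (dig N J i)) 0 l)))) \<and>
    (\<forall>i<k. \<forall>J<N ^ k. \<forall>z<D. m (cell i J z) = 0 \<or>
      (\<exists>J'. (J', m (cell i J z)) \<in> S \<and> J = rst J' i \<and> (\<exists>l<L ^ d. z = nodez (X (dig N J' i)) 0 l)))"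

lemma trieD:
  assumes "trie X m S" "(J, v) \<in> S"
  shows "J < N ^ k" "i < k \<Longrightarrow> dig N J i \<le> n"
    "i < k \<Longrightarrow> l < L ^ d \<Longrightarrow> v \<le> m (cell i (rst J i) (nodez (X (dig N J i)) 0 l))"
  using assms unfolding trie_def by blast+

lemma trieE:
  assumes "trie X m S" "i < k" "J < N ^ k" "z < D" "m (cell i J z) \<noteq> 0"
  obtains J' l where "(J', m (cell i J z)) \<in> S" "J = rst J' i" "l < L ^ d"
    "z = nodez (X (dig N J' i)) 0 l"
proof -
  have "\<exists>J'. (J', m (cell i J z)) \<in> S \<and> J = rst J' i \<and> (\<exists>l<L ^ d. z = nodez (X (dig N J' i)) 0 l)"
    using assms unfolding trie_def by meson
  then show thesis using that by blast
qed

text \<open>Updates for different piles write to different regions, so a cell of table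
  \<open>i\<close> feels only the \<open>i\<close>-th of them.\<close>

lemma ins_cell:
  assumes "prep m X" "\<And>i. i < k \<Longrightarrow> dig N J i \<le> n" "J < N ^ k" "i < k" "J' < N ^ k" "z < D" "b \<le> k"
  shows "ins X m J v b (cell i J' z) =
    (if i < b \<and> J' = rst J i \<and> (\<exists>l<L ^ d. z = nodez (X (dig N J i)) 0 l)
     then max (m (cell i J' z)) v else m (cell i J' z))"
  using assms(7)
proof (induction b)
  case (Suc b)
  have "X (dig N J b) c < N" if "c < d" for c
    using assms(1) assms(2)[of b] Suc.prems that by (force simp: prep_def)
  then have "nodez (X (dig N J b)) 0 l < D" for l by (intro nodez_less) simp
  then have "cell i J' z = cell b (rst J b) (nodez (X (dig N J b)) 0 l) \<longleftrightarrow>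
      i = b \<and> J' = rst J b \<and> z = nodez (X (dig N J b)) 0 l" for l
    using assms rst_less by (intro cell_eq) auto
  then have "ins X m J v (Suc b) (cell i J' z) =
     (if i = b \<and> J' = rst J b \<and> (\<exists>l<L ^ d. z = nodez (X (dig N J b)) 0 l)
      then max (ins X m J v b (cell i J' z)) v else ins X m J v b (cell i J' z))"
    by (auto simp: upd_def)
  then show ?case using Suc by (auto simp: less_Suc_eq)
qed simp

text \<open>Values only grow under \<open>max\<close>, which preserves the lower bounds. A cell that
  changed holds \<open>v\<close>, so the new pair is its witness; any other cell keeps its old
  one.\<close>

lemma trie_insert:
  assumes p: "prep m X" and dn: "\<And>i. i < k \<Longrightarrow> dig N J i \<le> n" and J: "J < N ^ k" and t: "trie X m S"
  shows "trie X (ins X m J v k) (insert (J, v) S)"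
proof -
  have ic: "ins X m J v k (cell i J' z) =
    (if J' = rst J i \<and> (\<exists>l<L ^ d. z = nodez (X (dig N J i)) 0 l)
     then max (m (cell i J' z)) v else m (cell i J' z))" if "i < k" "J' < N ^ k" "z < D" for i J' z
    using ins_cell[OF p dn J that order.refl] that by simp
  have zD: "nodez (X p) 0 l < D" if "p \<le> n" for p l
    using p that by (intro nodez_less) (force simp: prep_def)
  let ?m = "ins X m J v k"
  have lo: "v' \<le> ?m (cell i (rst J' i) (nodez (X (dig N J' i)) 0 l))"
    if a: "(J', v') \<in> insert (J, v) S" "i < k" "l < L ^ d" for J' v' i l
  proof -
    have J': "J' < N ^ k" "dig N J' i \<le> n"
      using a(1) J dn[OF a(2)] trieD(1)[OF t] trieD(2)[OF t _ a(2)] by blast+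
    note c = ic[OF a(2) rst_less[OF J'(1), of i] zD[OF J'(2), of l]]
    show ?thesis
    proof (cases "(J', v') \<in> S")
      case True
      then have "v' \<le> m (cell i (rst J' i) (nodez (X (dig N J' i)) 0 l))" using trieD(3)[OF t] a by blast
      also have "\<dots> \<le> ?m (cell i (rst J' i) (nodez (X (dig N J' i)) 0 l))" unfolding c by simp
      finally show ?thesis .
    next
      case False
      then have "J' = J" "v' = v" using a by auto
      then have "?m (cell i (rst J' i) (nodez (X (dig N J' i)) 0 l)) =
          max (m (cell i (rst J' i) (nodez (X (dig N J' i)) 0 l))) v'"
        using c a(3) by auto
      then show ?thesis by simp
    qed
  qed
  have hi: "\<exists>J''. (J'', ?m (cell i J' z)) \<in> insert (J, v) S \<and> J' = rst J'' i \<and>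
        (\<exists>l<L ^ d. z = nodez (X (dig N J'' i)) 0 l)"
    if a: "i < k" "J' < N ^ k" "z < D" and n0: "?m (cell i J' z) \<noteq> 0" for i J' z
  proof (cases "?m (cell i J' z) = m (cell i J' z)")
    case True
    then have "m (cell i J' z) \<noteq> 0" using n0 by simp
    from trieE[OF t a this] obtain J'' l where "(J'', m (cell i J' z)) \<in> S" "J' = rst J'' i"
      "l < L ^ d" "z = nodez (X (dig N J'' i)) 0 l" .
    then show ?thesis unfolding True by blast
  next
    case False
    then have "J' = rst J i \<and> (\<exists>l<L ^ d. z = nodez (X (dig N J i)) 0 l) \<and> ?m (cell i J' z) = v"
      using ic[OF a] by (auto simp: max_def split: if_splits)
    then show ?thesis by blast
  qed
  have "J' < N ^ k \<and> (\<forall>i<k. dig N J' i \<le> n)" if "(J', v') \<in> insert (J, v) S" for J' v'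
    using that J dn trieD(1)[OF t] trieD(2)[OF t] by blast
  then show ?thesis using lo hi unfolding trie_def by (intro conjI allI impI) (simp_all only:, meson)
qed

text \<open>A cell is addressed by a node without its level, so a match has to imply that the levels
  agree. Nodes of level \<open>i\<close> are numbered from \<open>2 ^ (L - i)\<close> to
  \<open>2 ^ (L - i + 1) - 1\<close>. Hence the number before that of a node can only be on another
  level if the node is the leftmost one, whose number is even for \<open>i < L\<close>.\<close>

lemma heap_less:
  assumes ab: "N \<le> a" "a < 2 * N" "N \<le> b" "b < 2 * N" and ij: "i < L" "j < L"
    and o: "odd (b div 2 ^ i)" and e: "a div 2 ^ j = b div 2 ^ i - 1"
  shows "a < b"
proof -
  have lo: "2 ^ (L - i) \<le> b div 2 ^ i" "2 ^ (L - j) \<le> a div 2 ^ j"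
  proof -
    have "2 ^ (L - i) * 2 ^ i = N" "2 ^ (L - j) * 2 ^ j = N"
      using ij by (simp_all add: N_def flip: power_add)
    then show "2 ^ (L - i) \<le> b div 2 ^ i" "2 ^ (L - j) \<le> a div 2 ^ j"
      using ab by (simp_all add: less_eq_div_iff_mult_less_eq)
  qed
  have hi: "b div 2 ^ i < 2 * 2 ^ (L - i)" "a div 2 ^ j < 2 * 2 ^ (L - j)"
  proof -
    have "2 * 2 ^ (L - i) * 2 ^ i = 2 * N" "2 * 2 ^ (L - j) * 2 ^ j = 2 * N"
      using ij by (simp_all add: N_def flip: power_add)
    then show "b div 2 ^ i < 2 * 2 ^ (L - i)" "a div 2 ^ j < 2 * 2 ^ (L - j)"
      using ab by (simp_all add: div_less_iff_less_mult)
  qed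
  have "i = j"
  proof (rule ccontr)
    assume "i \<noteq> j"
    then consider "j < i" | "i < j" by linarith
    then show False
    proof cases
      case 1
      then have "(2::nat) ^ Suc (L - i) \<le> 2 ^ (L - j)" using ij by (intro power_increasing) auto
      then show False using lo hi e by simp
    next
      case 2
      then have "(2::nat) ^ Suc (L - j) \<le> 2 ^ (L - i)" using ij by (intro power_increasing) auto
      then have "b div 2 ^ i - 1 < 2 ^ (L - i)" using hi(2) e by simp
      then have "b div 2 ^ i = 2 ^ (L - i)" using lo(1) by linarith
      then show False using o ij by simp
    qed
  qed
  then have "a div 2 ^ i = b div 2 ^ i - 1" using e by simp
  moreover have "b div 2 ^ i \<ge> 1" using lo(1) by (metis one_le_numeral one_le_power order.trans)
  ultimately show ?thesis by (rule trie_sound)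
qed

definition le :: "(nat \<Rightarrow> nat \<Rightarrow> nat) \<Rightarrow> nat \<Rightarrow> nat \<Rightarrow> bool" where
  "le X p t \<longleftrightarrow> (\<forall>c<d. X p c \<le> X t c)"

text \<open>Horner codes are injective, so a cell shared by an insertion of \<open>x\<close> and a
  query for \<open>y\<close> has the same node number in each coordinate; \<open>heap_less\<close>
  then gives \<open>x c < y c + 1\<close>.\<close>

lemma node_sound:
  assumes x: "\<And>c. c < d \<Longrightarrow> x c < N" and y: "\<And>c. c < d \<Longrightarrow> y c + 1 < N"
    and ok: "nodeok y 1 l" and eq: "nodez y 1 l = nodez x 0 l'" and c: "c < d"
  shows "x c \<le> y c"
proof -
  have bx: "2 \<le> nodev x 0 l' c \<and> nodev x 0 l' c < 2 * N" if "c < d" for c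
    using nodev_bounds[of x c 0 l'] x[OF that] by simp
  have b: "2 \<le> nodev y 1 l c \<and> nodev y 1 l c < 2 * N" if "c < d" for c
    using nodev_bounds[of y c 1 l] y[OF that] by simp
  have "(\<lambda>c. nodev y 1 l c - 1) c = (\<lambda>c. nodev x 0 l' c - 0) c"
  proof (rule horner_inj[of "2 * N" "\<lambda>c. nodev y 1 l c - 1" d "\<lambda>c. nodev x 0 l' c - 0" c])
    show "horner (2 * N) (\<lambda>c. nodev y 1 l c - 1) d = horner (2 * N) (\<lambda>c. nodev x 0 l' c - 0) d"
      using eq by (simp add: nodez_def)
    fix i assume "i < d"
    then show "nodev y 1 l i - 1 < 2 * N" "nodev x 0 l' i - 0 < 2 * N"
      using b[of i] bx[of i] by linarith+
  qed (rule c)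
  then have "(N + x c) div 2 ^ dig L l' c = (N + y c + 1) div 2 ^ dig L l c - 1"
    by (simp add: nodev_def)
  moreover have "odd ((N + y c + 1) div 2 ^ dig L l c)"
    using ok c by (simp add: nodeok_def nodev_def)
  ultimately have "N + x c < N + y c + 1"
    using x[OF c] y[OF c] dig_L by - (rule heap_less[of _ _ "dig L l c" "dig L l' c"], auto)
  then show ?thesis by simp
qed

text \<open>\<open>trie_complete\<close>, applied to \<open>x c < y c + 1\<close>, yields a level
  for each coordinate. The vector of these levels is the index at which insertion and query
  meet.\<close>

lemma node_complete:
  assumes x: "\<And>c. c < d \<Longrightarrow> x c \<le> y c" and y: "\<And>c. c < d \<Longrightarrow> y c + 1 < N"
  shows "\<exists>l<L ^ d. nodeok y 1 l \<and> nodez y 1 l = nodez x 0 l"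
proof -
  have "\<forall>c\<in>{..<d}. \<exists>l<L. odd ((N + y c + 1) div 2 ^ l) \<and> (N + x c) div 2 ^ l = (N + y c + 1) div 2 ^ l - 1"
  proof
    fix c assume "c \<in> {..<d}"
    then have c: "x c \<le> y c" "y c + 1 < N" using x y by auto
    \<comment> \<open>Level \<open>L\<close> is the root, so all leaves agree there.\<close>
    have q: "a div 2 ^ L = 1" if "N \<le> a" "a < 2 * N" for a
      using that by (simp add: N_def div_nat_eqI)
    have "(N + x c) div 2 ^ L = (N + y c + 1) div 2 ^ L"
      by (subst (1 2) q) (use c in auto)
    then show "\<exists>l<L. odd ((N + y c + 1) div 2 ^ l) \<and> (N + x c) div 2 ^ l = (N + y c + 1) div 2 ^ l - 1"
      using c by (intro trie_complete) auto
  qed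
  then obtain f where f: "\<And>c. c < d \<Longrightarrow> f c < L \<and> odd ((N + y c + 1) div 2 ^ f c) \<and>
      (N + x c) div 2 ^ f c = (N + y c + 1) div 2 ^ f c - 1"
    by (metis lessThan_iff)
  let ?l = "code L d f"
  have dl: "dig L ?l c = f c" if "c < d" for c using f that by (intro dig_code) auto
  have "?l < L ^ d" using f by (intro code_less) auto
  moreover have "nodeok y 1 ?l" using f dl by (simp add: nodeok_def nodev_def)
  moreover have "nodez y 1 ?l = nodez x 0 ?l"
    unfolding nodez_def using f dl by (intro horner_cong) (simp add: nodev_def)
  ultimately show ?thesis by blast
qed

lemma query_trie:
  assumes g: "glob r" and p: "prep m X" and t: "t \<le> n" "r 32 = m (adr 4 t)"
    and i: "r 30 = 7 + i" "i < k" and J: "r 31 < N ^ k" and tr: "trie X m S"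
  shows "runs w (query_prog d) r m 0 (\<lambda>t' r' m'. t' \<le> L ^ d * (80 * d + 60) + 10 \<and>
     (\<forall>j<33. r' j = r j) \<and> m' = m \<and>
     (\<forall>(J, v)\<in>S. rst J i = r 31 \<and> le X (dig N J i) t \<longrightarrow> v \<le> r' 33) \<and>
     (r' 33 = 0 \<or> (\<exists>J. (J, r' 33) \<in> S \<and> rst J i = r 31 \<and> le X (dig N J i) t)))"
proof -
  have X: "X p c = m (adr 5 (c * N + m (adr 4 p)))" "X p c + 1 < N" "m (adr 4 p) < N"
    if "p \<le> n" "c < d" for p c
    using p that unfolding prep_def by blast+
  have u: "m (adr 4 t) < N" using p t unfolding prep_def by blast
  show ?thesis
  proof (rule runs_conseq[OF query_spec[where x = "X t" and i = i]], goal_cases)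
    case (9 t' r' m')
    then have fr: "t' \<le> L ^ d * (80 * d + 60) + 10" "\<forall>j<33. r' j = r j" "m' = m"
      and c: "\<And>l. l < L ^ d \<Longrightarrow> nodeok (X t) 1 l \<Longrightarrow> m (cell i (r 31) (nodez (X t) 1 l)) \<le> r' 33"
      and s: "r' 33 = 0 \<or> (\<exists>l<L ^ d. nodeok (X t) 1 l \<and> r' 33 = m (cell i (r 31) (nodez (X t) 1 l)))"
      by blast+
    have "v \<le> r' 33" if a: "(J', v) \<in> S" "rst J' i = r 31" "le X (dig N J' i) t" for J' v
    proof -
      have p: "v \<le> m (cell i (r 31) (nodez (X (dig N J' i)) 0 l))" if "l < L ^ d" for l
        using trieD(3)[OF tr a(1) i(2) that] a(2) by simp
      obtain l where "l < L ^ d" "nodeok (X t) 1 l" "nodez (X t) 1 l = nodez (X (dig N J' i)) 0 l"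
        using node_complete[of "X (dig N J' i)" "X t"] a(3) X t(1) unfolding le_def by blast
      then show ?thesis using p[of l] c[of l] by simp
    qed
    moreover have "\<exists>J. (J, r' 33) \<in> S \<and> rst J i = r 31 \<and> le X (dig N J i) t" if n0: "r' 33 \<noteq> 0"
    proof -
      obtain l where l: "l < L ^ d" "nodeok (X t) 1 l" "r' 33 = m (cell i (r 31) (nodez (X t) 1 l))"
        using s n0 by blast
      have "nodez (X t) 1 l < D" using X t(1) by (intro nodez_less) blast
      then obtain J' l' where J': "(J', r' 33) \<in> S" "r 31 = rst J' i"
          "nodez (X t) 1 l = nodez (X (dig N J' i)) 0 l'"
        using trieE[OF tr i(2) J, of "nodez (X t) 1 l"] l(3) n0 by metis
      have "dig N J' i \<le> n" using trieD(2)[OF tr J'(1)] i(2) .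
      then have "X (dig N J' i) c \<le> X t c" if "c < d" for c
        using that by (intro node_sound[OF _ _ l(2) J'(3)] X(2)[OF t(1)] add_lessD1[OF X(2)])
      then show ?thesis using J' unfolding le_def by auto
    qed
    ultimately show ?case using fr by auto
  qed (use g p t i J X u in \<open>auto simp: prep_def\<close>)
qed

end

section \<open>Tournament sort and ranks\<close>

text \<open>Register 30 is a leaf and 31 its new content, either its own number to insert it or 0 to
  delete it. The matches on the path to the root are then played again.\<close>

definition fix_prog :: com where
  "fix_prog =
    Assign 32 (Bin Add (Reg 5) (Reg 30)) ;;
    Store (At (Const 6) (Reg 32)) (Reg 31) ;;
    For 33 (Reg 2)
      (Assign 32 (Bin Div (Reg 32) (Const 2)) ;;
       Assign 34 (Load (At (Const 6) (Bin Mult (Const 2) (Reg 32)))) ;;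
       Assign 35 (Load (At (Const 6) (Bin Add (Bin Mult (Const 2) (Reg 32)) (Const 1)))) ;;
       Cond (Bin BitOr (Bin Equal (Reg 34) (Const 0)) (Bin BitAnd (Bin Less (Const 0) (Reg 35))
           (Bin Less (Load (At (Const 3) (Reg 35))) (Load (At (Const 3) (Reg 34))))))
         (Store (At (Const 6) (Reg 32)) (Reg 35))
         (Store (At (Const 6) (Reg 32)) (Reg 34)))"

text \<open>The tree starts empty and is empty again at the end, so the same memory serves for all
  \<open>d + 1\<close> sorts without being cleared.\<close>

definition sort_prog :: com where
  "sort_prog =
    For 20 (Reg 0)
      (Assign 30 (Bin Add (Reg 20) (Const 1)) ;; Assign 31 (Reg 30) ;; fix_prog) ;;
    For 20 (Reg 0)
      (Assign 30 (Load (At (Const 6) (Const 1))) ;;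
       Store (At (Const 4) (Bin Add (Reg 20) (Const 1))) (Reg 30) ;;
       Assign 31 (Const 0) ;; fix_prog)"

lemma or_of_bool: "or (of_bool P) (of_bool Q :: nat) = of_bool (P \<or> Q)"
  by (cases P; cases Q) simp_all

context ram begin

definition same :: "nat set \<Rightarrow> (nat \<Rightarrow> nat) \<Rightarrow> (nat \<Rightarrow> nat) \<Rightarrow> bool" where
  "same S m m' \<longleftrightarrow> (\<forall>a y. a \<notin> S \<longrightarrow> y < M \<longrightarrow> m' (adr a y) = m (adr a y))"

lemma sameD: "same S m m' \<Longrightarrow> a \<notin> S \<Longrightarrow> y < M \<Longrightarrow> m' (adr a y) = m (adr a y)"
  by (simp add: same_def)

lemma same_refl: "same S m m"
  by (simp add: same_def)

lemma same_trans: "same S m m' \<Longrightarrow> same S' m' m'' \<Longrightarrow> S \<subseteq> U \<Longrightarrow> S' \<subseteq> U \<Longrightarrow> same U m m''"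
  unfolding same_def by (metis subsetD)

lemma same_store: "a \<in> S \<Longrightarrow> y < M \<Longrightarrow> same S m (m(adr a y := v))"
  by (auto simp: same_def adr_eq)

definition key :: "(nat \<Rightarrow> nat) \<Rightarrow> nat \<Rightarrow> nat" where "key m u = m (adr 3 u)"
definition tr :: "(nat \<Rightarrow> nat) \<Rightarrow> nat \<Rightarrow> nat" where "tr m v = m (adr 6 v)"

definition tree :: "(nat \<Rightarrow> nat) \<Rightarrow> nat set \<Rightarrow> bool" where
  "tree m S \<longleftrightarrow> S \<subseteq> {1..<N} \<and> (\<forall>v. 1 \<le> v \<longrightarrow> v < 2 * N \<longrightarrow> tr m v < N) \<and>
     (\<forall>x<N. tr m (N + x) = (if x \<in> S then x else 0)) \<and>
     (\<forall>v. 1 \<le> v \<longrightarrow> v < N \<longrightarrow> tr m v = better (key m) (tr m (2 * v)) (tr m (2 * v + 1)))"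

lemma tree_root: "tree m S \<Longrightarrow> S \<noteq> {} \<Longrightarrow> tr m 1 \<in> S \<and> (\<forall>x\<in>S. key m (tr m 1) \<le> key m x)"
  using tournament[of N L "tr m" "key m" S] unfolding tree_def N_def by blast

text \<open>From the leaves upwards, every winner is 0. This does not refer to the keys, so an empty
  tree survives when new keys are written; see \<open>tree_same\<close>.\<close>

lemma tree_empty:
  assumes "tree m {}" "1 \<le> v" "v < 2 * N" shows "tr m v = 0"
  using assms(2,3)
proof (induction "2 * N - v" arbitrary: v rule: less_induct)
  case less
  show ?case
  proof (cases "v < N")
    case True
    then have "tr m (2 * v) = 0" "tr m (2 * v + 1) = 0" using less by auto
    moreover have "tr m v = better (key m) (tr m (2 * v)) (tr m (2 * v + 1))"
      using assms(1) less.prems(1) True unfolding tree_def by blast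
    ultimately show ?thesis by (simp add: better_def)
  next
    case False
    then have "v = N + (v - N)" "v - N < N" using less by auto
    then show ?thesis using assms(1) unfolding tree_def by (metis empty_iff)
  qed
qed

lemma empty_tree: "(\<And>v. 1 \<le> v \<Longrightarrow> v < 2 * N \<Longrightarrow> tr m v = 0) \<Longrightarrow> tree m {}"
  using N2 by (auto simp: tree_def better_def)

text \<open>A tree under repair: the winner equation may fail at the ancestors of leaf
  \<open>x\<close> above level \<open>l\<close>, and nowhere else.\<close>

definition path :: "(nat \<Rightarrow> nat) \<Rightarrow> nat set \<Rightarrow> nat \<Rightarrow> (nat \<Rightarrow> nat) \<Rightarrow> nat \<Rightarrow> bool" where
  "path K S x T l \<longleftrightarrow> (\<forall>v. 1 \<le> v \<longrightarrow> v < 2 * N \<longrightarrow> T v < N) \<and>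
     (\<forall>y<N. T (N + y) = (if y \<in> S then y else 0)) \<and>
     (\<forall>v. 1 \<le> v \<longrightarrow> v < N \<longrightarrow> (\<forall>l'>l. v \<noteq> (N + x) div 2 ^ l') \<longrightarrow>
       T v = better K (T (2 * v)) (T (2 * v + 1)))"

lemma path_cong:
  assumes "path K S x T l" "\<And>v. v < 2 * N \<Longrightarrow> T' v = T v" shows "path K S x T' l"
  using assms(1) unfolding path_def by (auto simp: assms(2))

lemma path_0:
  assumes "tree m S" "x < N" "S' - {x} = S - {x}" "z = (if x \<in> S' then x else 0)"
  shows "path (key m) S' x ((tr m)(N + x := z)) 0"
proof -
  have t: "\<And>v. 1 \<le> v \<Longrightarrow> v < 2 * N \<Longrightarrow> tr m v < N" "\<And>y. y < N \<Longrightarrow> tr m (N + y) = (if y \<in> S then y else 0)"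
     "\<And>v. 1 \<le> v \<Longrightarrow> v < N \<Longrightarrow> tr m v = better (key m) (tr m (2 * v)) (tr m (2 * v + 1))"
    using assms(1) unfolding tree_def by blast+
  have "((tr m)(N + x := z)) v = better (key m) (((tr m)(N + x := z)) (2 * v)) (((tr m)(N + x := z)) (2 * v + 1))"
    if v: "1 \<le> v" "v < N" "\<forall>l'>0. v \<noteq> (N + x) div 2 ^ l'" for v
  proof -
    have "v \<noteq> (N + x) div 2" using v(3)[rule_format, of 1] by simp
    then have "2 * v \<noteq> N + x" "2 * v + 1 \<noteq> N + x" by auto
    moreover have "v \<noteq> N + x" using v by simp
    ultimately show ?thesis using t(3)[OF v(1,2)] by simp
  qed
  moreover have "((tr m)(N + x := z)) v < N" if "1 \<le> v" "v < 2 * N" for v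
    using t(1)[OF that] assms by simp
  moreover have "((tr m)(N + x := z)) (N + y) = (if y \<in> S' then y else 0)" if "y < N" for y
    using t(2)[OF that] assms(3,4) by auto
  ultimately show ?thesis unfolding path_def by blast
qed

text \<open>Changing node \<open>u\<close> affects two equations: that of \<open>u\<close>, which
  holds by choice of the new value, and that of its parent, the ancestor at level
  \<open>l + 2\<close>, which is still exempt.\<close>

lemma path_Suc:
  assumes p: "path K S x T l" and l: "l < L" and x: "x < N" and u: "u = (N + x) div 2 ^ Suc l"
  shows "path K S x (T(u := better K (T (2 * u)) (T (2 * u + 1)))) (Suc l)" "1 \<le> u" "u < N"
proof -
  let ?T = "T(u := better K (T (2 * u)) (T (2 * u + 1)))"
  have "(2::nat) ^ Suc l \<le> N" unfolding N_def using l by (intro power_increasing) auto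
  then show u1: "1 \<le> u" unfolding u by (simp add: less_eq_div_iff_mult_less_eq)
  have "u = (N + x) div 2 ^ l div 2" unfolding u power_Suc2 div_mult2_eq ..
  also have "\<dots> \<le> (N + x) div 2" by (intro div_le_mono) simp
  also have "\<dots> < N" using x by simp
  finally show u2: "u < N" .
  have t: "\<And>v. 1 \<le> v \<Longrightarrow> v < 2 * N \<Longrightarrow> T v < N" "\<And>y. y < N \<Longrightarrow> T (N + y) = (if y \<in> S then y else 0)"
     "\<And>v. 1 \<le> v \<Longrightarrow> v < N \<Longrightarrow> \<forall>l'>l. v \<noteq> (N + x) div 2 ^ l' \<Longrightarrow> T v = better K (T (2 * v)) (T (2 * v + 1))"
    using p unfolding path_def by blast+
  have "?T v = better K (?T (2 * v)) (?T (2 * v + 1))"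
    if v: "1 \<le> v" "v < N" "\<forall>l'>Suc l. v \<noteq> (N + x) div 2 ^ l'" for v
  proof (cases "v = u")
    case True
    then show ?thesis using u1 by auto
  next
    case False
    have "v \<noteq> u div 2" using v(3)[rule_format, of "Suc (Suc l)"]
      unfolding u by (simp only: power_Suc2[of _ "Suc l"] div_mult2_eq) simp
    then have "2 * v \<noteq> u" "2 * v + 1 \<noteq> u" by auto
    moreover have "T v = better K (T (2 * v)) (T (2 * v + 1))"
      using v False u by (intro t(3)) (metis Suc_lessI)+
    ultimately show ?thesis using False by simp
  qed
  moreover have "?T v < N" if "1 \<le> v" "v < 2 * N" for v
  proof (cases "v = u")
    case True
    have "T (2 * u) < N" "T (2 * u + 1) < N" using u1 u2 by (auto intro!: t(1))
    then show ?thesis using True by (simp add: better_def)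
  qed (use t(1)[OF that] in simp)
  moreover have "?T (N + y) = (if y \<in> S then y else 0)" if "y < N" for y
    using t(2)[OF that] u2 by simp
  ultimately show "path K S x ?T (Suc l)" unfolding path_def by blast
qed

text \<open>Above level \<open>L\<close> the quotient is 0, so no node remains exempt.\<close>

lemma path_L:
  assumes p: "path K S x T L" and x: "x < N" and v: "1 \<le> v" "v < N"
  shows "T v = better K (T (2 * v)) (T (2 * v + 1))"
proof -
  have "v \<noteq> (N + x) div 2 ^ l" if "L < l" for l
  proof -
    have "(2::nat) ^ Suc L \<le> 2 ^ l" using that by (intro power_increasing) auto
    then have "N + x < 2 ^ l" using x by (simp add: N_def)
    then show ?thesis using v by simp
  qed
  then show ?thesis using p v unfolding path_def by blast
qed

lemma tr_upd: "y < M \<Longrightarrow> v < M \<Longrightarrow> tr (m(adr 6 y := z)) v = ((tr m)(y := z)) v"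
  by (simp add: tr_def adr_eq)

lemma fix_spec:
  assumes g: "glob r" and t: "tree m S" and x: "1 \<le> r 30" "r 30 < N" and v: "r 31 = 0 \<or> r 31 = r 30"
  shows "runs w fix_prog r m 0 (\<lambda>t r' m'. t \<le> L * 70 + 30 \<and> (\<forall>j<32. r' j = r j) \<and>
     same {6} m m' \<and> tree m' (if r 31 = 0 then S - {r 30} else insert (r 30) S))"
proof -
  define S' where "S' = (if r 31 = 0 then S - {r 30} else insert (r 30) S)"
  let ?h = "\<lambda>l. (N + r 30) div 2 ^ l"
  have S: "S' \<subseteq> {1..<N}" using t x unfolding tree_def S'_def by auto
  let ?I = "\<lambda>l r' m'. (\<forall>j<32. r' j = r j) \<and> r' 33 = l \<and> r' 32 = ?h l \<and> same {6} m m' \<and>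
    path (key m) S' (r 30) (tr m') l"
  have xM: "N + r 30 < M" using x N2M by linarith
  have gr: "r 5 = N" "r 4 = M" "r 2 = L" using g by (simp_all add: glob_def)
  have EN: "eval_binop w Add N (r 30) = N + r 30" using xM by (intro ev_Add; linarith)
  have NM: "2 * N < M" using N2M N2 by linarith
  show ?thesis
    unfolding fix_prog_def S'_def[symmetric] runs_Seq runs_Assign runs_Store
  proof (rule runs_For[where I = ?I and B = L and T = 60], goal_cases)
    case 1
    have "path (key m) S' (r 30) (tr (m(adr 6 (N + r 30) := r 31))) 0"
    proof (rule path_cong[OF path_0[OF t x(2)]])
      show "tr (m(adr 6 (N + r 30) := r 31)) u = ((tr m)(N + r 30 := r 31)) u" if "u < 2 * N" for u
        using that NM xM by (intro tr_upd) auto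
    qed (use v x in \<open>auto simp: S'_def\<close>)
    then show ?case using same_store[of 6 "{6}" "N + r 30" m] xM by (simp add: ev gr EN)
  next
    case 2
    show ?case using LN N2M by (intro limM) linarith
  next
    case (3 l r' m')
    then show ?case by (simp add: gr)
  next
    case (4 l r' m')
    then have l: "l < L" and r': "\<And>j. j < 32 \<Longrightarrow> r' j = r j" "r' 33 = l" "r' 32 = ?h l"
      and sm: "same {6} m m'" and p: "path (key m) S' (r 30) (tr m') l" by blast+
    define u where "u = ?h (Suc l)"
    note P = path_Suc[OF p l x(2) u_def]
    have hu: "?h l div 2 = u" unfolding u_def power_Suc2 div_mult2_eq ..
    have uM: "2 * u + 1 < M" "2 * u < M" "u < M" "2 * u + 1 < 2 * N"
      using P(3) N2M by linarith+
    define a b where "a = tr m' (2 * u)" and "b = tr m' (2 * u + 1)"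
    have ab: "a < N" "b < N" using p P(2) uM unfolding path_def a_def b_def by auto
    have abM: "a < M" "b < M" using ab NM by linarith+
    have K: "m' (adr 3 a) = key m a" "m' (adr 3 b) = key m b"
      using sameD[OF sm] abM by (simp_all add: key_def)
    have E: "eval_binop w Mult 2 u = 2 * u" "eval_binop w Add (2 * u) 1 = 2 * u + 1"
      using uM M8 by (intro ev_Mult ev_Add; linarith)+
    let ?m = "m'(adr 6 u := better (key m) a b)"
    have pm: "path (key m) S' (r 30) (tr ?m) (Suc l)"
      unfolding a_def b_def
      by (rule path_cong[OF P(1)], rule tr_upd) (use uM NM in linarith)+
    have sm': "same {6} m ?m"
      by (rule same_trans[OF sm same_store[of 6 "{6}"]]) (use uM in auto)
    have tr: "m' (adr 6 (2 * u)) = a" "m' (adr 6 (2 * u + 1)) = b" by (simp_all add: tr_def a_def b_def)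
    show ?case
    proof (cases "a = 0 \<or> 0 < b \<and> key m b < key m a")
      case True
      then have "better (key m) a b = b" by (auto simp: better_def)
      then show ?thesis using pm sm' True
        by (simp add: ev r' gr hu E tr K uM abM and_of_bool or_of_bool u_def[symmetric]
          del: power_Suc One_nat_def)
    next
      case False
      then have "better (key m) a b = a"
        "(a = 0 \<or> 0 < b \<and> key m b < key m a) = False" by (auto simp: better_def)
      then show ?thesis using pm sm'
        by (simp add: ev r' gr hu E tr K uM abM and_of_bool or_of_bool u_def[symmetric]
          del: power_Suc One_nat_def de_Morgan_disj de_Morgan_conj) (use False in auto)
    qed
  next
    case (5 t' r' m')
    then have sm: "same {6} m m'" and p: "path (key m) S' (r 30) (tr m') L" by blast+
    \<comment> \<open>Region 3 is untouched, so \<open>better\<close> may be read with the keys of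
      the new memory. This is where the bound \<open>N\<close> on tree entries is used.\<close>
    have "key m' u = key m u" if "u < N" for u
      unfolding key_def by (rule sameD[OF sm]) (use that NM in auto)
    then have "better (key m) (tr m' v) (tr m' u) = better (key m') (tr m' v) (tr m' u)"
      if "1 \<le> v" "v < 2 * N" "1 \<le> u" "u < 2 * N" for u v
      using p that unfolding path_def better_def by auto
    then have "tree m' S'"
      using p path_L[OF p x(2)] S unfolding tree_def path_def by auto
    then show ?case using 5 sm by (simp add: ev algebra_simps)
  qed
qed

definition out :: "(nat \<Rightarrow> nat) \<Rightarrow> nat \<Rightarrow> nat" where "out m p = m (adr 4 p)"

text \<open>In the second loop the tree contains the boxes not yet output, and their keys are at
  least those of the boxes already output. Cell 0 of the output is never written, since position 0
  is reserved for the bottom of a pile.\<close>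

lemma sort_spec:
  assumes g: "glob r" and t: "tree m {}"
  shows "runs w sort_prog r m 0 (\<lambda>t r' m'. t \<le> n * (L * 140 + 200) + 20 \<and> (\<forall>j<20. r' j = r j) \<and>
     same {4, 6} m m' \<and> tree m' {} \<and> out m' 0 = out m 0 \<and> bij_betw (out m') {1..n} {1..n} \<and>
     (\<forall>p q. 1 \<le> p \<longrightarrow> p \<le> q \<longrightarrow> q \<le> n \<longrightarrow> key m (out m' p) \<le> key m (out m' q)))"
proof -
  have gr: "r 5 = N" "r 4 = M" "r 2 = L" "r 0 = n" using g by (simp_all add: glob_def)
  have nM: "n \<le> M" "n < M" "1 < M" "n < N" using nN N2M by linarith+
  have E: "eval_binop w Add i 1 = i + 1" if "i < n" for i using that nM by (intro ev_Add; linarith)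
  let ?I1 = "\<lambda>i r' m'. (\<forall>j<20. r' j = r j) \<and> r' 20 = i \<and> same {6} m m' \<and> tree m' {1..i}"
  let ?I2 = "\<lambda>i r' m'. (\<forall>j<20. r' j = r j) \<and> r' 20 = i \<and> same {4, 6} m m' \<and>
    tree m' ({1..n} - out m' ` {1..i}) \<and> out m' 0 = out m 0 \<and> inj_on (out m') {1..i} \<and>
    out m' ` {1..i} \<subseteq> {1..n} \<and>
    (\<forall>p q. 1 \<le> p \<longrightarrow> p \<le> q \<longrightarrow> q \<le> i \<longrightarrow> key m (out m' p) \<le> key m (out m' q)) \<and>
    (\<forall>p\<in>{1..i}. \<forall>u\<in>{1..n} - out m' ` {1..i}. key m (out m' p) \<le> key m u)"
  have nw: "n < 2 ^ w" using nM by (intro limM) linarith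
  show ?thesis
    unfolding sort_prog_def runs_Seq
  proof (rule runs_For[where I = ?I1 and B = n and T = "L * 70 + 50"], goal_cases)
    case 1
    then show ?case using t by (simp add: same_refl)
  next
    case (3 i r' m')
    then show ?case by (simp add: gr)
  next
    case (4 i r' m')
    then have i: "i < n" and r': "\<And>j. j < 20 \<Longrightarrow> r' j = r j" "r' 20 = i"
      and sm: "same {6} m m'" and tr: "tree m' {1..i}" by blast+
    let ?r = "r'(30 := i + 1, 31 := i + 1)"
    have "glob ?r" using g by (rule glob_cong) (simp add: r')
    from fix_spec[OF this tr] have f: "runs w fix_prog ?r m' 0 (\<lambda>t r'' m''. t \<le> L * 70 + 30 \<and> (\<forall>j<32. r'' j = ?r j) \<and>
       same {6} m' m'' \<and> tree m'' (insert (i + 1) {1..i}))"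
      using i nM by simp
    have eq: "insert (i + 1) {1..i} = {1..Suc i}" by auto
    have f: "runs w fix_prog ?r m' 0 (\<lambda>t r'' m''. t \<le> L * 70 + 30 \<and> (\<forall>j<32. r'' j = ?r j) \<and>
       same {6} m m'' \<and> tree m'' {1..Suc i})"
      by (rule runs_conseq[OF f[unfolded eq]]) (use same_trans[OF sm, of "{6}"] in blast)
    show ?case
      by (simp add: ev r' E[OF i] del: One_nat_def) (rule runs_call[OF f], simp add: r')
  next
    case (5 t1 r1 m1)
    then have r1: "\<And>j. j < 20 \<Longrightarrow> r1 j = r j" and sm1: "same {6} m m1" and tr1: "tree m1 {1..n}"
      and t1: "t1 \<le> 0 + n * (L * 70 + 50 + cost (Reg 0) + 7) + (cost (Reg 0) + 5)" by blast+
    show ?case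
    proof (rule runs_For[where I = ?I2 and B = n and T = "L * 70 + 70"], goal_cases)
      case 1
      have "out m1 0 = out m 0" unfolding out_def by (rule sameD[OF sm1]) (use nM in auto)
      moreover have "same {4, 6} m m1" using sm1 by (simp add: same_def)
      ultimately show ?case using tr1 by (simp add: r1)
    next
      case (3 i r' m')
      then show ?case by (simp add: gr)
    next
      case (4 i r' m')
      then have i: "i < n" and r': "\<And>j. j < 20 \<Longrightarrow> r' j = r j" "r' 20 = i"
        and sm: "same {4, 6} m m'" and tr: "tree m' ({1..n} - out m' ` {1..i})"
        and o0: "out m' 0 = out m 0" and inj: "inj_on (out m') {1..i}"
        and sub: "out m' ` {1..i} \<subseteq> {1..n}"
        and so: "\<And>p q. 1 \<le> p \<Longrightarrow> p \<le> q \<Longrightarrow> q \<le> i \<Longrightarrow> key m (out m' p) \<le> key m (out m' q)"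
        and re: "\<And>p u. p \<in> {1..i} \<Longrightarrow> u \<in> {1..n} - out m' ` {1..i} \<Longrightarrow> key m (out m' p) \<le> key m u"
        by blast+
      let ?R = "{1..n} - out m' ` {1..i}"
      \<comment> \<open>Injectivity of the output so far gives the size of the remainder, which is
        therefore not empty, and the root is a genuine box.\<close>
      have "card ?R = n - i" using sub inj by (simp add: card_Diff_subset card_image)
      then have ne: "?R \<noteq> {}" using i by (metis card.empty diff_is_0_eq not_le)
      define u where "u = tr m' 1"
      have k: "key m' x = key m x" if "x \<in> {1..n}" for x
        unfolding key_def by (rule sameD[OF sm]) (use that nM in auto)
      have u: "u \<in> ?R" "\<And>x. x \<in> ?R \<Longrightarrow> key m u \<le> key m x"
        using tree_root[OF tr ne] k unfolding u_def by auto
      have um: "m' (adr 6 1) = u" by (simp add: u_def tr_def)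
      let ?m = "m'(adr 4 (i + 1) := u)"
      have sm2: "same {4} m' ?m" by (rule same_store) (use i nM in auto)
      have tr2: "tree ?m ?R"
      proof -
        have "tr ?m v = tr m' v" if "v < 2 * N" for v
          unfolding tr_def by (rule sameD[OF sm2]) (use that N2M N2 in auto)
        moreover have "key ?m v = key m' v" if "v < N" for v
          unfolding key_def by (rule sameD[OF sm2]) (use that N2M N2 in auto)
        ultimately show ?thesis using tr unfolding tree_def better_def by auto
      qed
      let ?r = "r'(30 := u, 31 := 0)"
      have "glob ?r" using g by (rule glob_cong) (simp add: r')
      from fix_spec[OF this tr2] have f: "runs w fix_prog ?r ?m 0 (\<lambda>t r'' m''. t \<le> L * 70 + 30 \<and> (\<forall>j<32. r'' j = ?r j) \<and>
         same {6} ?m m'' \<and> tree m'' (?R - {u}))"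
        using u(1) nM by simp
      have Q: "?I2 (Suc i) (r''(20 := Suc i)) m''"
        if "\<forall>j<32. r'' j = ?r j" "same {6} ?m m''" "tree m'' (?R - {u})" for r'' m''
      proof -
        have o: "out m'' p = (if p = Suc i then u else out m' p)" if "p \<le> n" for p
          using sameD[OF \<open>same {6} ?m m''\<close>, of 4 p] that i nM by (simp add: out_def adr_eq)
        have old: "out m'' p = out m' p" if "p \<in> {1..i}" for p using o[of p] that i by auto
        have new: "out m'' (Suc i) = u" using o[of "Suc i"] i by simp
        have imi: "out m'' ` {1..i} = out m' ` {1..i}" by (intro image_cong refl old)
        have Sc: "{1..Suc i} = insert (Suc i) {1..i}" by auto
        have im: "out m'' ` {1..Suc i} = insert u (out m' ` {1..i})"
          unfolding Sc image_insert imi new ..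
        have "inj_on (out m'') {1..i}" using inj inj_on_cong[of "{1..i}" "out m''" "out m'"] old by blast
        then have ij: "inj_on (out m'') {1..Suc i}"
          unfolding Sc inj_on_insert using u(1) imi new by auto
        have "key m (out m'' p) \<le> key m (out m'' q)" if "1 \<le> p" "p \<le> q" "q \<le> Suc i" for p q
          using that o[of p] o[of q] i so[of p q] re[of p u] u(1) by (auto simp: le_Suc_eq)
        moreover have "key m (out m'' p) \<le> key m x"
          if "p \<in> {1..Suc i}" "x \<in> {1..n} - out m'' ` {1..Suc i}" for p x
          using that o[of p] i re[of p x] u(2)[of x] unfolding im by (auto simp: le_Suc_eq)
        moreover have "same {4, 6} m m''"
          using same_trans[OF same_trans[OF sm sm2] that(2)] by blast
        moreover have "tree m'' ({1..n} - out m'' ` {1..Suc i})"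
          using that(3) unfolding im by (metis Diff_insert)
        moreover have "out m'' ` {1..Suc i} \<subseteq> {1..n}" unfolding im using sub u(1) by blast
        ultimately show ?thesis using that(1) r' o0 o[of 0] ij by simp
      qed
      have f2: "runs w fix_prog ?r ?m 0 (\<lambda>t r'' m''. t \<le> L * 70 + 30 \<and> r'' 20 = i \<and>
          ?I2 (Suc i) (r''(20 := Suc i)) m'')"
      proof (rule runs_conseq[OF f], elim conjE, intro conjI)
        fix t r'' m'' assume "\<forall>j<32. r'' j = ?r j"
        from this[rule_format, of 20] show "r'' 20 = i" using r' by simp
      qed (use Q in blast)+
      show ?case
        using i nM
        by (simp add: ev r' gr um E[OF i] del: One_nat_def) (rule runs_call[OF f2], simp)
    next
      case (5 t' r' m')
      then have tr: "tree m' ({1..n} - out m' ` {1..n})" and inj: "inj_on (out m') {1..n}"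
        and sub: "out m' ` {1..n} \<subseteq> {1..n}" by blast+
      have eq: "out m' ` {1..n} = {1..n}"
        using sub inj by (intro card_subset_eq) (simp_all add: card_image)
      then have "bij_betw (out m') {1..n} {1..n}" using inj by (simp add: bij_betw_def)
      moreover have "tree m' {}" using tr eq by simp
      moreover have "t' \<le> n * (L * 140 + 200) + 20"
        using 5(1) t1 by (simp add: algebra_simps)
      ultimately show ?case using 5(2) by blast
    qed (use nw in auto)
  qed (use nw in auto)
qed

end

section \<open>Ranks and the order of processing\<close>

definition fill_prog :: "nat \<Rightarrow> com" where
  "fill_prog d = For 11 (Reg 0) (Store (At (Const 3) (Bin Add (Reg 11) (Const 1)))
     (Load (Bin Add (Bin Mult (Reg 11) (Const d)) (Reg 10))))"

text \<open>Register 12 grows only when the key does, so boxes with equal coordinates share a rank,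
  and ranks compare exactly as coordinates do. The comparison at position 1 is with box 0; it shifts
  all ranks alike, which preserves their order. The rank cells of box 0 keep the value 0, so that it
  fits everywhere.\<close>

definition rank_prog :: com where
  "rank_prog =
    Assign 12 (Const 0) ;;
    For 11 (Reg 0)
      (Assign 13 (Load (At (Const 4) (Bin Add (Reg 11) (Const 1)))) ;;
       Cond (Bin Less (Load (At (Const 3) (Load (At (Const 4) (Reg 11))))) (Load (At (Const 3) (Reg 13))))
         (Assign 12 (Bin Add (Reg 12) (Const 1))) Skip ;;
       Store (At (Const 5) (Bin Add (Bin Mult (Reg 10) (Reg 5)) (Reg 13))) (Reg 12))"

text \<open>The key of the final sort is the sum of the ranks. It is monotone under fitting and at
  most \<open>d * n\<close>, whereas a sum of coordinates might not fit into a word.\<close>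

definition total_prog :: "nat \<Rightarrow> com" where
  "total_prog d =
    For 11 (Reg 0)
      (Assign 12 (Const 0) ;;
       Assign 13 (Bin Add (Reg 11) (Const 1)) ;;
       For 10 (Const d)
         (Assign 12 (Bin Add (Reg 12) (Load (At (Const 5) (Bin Add (Bin Mult (Reg 10) (Reg 5)) (Reg 13)))))) ;;
       Store (At (Const 3) (Reg 13)) (Reg 12))"

definition prep_prog :: "nat \<Rightarrow> com" where
  "prep_prog d =
    For 10 (Const d) (fill_prog d ;; sort_prog ;; rank_prog) ;;
    total_prog d ;;
    sort_prog"

context ram begin

definition rk :: "(nat \<Rightarrow> nat) \<Rightarrow> nat \<Rightarrow> nat \<Rightarrow> nat" where "rk m c u = m (adr 5 (c * N + u))"

definition input :: "(nat \<Rightarrow> nat \<Rightarrow> nat) \<Rightarrow> (nat \<Rightarrow> nat) \<Rightarrow> bool" where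
  "input B m \<longleftrightarrow> (\<forall>p<n. \<forall>c<d. m (p * d + c) = B p c)"

lemma inputM: "p < n \<Longrightarrow> c < d \<Longrightarrow> p * d + c < M"
proof -
  assume "p < n" "c < d"
  then have "p * d + c < (p + 1) * d" by simp
  also have "\<dots> \<le> N * d" using \<open>p < n\<close> nN by (intro mult_le_mono1) simp
  also have "\<dots> \<le> D" using dN by (simp add: mult.commute)
  finally show ?thesis using powN by simp
qed

lemma input_cong: "input B m \<Longrightarrow> same S m m' \<Longrightarrow> 0 \<notin> S \<Longrightarrow> input B m'"
  using sameD[of S m m' 0] inputM unfolding input_def adr_def by simp

lemma n_bounds: "n < M" "n \<le> M" "n < N" "n < 2 ^ w" "1 < M"
proof -
  show "n < M" "n \<le> M" "n < N" "1 < M" using nN N2M by linarith+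
  then show "n < 2 ^ w" using limM[of n] by simp
qed

lemma E_Suc: "i < n \<Longrightarrow> eval_binop w Add i 1 = i + 1"
  using n_bounds by (intro ev_Add) linarith+

lemma fill_spec:
  assumes g: "glob r" and c: "r 10 = c" "c < d" and B: "input B m"
  shows "runs w (fill_prog d) r m 0 (\<lambda>t r' m'. t \<le> n * 30 + 10 \<and> (\<forall>j<11. r' j = r j) \<and>
    same {3} m m' \<and> (\<forall>p\<in>{1..n}. key m' p = B (p - 1) c))"
proof -
  have gr: "r 5 = N" "r 4 = M" "r 2 = L" "r 0 = n" using g by (simp_all add: glob_def)
  let ?I = "\<lambda>i r' m'. (\<forall>j<11. r' j = r j) \<and> r' 11 = i \<and> same {3} m m' \<and> (\<forall>p\<in>{1..i}. key m' p = B (p - 1) c)"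
  show ?thesis unfolding fill_prog_def
  proof (rule runs_For[where I = ?I and B = n and T = 20], goal_cases)
    case (3 i r' m')
    then show ?case by (simp add: gr)
  next
    case (4 i r' m')
    then have i: "i < n" and r': "\<And>j. j < 11 \<Longrightarrow> r' j = r j" "r' 11 = i"
      and sm: "same {3} m m'" and ke: "\<And>p. p \<in> {1..i} \<Longrightarrow> key m' p = B (p - 1) c" by blast+
    note iM = inputM[OF i c(2)]
    then have E: "eval_binop w Mult i d = i * d" "eval_binop w Add (i * d) c = i * d + c"
      by (intro ev_Mult ev_Add; linarith)+
    have b: "m' (i * d + c) = B i c"
      using input_cong[OF B sm] i c unfolding input_def by simp
    let ?m = "m'(adr 3 (i + 1) := B i c)"
    have sm2: "same {3} m ?m"
      using i n_bounds by (intro same_trans[OF sm same_store[of 3 "{3}"]]) auto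
    have k2: "\<forall>p\<in>{1..Suc i}. key ?m p = B (p - 1) c"
    proof
      fix p assume p: "p \<in> {1..Suc i}"
      show "key ?m p = B (p - 1) c"
        using ke[of p] p i n_bounds by (cases "p = Suc i") (simp_all add: key_def adr_eq)
    qed
    show ?case
      using sm2 k2 i n_bounds
      by (simp add: ev r' gr c(1) E E_Suc b del: One_nat_def)
  next
    case (5 t r' m')
    then show ?case by simp
  qed (use n_bounds same_refl in auto)
qed

lemma rank_spec:
  assumes g: "glob r" and c: "r 10 = c" "c < d" and o: "bij_betw (out m) {1..n} {1..n}" "out m 0 = 0"
    and so: "\<And>p q. 1 \<le> p \<Longrightarrow> p \<le> q \<Longrightarrow> q \<le> n \<Longrightarrow> key m (out m p) \<le> key m (out m q)"
  shows "runs w rank_prog r m 0 (\<lambda>t r' m'. t \<le> n * 60 + 20 \<and> (\<forall>j<11. r' j = r j) \<and>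
    same {5} m m' \<and> (\<forall>c'<d. \<forall>u<N. c' \<noteq> c \<or> u = 0 \<longrightarrow> rk m' c' u = rk m c' u) \<and>
    (\<forall>u\<in>{1..n}. rk m' c u \<le> n \<and> (\<forall>u'\<in>{1..n}. rk m' c u \<le> rk m' c u' \<longleftrightarrow> key m u \<le> key m u')))"
proof -
  have gr: "r 5 = N" "r 4 = M" "r 2 = L" "r 0 = n" using g by (simp_all add: glob_def)
  have on: "out m p \<in> {1..n}" if "p \<in> {1..n}" for p using o(1) that by (rule bij_betwE[rule_format])
  have on0: "out m p < N" if "p \<le> n" for p
    using on[of p] o(2) that n_bounds by (cases "p = 0") auto
  have oi: "out m p = out m q \<longleftrightarrow> p = q" if "p \<in> {1..n}" "q \<in> {1..n}" for p q
    using o(1) that by (meson bij_betw_imp_inj_on inj_on_eq_iff)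
  define I where "I i r' m' \<longleftrightarrow> (\<forall>j<11. r' j = r j) \<and> r' 11 = i \<and> same {5} m m' \<and>
     (\<forall>c'<d. \<forall>u<N. c' \<noteq> c \<or> u = 0 \<longrightarrow> rk m' c' u = rk m c' u) \<and> r' 12 \<le> i \<and>
     (\<forall>p\<in>{1..i}. rk m' c (out m p) \<le> r' 12) \<and> (1 \<le> i \<longrightarrow> rk m' c (out m i) = r' 12) \<and>
     (\<forall>p\<in>{1..i}. \<forall>q\<in>{1..i}. rk m' c (out m p) \<le> rk m' c (out m q) \<longleftrightarrow> key m (out m p) \<le> key m (out m q))"
    for i r' m'
  show ?thesis unfolding rank_prog_def runs_Seq runs_Assign
  proof (rule runs_For[where I = I and B = n and T = 50], goal_cases)
    case 1
    then show ?case by (simp add: I_def ev same_refl)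
  next
    case (3 i r' m')
    then show ?case by (simp add: I_def gr)
  next
    case (4 i r' m')
    then have i: "i < n" and r': "\<And>j. j < 11 \<Longrightarrow> r' j = r j" "r' 11 = i"
      and sm: "same {5} m m'" and fr: "\<And>c' u. c' < d \<Longrightarrow> u < N \<Longrightarrow> c' \<noteq> c \<or> u = 0 \<Longrightarrow> rk m' c' u = rk m c' u"
      and ri: "r' 12 \<le> i" and le: "\<And>p. p \<in> {1..i} \<Longrightarrow> rk m' c (out m p) \<le> r' 12"
      and last: "1 \<le> i \<Longrightarrow> rk m' c (out m i) = r' 12"
      and iff: "\<And>p q. p \<in> {1..i} \<Longrightarrow> q \<in> {1..i} \<Longrightarrow>
        rk m' c (out m p) \<le> rk m' c (out m q) \<longleftrightarrow> key m (out m p) \<le> key m (out m q)"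
      unfolding I_def by blast+
    define u u0 where "u = out m (i + 1)" and "u0 = out m i"
    have uN: "u < N" "u0 < N" "u \<in> {1..n}" using on0[of "i + 1"] on0[of i] on[of "i + 1"] i by (auto simp: u_def u0_def)
    then have uM: "u < M" "u0 < M" using N2M by linarith+
    have ld: "m' (adr 4 (i + 1)) = u" "m' (adr 4 i) = u0" "m' (adr 3 u) = key m u" "m' (adr 3 u0) = key m u0"
      using sameD[OF sm] uM i n_bounds by (simp_all add: u_def u0_def out_def key_def)
    have cM: "c * N + u < M" using rkM c(2) uN by blast
    have E: "eval_binop w Add (r' 12) 1 = r' 12 + 1" "eval_binop w Mult c N = c * N"
      "eval_binop w Add (c * N) u = c * N + u"
      using cM ri i n_bounds by (intro ev_Add ev_Mult; linarith)+
    define R where "R = (if key m u0 < key m u then r' 12 + 1 else r' 12)"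
    let ?m = "m'(adr 5 (c * N + u) := R)"
    have sm2: "same {5} m ?m"
      using cM by (intro same_trans[OF sm same_store[of 5 "{5}"]]) auto
    have rk: "rk ?m c' v = (if c' = c \<and> v = u then R else rk m' c' v)" if "c' < d" "v < N" for c' v
    proof -
      have "c' * N + v = c * N + u \<longleftrightarrow> c' = c \<and> v = u"
      proof -
        have "(c' * N + v) div N = c'" "(c' * N + v) mod N = v" "(c * N + u) div N = c" "(c * N + u) mod N = u"
          using that uN N2 by simp_all
        then show ?thesis by metis
      qed
      then show ?thesis using rkM[OF that] cM by (simp add: rk_def adr_eq)
    qed
    have rkp: "rk ?m c (out m p) = (if p = Suc i then R else rk m' c (out m p))" if "p \<in> {1..Suc i}" for p
      using rk[OF c(2) on0[of p]] oi[of p "i + 1"] that i by (auto simp: u_def)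
    have fr2: "\<forall>c'<d. \<forall>u<N. c' \<noteq> c \<or> u = 0 \<longrightarrow> rk ?m c' u = rk m c' u"
      using fr rk uN(3) by auto
    have Ri: "r' 12 \<le> R" "R \<le> Suc i" using ri by (simp_all add: R_def)
    have le2: "\<forall>p\<in>{1..Suc i}. rk ?m c (out m p) \<le> R"
    proof
      fix p assume p: "p \<in> {1..Suc i}"
      show "rk ?m c (out m p) \<le> R"
        unfolding rkp[OF p] using le[of p] p Ri(1) by (cases "p = Suc i") auto
    qed
    have iff2: "\<forall>p\<in>{1..Suc i}. \<forall>q\<in>{1..Suc i}.
        rk ?m c (out m p) \<le> rk ?m c (out m q) \<longleftrightarrow> key m (out m p) \<le> key m (out m q)"
    proof (intro ballI)
      fix p q assume p: "p \<in> {1..Suc i}" and q: "q \<in> {1..Suc i}"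
      consider "p = q" | "p \<le> i" "q \<le> i" | "p \<le> i" "q = Suc i" | "p = Suc i" "q \<le> i"
        using p q by fastforce
      then show "rk ?m c (out m p) \<le> rk ?m c (out m q) \<longleftrightarrow> key m (out m p) \<le> key m (out m q)"
      proof cases
        case 2
        then show ?thesis using iff[of p q] p q rkp by simp
      next
        case 3
        then show ?thesis using so[of p q] le[of p] p q rkp Ri i by simp
      next
        \<comment> \<open>The new box against an old one. If the key grew, the new rank exceeds all
          old ones. Otherwise the new box has the rank and the key of its predecessor at position
          \<open>i\<close>, and the invariant for that box applies.\<close>
        case 4
        then have i1: "1 \<le> i" and qi: "q \<in> {1..i}" using q by auto
        have e: "rk ?m c (out m p) = R" "rk ?m c (out m q) = rk m' c (out m q)"
          using rkp[OF p] rkp[OF q] 4 by simp_all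
        have kq: "key m (out m q) \<le> key m u0" unfolding u0_def using so qi i by auto
        have k0: "key m u0 \<le> key m u" unfolding u0_def u_def using so[of i "i + 1"] i1 i by simp
        have pu: "out m p = u" using 4 by (simp add: u_def)
        show ?thesis
        proof (cases "key m u0 < key m u")
          case True
          then show ?thesis using e le[OF qi] kq pu by (simp add: R_def)
        next
          case False
          then have "key m u0 = key m u" using k0 by simp
          then show ?thesis using e iff[of i q] i1 qi last[OF i1] pu False by (simp add: R_def u0_def)
        qed
      qed simp
    qed
    have lst: "rk ?m c (out m (Suc i)) = R" using rkp[of "Suc i"] by simp
    have st: "I (Suc i) r'' ?m" if "\<And>j. j < 11 \<Longrightarrow> r'' j = r j" "r'' 11 = Suc i" "r'' 12 = R" for r''
      unfolding I_def that(2,3) using that(1) sm2 fr2 le2 iff2 lst Ri by blast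
    show ?case
    proof (cases "key m u0 < key m u")
      case True
      then have Re: "R = r' 12 + 1" by (simp add: R_def)
      have "I (Suc i) (r'(13 := u, 12 := r' 12 + 1, 11 := Suc i)) (m'(adr 5 (c * N + u) := r' 12 + 1))"
        by (rule st[unfolded Re]) (simp_all add: r'(1))
      then show ?thesis using True i n_bounds
        by (simp add: ev r' gr c(1) E E_Suc ld uM cM del: One_nat_def)
    next
      case False
      then have Re: "R = r' 12" by (simp add: R_def)
      have "I (Suc i) (r'(13 := u, 11 := Suc i)) (m'(adr 5 (c * N + u) := r' 12))"
        by (rule st[unfolded Re]) (simp_all add: r'(1))
      then show ?thesis using False i n_bounds
        by (simp add: ev r' gr c(1) E E_Suc ld uM cM del: One_nat_def)
    qed
  next
    case (5 t r' m')
    then have rn: "r' 12 \<le> n" and le: "\<And>p. p \<in> {1..n} \<Longrightarrow> rk m' c (out m p) \<le> r' 12"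
      and iff: "\<And>p q. p \<in> {1..n} \<Longrightarrow> q \<in> {1..n} \<Longrightarrow>
        rk m' c (out m p) \<le> rk m' c (out m q) \<longleftrightarrow> key m (out m p) \<le> key m (out m q)" unfolding I_def by blast+
    have "\<forall>u\<in>out m ` {1..n}. rk m' c u \<le> n \<and>
        (\<forall>u'\<in>out m ` {1..n}. rk m' c u \<le> rk m' c u' \<longleftrightarrow> key m u \<le> key m u')"
      using iff order.trans[OF le rn] by blast
    then have "\<forall>u\<in>{1..n}. rk m' c u \<le> n \<and> (\<forall>u'\<in>{1..n}. rk m' c u \<le> rk m' c u' \<longleftrightarrow> key m u \<le> key m u')"
      unfolding bij_betw_imp_surj_on[OF o(1)] .
    then show ?case using 5 unfolding I_def by simp
  qed (use n_bounds in auto)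
qed

definition trie0 :: "(nat \<Rightarrow> nat) \<Rightarrow> bool" where
  "trie0 m \<longleftrightarrow> (\<forall>a y. 7 \<le> a \<longrightarrow> y < M \<longrightarrow> m (adr a y) = 0)"

lemma total_spec:
  assumes g: "glob r" and R: "\<And>c u. c < d \<Longrightarrow> u \<in> {1..n} \<Longrightarrow> rk m c u \<le> n"
  shows "runs w (total_prog d) r m 0 (\<lambda>t r' m'. t \<le> n * (d * 40 + 60) + 10 \<and> (\<forall>j<10. r' j = r j) \<and>
    same {3} m m' \<and> (\<forall>u\<in>{1..n}. key m' u = (\<Sum>c<d. rk m c u)))"
proof -
  have gr: "r 5 = N" "r 4 = M" "r 2 = L" "r 0 = n" using g by (simp_all add: glob_def)
  let ?I = "\<lambda>i r' m'. (\<forall>j<10. r' j = r j) \<and> r' 11 = i \<and> same {3} m m' \<and>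
    (\<forall>u\<in>{1..i}. key m' u = (\<Sum>c<d. rk m c u))"
  have dn: "d * n \<le> M"
  proof -
    have "d * n \<le> d * N" using n_bounds by (intro mult_le_mono2) simp
    then show ?thesis using dN powN by linarith
  qed
  show ?thesis unfolding total_prog_def
  proof (rule runs_For[where I = ?I and B = n and T = "d * 40 + 40"], goal_cases)
    case (3 i r' m')
    then show ?case by (simp add: gr)
  next
    case (4 i r' m')
    then have i: "i < n" and r': "\<And>j. j < 10 \<Longrightarrow> r' j = r j" "r' 11 = i"
      and sm: "same {3} m m'" and ke: "\<And>u. u \<in> {1..i} \<Longrightarrow> key m' u = (\<Sum>c<d. rk m c u)" by blast+
    have iM: "i + 1 < M" using i n_bounds by linarith
    let ?J = "\<lambda>c r'' m''. (\<forall>j<10. r'' j = r j) \<and> r'' 11 = i \<and> r'' 13 = i + 1 \<and> m'' = m' \<and> r'' 10 = c \<and> c \<le> d \<and>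
       r'' 12 = (\<Sum>c<c. rk m c (i + 1))"
    show ?case unfolding runs_Seq runs_Assign
    proof (rule runs_For[where I = ?J and B = d and T = 25], goal_cases)
      case 1
      then show ?case using E_Suc[OF i] by (simp add: ev r' del: One_nat_def)
    next
      case (4 c r'' m'')
      then have c: "c < d" and r'': "\<And>j. j < 10 \<Longrightarrow> r'' j = r j" "r'' 11 = i" "r'' 13 = i + 1" "m'' = m'" "r'' 10 = c"
         "r'' 12 = (\<Sum>c<c. rk m c (i + 1))" by blast+
      have cM: "c * N + (i + 1) < M" using rkM[OF c, of "i + 1"] i n_bounds by simp
      have b: "(\<Sum>c<c. rk m c (i + 1)) \<le> M" "rk m c (i + 1) \<le> M"
      proof -
        have "(\<Sum>c<c. rk m c (i + 1)) \<le> (\<Sum>c<c. n)" using R c i by (intro sum_mono) auto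
        also have "\<dots> \<le> d * n" using c by simp
        finally show "(\<Sum>c<c. rk m c (i + 1)) \<le> M" using dn by linarith
        show "rk m c (i + 1) \<le> M" using R[OF c, of "i + 1"] i n_bounds by (simp add: order.trans)
      qed
      have E: "eval_binop w Mult c N = c * N" "eval_binop w Add (c * N) (i + 1) = c * N + (i + 1)"
        "eval_binop w Add (\<Sum>c<c. rk m c (i + 1)) (rk m c (i + 1)) = (\<Sum>c<Suc c. rk m c (i + 1))"
        using cM b unfolding sum.lessThan_Suc by (intro ev_Add ev_Mult; linarith)+
      have ld: "m' (adr 5 (c * N + (i + 1))) = rk m c (i + 1)"
        using sameD[OF sm _ cM, of 5] by (simp add: rk_def)
      show ?case using c cM
        by (simp add: ev r'' gr E ld del: One_nat_def sum.lessThan_Suc Suc_eq_plus1 add_Suc_right)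
    next
      case (5 t'' r'' m'')
      then have r'': "\<And>j. j < 10 \<Longrightarrow> r'' j = r j" "r'' 11 = i" "r'' 13 = i + 1" "m'' = m'"
         "r'' 12 = (\<Sum>c<d. rk m c (i + 1))" and t'': "t'' \<le> d * 33 + 30" by simp_all
      let ?m = "m'(adr 3 (i + 1) := (\<Sum>c<d. rk m c (i + 1)))"
      have sm2: "same {3} m ?m"
        using iM by (intro same_trans[OF sm same_store[of 3 "{3}"]]) auto
      have k2: "\<forall>p\<in>{1..Suc i}. key ?m p = (\<Sum>c<d. rk m c p)"
      proof
        fix p assume p: "p \<in> {1..Suc i}"
        show "key ?m p = (\<Sum>c<d. rk m c p)"
          using ke[of p] p i n_bounds by (cases "p = Suc i") (simp_all add: key_def adr_eq)
      qed
      show ?case using sm2 k2 t'' iM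
        by (simp add: ev r'' gr del: One_nat_def)
    qed (use kdw in auto)
  next
    case (5 t r' m')
    then show ?case by (simp add: algebra_simps)
  qed (use n_bounds same_refl in auto)
qed

lemma tree_same: "tree m {} \<Longrightarrow> same S m m' \<Longrightarrow> 6 \<notin> S \<Longrightarrow> tree m' {}"
proof (rule empty_tree)
  fix v assume a: "tree m {}" "same S m m'" "6 \<notin> S" "1 \<le> v" "v < 2 * N"
  then have "tr m' v = tr m v" using N2M N2 by (auto simp: tr_def intro: sameD)
  then show "tr m' v = 0" using tree_empty[OF a(1,4,5)] by simp
qed

lemma rk_same: "same S m m' \<Longrightarrow> 5 \<notin> S \<Longrightarrow> c < d \<Longrightarrow> u < N \<Longrightarrow> rk m' c u = rk m c u"
  unfolding rk_def by (rule sameD) (auto intro: rkM)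

text \<open>The interface to the dynamic program: dominance of ranks is fitting of the original
  boxes, and the positions are a topological order up to ties. Boxes are numbered from 1 but rows of
  \<open>B\<close> from 0, hence \<open>- 1\<close>.\<close>

definition prepared :: "(nat \<Rightarrow> nat \<Rightarrow> nat) \<Rightarrow> (nat \<Rightarrow> nat) \<Rightarrow> bool" where
  "prepared B m \<longleftrightarrow> (\<exists>X. prep m X \<and> bij_betw (out m) {1..n} {1..n} \<and> (\<forall>t. le X 0 t) \<and>
    (\<forall>p\<in>{1..n}. \<forall>t\<in>{1..n}. le X p t \<longleftrightarrow> (\<forall>c<d. B (out m p - 1) c \<le> B (out m t - 1) c)) \<and>
    (\<forall>p t. 1 \<le> p \<longrightarrow> p < t \<longrightarrow> t \<le> n \<longrightarrow> le X t p \<longrightarrow> le X p t))"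

lemma prep_spec:
  assumes g: "glob r" and B: "input B m" and p: "pow_ok m" and
    z: "\<And>a y. 3 \<le> a \<Longrightarrow> y < M \<Longrightarrow> m (adr a y) = 0"
  shows "runs w (prep_prog d) r m 0 (\<lambda>t r' m'. t \<le> n * (L * (140 * d + 140) + 640 * d + 300) + 200 * d + 100 \<and>
    (\<forall>j<10. r' j = r j) \<and> trie0 m' \<and>
    prepared B m')"
proof -
  have gr: "r 5 = N" "r 4 = M" "r 2 = L" "r 0 = n" using g by (simp_all add: glob_def)
  let ?R = "\<lambda>m c. \<forall>u\<in>{1..n}. rk m c u \<le> n \<and> (\<forall>u'\<in>{1..n}. rk m c u \<le> rk m c u' \<longleftrightarrow> B (u - 1) c \<le> B (u' - 1) c)"
  let ?I = "\<lambda>c r' m'. (\<forall>j<10. r' j = r j) \<and> r' 10 = c \<and> same {3, 4, 5, 6} m m' \<and> tree m' {} \<and>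
     out m' 0 = 0 \<and> (\<forall>c<d. rk m' c 0 = 0) \<and> (\<forall>c'<c. ?R m' c')"
  show ?thesis unfolding prep_prog_def runs_Seq
  proof (rule runs_For[where I = ?I and B = d and T = "n * (L * 140 + 290) + 50"], goal_cases)
    case 1
    have "tree m {}" using z N2M N2 by (intro empty_tree) (simp add: tr_def)
    moreover have "rk m c 0 = 0" if "c < d" for c using z rkM[OF that, of 0] N2 by (simp add: rk_def)
    moreover have "out m 0 = 0" using z n_bounds by (simp add: out_def)
    ultimately show ?case by (simp add: same_refl)
  next
    case (4 c r' m')
    then have c: "c < d" and r': "\<And>j. j < 10 \<Longrightarrow> r' j = r j" "r' 10 = c" and sm: "same {3, 4, 5, 6} m m'"
      and t: "tree m' {}" and o: "out m' 0 = 0" and rz: "\<And>c. c < d \<Longrightarrow> rk m' c 0 = 0"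
      and R: "\<And>c'. c' < c \<Longrightarrow> ?R m' c'" by blast+
    have g': "glob r'" using g r' by (auto intro: glob_cong)
    have B': "input B m'" using input_cong[OF B sm] by simp
    show ?case unfolding runs_Seq
    proof (rule runs_conseq[OF fill_spec[OF g' r'(2) c B']], goal_cases)
      case a1: (1 t1 r1 m1)
      then have g1: "glob r1" using g' by (auto intro: glob_cong)
      have tr1: "tree m1 {}" using tree_same[OF t, of "{3}"] a1 by simp
      show ?case
      proof (rule runs_call[OF sort_spec[OF g1 tr1]], goal_cases)
        case a2: (1 t2 r2 m2)
        have o1: "out m1 0 = 0" using o a1 n_bounds sameD[of "{3}" m' m1 4 0] by (simp add: out_def)
        have on: "out m2 p \<in> {1..n}" if "p \<in> {1..n}" for p using a2 that bij_betwE by blast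
        have k: "key m2 u = key m1 u" if "u \<in> {1..n}" for u
          unfolding key_def using a2 that n_bounds by (intro sameD[of "{4, 6}"]) auto
        have so: "key m2 (out m2 p) \<le> key m2 (out m2 q)" if "1 \<le> p" "p \<le> q" "q \<le> n" for p q
          using a2 that k on by simp
        have g2: "glob r2" using g1 a2 by (auto intro: glob_cong)
        have r2: "r2 10 = c" using a2 a1 r' by simp
        have b2: "bij_betw (out m2) {1..n} {1..n}" "out m2 0 = 0" using a2 o1 by simp_all
        show ?case
        proof (rule runs_call[OF rank_spec[OF g2 r2 c b2 so]], goal_cases)
          case a3: (4 t3 r3 m3)
          have sm1: "same {3} m' m1" and sm2: "same {4, 6} m1 m2" and sm3: "same {5} m2 m3"
            using a1 a2 a3 by blast+
          have sm12: "same {3, 4, 6} m' m2" using sm1 sm2 by (rule same_trans) auto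
          have old: "rk m2 c' u = rk m' c' u" if "c' < d" "u < N" for c' u
            using rk_same[OF sm12] that by simp
          have "t1 + t2 + t3 \<le> n * (L * 140 + 290) + 50"
            using a1 a2 a3 by (simp add: algebra_simps)
          moreover have "\<forall>j<10. r3 j = r j" "r3 10 = c" using a1 a2 a3 r' by simp_all
          moreover have "same {3, 4, 5, 6} m m3"
            using same_trans[OF sm same_trans[OF sm12 sm3, of "{3, 4, 5, 6}"]] by simp
          moreover have "tree m3 {}" using a2 tree_same[OF _ sm3] by simp
          moreover have "out m3 0 = 0"
            using a2 o1 sameD[OF sm3, of 4 0] n_bounds by (simp add: out_def)
          moreover have "\<forall>c<d. rk m3 c 0 = 0" using a3 old rz N2 by simp
          moreover have "?R m3 c'" if "c' < Suc c" for c'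
          proof (cases "c' = c")
            case True
            then show ?thesis using a3 k a1 by simp
          next
            case False
            then have "c' < c" "c' < d" using that c by simp_all
            moreover have "rk m3 c' u = rk m' c' u" if "u \<in> {1..n}" for u
              using a3 old[of c' u] \<open>c' < d\<close> False that n_bounds by simp
            ultimately show ?thesis using R[of c'] by simp
          qed
          ultimately show ?case
            by simp
        qed
      qed
    qed
  next
    case (5 t0 r0 m0)
    note t0 = 5(1)
    note r0 = 5(2)[THEN conjunct1, rule_format]
    note I1 = 5(2)[THEN conjunct2, THEN conjunct2]
    note sm = I1[THEN conjunct1] and I2 = I1[THEN conjunct2]
    note t = I2[THEN conjunct1] and I3 = I2[THEN conjunct2]
    note o = I3[THEN conjunct1] and I4 = I3[THEN conjunct2]
    note rz = I4[THEN conjunct1, rule_format] and R = I4[THEN conjunct2, THEN spec, THEN mp]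
    have g0: "glob r0" using g r0 by (auto intro: glob_cong)
    have Rn: "rk m0 c u \<le> n" if "c < d" "u \<in> {1..n}" for c u using R that by blast
    show ?case
    proof (rule runs_call[OF total_spec[OF g0 Rn]], goal_cases)
      case a1: (3 t1 r1 m1)
      have g1: "glob r1" using g0 a1 by (auto intro: glob_cong)
      have tr1: "tree m1 {}" using tree_same[OF t, of "{3}"] a1 by simp
      show ?case
      proof (rule runs_call[OF sort_spec[OF g1 tr1]], goal_cases)
        case a2: (1 t2 r2 m2)
        have sm1: "same {3} m0 m1" and sm2: "same {4, 6} m1 m2" using a1 a2 by blast+
        have sm02: "same {3, 4, 6} m0 m2" using sm1 sm2 by (rule same_trans) auto
        have sma: "same {3, 4, 5, 6} m m2" using sm sm02 by (rule same_trans) auto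
        define X where "X p c = rk m2 c (out m2 p)" for p c
        have o2: "out m2 0 = 0" using o a2 n_bounds sameD[OF sm1, of 4 0] by (simp add: out_def)
        have on: "out m2 p \<in> {1..n}" if "p \<in> {1..n}" for p using a2 that bij_betwE by blast
        have old: "rk m2 c u = rk m0 c u" if "c < d" "u < N" for c u
          using rk_same[OF sm02] that by simp
        have X0: "X 0 c = 0" if "c < d" for c using that rz old[of c 0] N2 by (simp add: X_def o2)
        have Xp: "X p c = rk m0 c (out m2 p)" if "c < d" "p \<in> {1..n}" for p c
          using old[OF that(1), of "out m2 p"] on[OF that(2)] n_bounds by (simp add: X_def)
        have Xn: "X p c \<le> n" if "c < d" "p \<le> n" for p c
          using X0[OF that(1)] Xp[OF that(1), of p] Rn[OF that(1), of "out m2 p"] on[of p] that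
          by (cases "p = 0") auto
        have "prep m2 X"
          unfolding prep_def
        proof (intro conjI allI impI)
          show "pow_ok m2" using pow_ok_cong[OF p] sameD[OF sma] by simp
          fix p assume p: "p \<le> n"
          show "m2 (adr 4 p) < N" using on[of p] o2 p n_bounds by (cases "p = 0") (auto simp: out_def)
          fix c assume "c < d"
          then show "X p c = m2 (adr 5 (c * N + m2 (adr 4 p)))" "X p c + 1 < N"
            using Xn[of c p] p nN by (simp_all add: X_def rk_def out_def)
        qed
        moreover have "\<forall>t. le X 0 t" using X0 by (simp add: le_def)
        moreover have iff: "le X p t \<longleftrightarrow> (\<forall>c<d. B (out m2 p - 1) c \<le> B (out m2 t - 1) c)"
          if "p \<in> {1..n}" "t \<in> {1..n}" for p t
          using R on[OF that(1)] on[OF that(2)] Xp that unfolding le_def by simp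
        \<comment> \<open>A later box has at least the rank sum of an earlier one, and at most that
          sum if it fits into it. Tuples that are ordered componentwise and have equal sums are
          equal, so the fitting is mutual.\<close>
        moreover have "le X p t" if "1 \<le> p" "p < t" "t \<le> n" "le X t p" for p t
        proof -
          have pt: "p \<in> {1..n}" "t \<in> {1..n}" using that by auto
          have "key m1 (out m2 p) \<le> key m1 (out m2 t)" using a2 that by simp
          then have "(\<Sum>c<d. X p c) \<le> (\<Sum>c<d. X t c)" using a1 on pt Xp by simp
          moreover have "(\<Sum>c<d. X t c) \<le> (\<Sum>c<d. X p c)"
            using that(4) by (intro sum_mono) (simp add: le_def)
          ultimately have e: "(\<Sum>c<d. X t c) = (\<Sum>c<d. X p c)" by simp
          have "X t c = X p c" if "c < d" for c
            using sum_mono_inv[OF e, of c] \<open>le X t p\<close> that by (simp add: le_def)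
          then show ?thesis by (simp add: le_def)
        qed
        moreover have "trie0 m2" using z sameD[OF sma] unfolding trie0_def by simp
        moreover have "t0 + t1 + t2 \<le> n * (L * (140 * d + 140) + 640 * d + 300) + 200 * d + 100"
          using t0 a1 a2 by (simp add: algebra_simps)
        moreover have "\<forall>j<10. r2 j = r j" using a1 a2 r0 by simp
        ultimately show ?case
          using a2 unfolding prepared_def by blast
      qed
    qed
  qed (use kdw in auto)
qed

end

section \<open>The dynamic program\<close>

text \<open>Every box is added at a position larger than all positions used before, so the number of
  boxes is at most the last position.\<close>

lemma reach_bound: "reach k n le js v \<Longrightarrow> (\<And>i. i < k \<Longrightarrow> js i \<le> t) \<Longrightarrow> v \<le> t"
proof (induction arbitrary: t rule: reach.induct)
  case (reach_step js v m t')
  have "v \<le> t' - 1"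
  proof (rule reach_step.IH)
    fix i assume "i < k"
    then have "js i < t'" using reach_step.hyps by blast
    then show "js i \<le> t' - 1" by simp
  qed
  moreover have "t' \<le> t" using reach_step.prems[of m] reach_step.hyps by simp
  ultimately show ?case using reach_step.hyps by linarith
qed simp

text \<open>The box added last has the strictly largest position, so the pile that carries the
  maximum is the one extended by the last step.\<close>

lemma reach_last:
  assumes "reach k n le js v" "m < k" "1 \<le> js m" "\<And>i. i < k \<Longrightarrow> js i \<le> js m"
  shows "\<exists>js0 v0. v = Suc v0 \<and> reach k n le js0 v0 \<and> js = js0(m := js m) \<and>
    (\<forall>i<k. js0 i < js m) \<and> le (js0 m) (js m)"
  using assms(1)
proof cases
  case (reach_step js0 v0 m' t)
  have "m' = m"
  proof (rule ccontr)
    assume "m' \<noteq> m"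
    then have "js m < t" using reach_step assms(2) by simp
    moreover have "js m' = t" using reach_step by simp
    ultimately show False using assms(4)[of m'] reach_step by simp
  qed
  then show ?thesis using reach_step by auto
qed (use assms in simp)

text \<open>Register 33 is the answer of the query, 0 meaning that no predecessor is attained, and
  16 keeps the best value. Register 11 is \<open>t\<close>, 13 is \<open>N ^ m\<close> and 15 the
  code of the other piles, so 20 receives the code of the new tuple.\<close>

definition extend_prog :: "nat \<Rightarrow> nat \<Rightarrow> com" where
  "extend_prog k d =
    Cond (Reg 33)
      (Assign 21 (Bin Add (Reg 33) (Const 1)) ;;
       Cond (Bin Less (Reg 16) (Reg 21)) (Assign 16 (Reg 21)) Skip ;;
       Assign 20 (Bin Add (Reg 15) (Bin Mult (Reg 11) (Reg 13))) ;;
       insert_prog k d)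
      Skip"

text \<open>Detects that \<open>t\<close> already lies on another pile. Such tuples may have been
  stored for an earlier pile, and a query could find them and use \<open>t\<close> twice. Entries
  above \<open>t\<close> need no test, as no tuple with such an entry has been stored yet.\<close>

definition digits_prog :: "nat \<Rightarrow> com" where
  "digits_prog k =
    For 19 (Const k)
      (Cond (Bin Equal (Bin Mod (Reg 18) (Reg 5)) (Reg 11)) (Assign 17 (Const 2)) Skip ;;
       Assign 18 (Bin Div (Reg 18) (Reg 5)))"

definition locate_prog :: com where
  "locate_prog =
    Assign 15 (Bin Add (Bin Mod (Reg 14) (Reg 13)) (Bin Mult (Bin Div (Reg 14) (Reg 13)) (Bin Mult (Reg 13) (Reg 5)))) ;;
    Assign 17 (Const 0) ;;
    Assign 18 (Reg 15)"

definition search_prog :: "nat \<Rightarrow> nat \<Rightarrow> com" where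
  "search_prog k d =
    Assign 30 (Bin Add (Const 7) (Reg 12)) ;;
    Assign 31 (Reg 15) ;;
    Assign 32 (Load (At (Const 4) (Reg 11))) ;;
    query_prog d ;;
    extend_prog k d"

definition step_prog :: "nat \<Rightarrow> nat \<Rightarrow> com" where
  "step_prog k d = locate_prog ;; digits_prog k ;; Cond (Reg 17) Skip (search_prog k d)"

definition round_prog :: "nat \<Rightarrow> nat \<Rightarrow> com" where
  "round_prog k d =
    Assign 11 (Bin Add (Reg 10) (Const 1)) ;;
    Assign 13 (Const 1) ;;
    For 12 (Const k)
      (For 14 (Reg 7) (step_prog k d) ;;
       Assign 13 (Bin Mult (Reg 13) (Reg 5)))"

text \<open>Tuple 0, with all piles empty, is entered with value 1; this offset is removed from the
  best value at the end.\<close>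

definition main_prog :: "nat \<Rightarrow> nat \<Rightarrow> com" where
  "main_prog k d =
    Assign 16 (Const 1) ;; Assign 20 (Const 0) ;; Assign 21 (Const 1) ;;
    insert_prog k d ;;
    For 10 (Reg 0) (round_prog k d) ;;
    Assign 0 (Bin Sub (Reg 16) (Const 1))"

section \<open>Invariant of the dynamic program\<close>

context ram begin

lemma dig_zero: "J < N ^ k \<Longrightarrow> k \<le> i \<Longrightarrow> dig N J i = 0"
proof -
  assume "J < N ^ k" "k \<le> i"
  moreover then have "N ^ k \<le> N ^ i" using N2 by (intro power_increasing) auto
  ultimately have "J < N ^ i" by linarith
  then show ?thesis by (simp add: dig_def)
qed

lemma dig_less: "dig N J i < N" using N2 by (simp add: dig_def)

lemma code_of_dig: "J < N ^ k \<Longrightarrow> code N k (dig N J) = J"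
  by (simp add: code_dig)

lemma dig_of_code: "(\<And>i. i < k \<Longrightarrow> f i < N) \<Longrightarrow> (\<And>i. k \<le> i \<Longrightarrow> f i = 0) \<Longrightarrow> dig N (code N k f) = f"
proof
  fix i assume f: "\<And>i. i < k \<Longrightarrow> f i < N" "\<And>i. k \<le> i \<Longrightarrow> f i = 0"
  show "dig N (code N k f) i = f i"
  proof (cases "i < k")
    case True
    then show ?thesis using dig_code[of k f N i] f by simp
  next
    case False
    have "code N k f < N ^ k" using f(1) by (rule code_less)
    then show ?thesis using dig_zero[of "code N k f" i] f(2)[of i] False by simp
  qed
qed

lemma rst_code: "J < N ^ k \<Longrightarrow> m < k \<Longrightarrow> rst J m = code N k ((dig N J)(m := 0))"
  using code_upd[of m k N "dig N J" "dig N J m"] code_of_dig[of J] by (simp add: rst_def)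

text \<open>
  The tuples treated before step \<open>(t, m, R)\<close> of the program, which enters \<open>t\<close> on pile \<open>m\<close> for all
  choices \<open>R\<close> of the other piles. In the table, values are increased by 1, so that 0 means that the
  tuple cannot be attained.
\<close>

definition proc :: "nat \<Rightarrow> nat \<Rightarrow> nat \<Rightarrow> (nat \<Rightarrow> nat) \<Rightarrow> bool" where
  "proc t m R js \<longleftrightarrow> (\<forall>i<k. js i < t) \<or>
     (\<exists>m'<k. js m' = t \<and> (\<forall>i<k. i \<noteq> m' \<longrightarrow> js i < t) \<and>
       (m' < m \<or> m' = m \<and> (\<exists>R'<R. code N k (js(m' := 0)) = insert0 N m' R')))"

text \<open>Soundness: stored values are attained, up to the offset. Completeness: attained values
  of tuples in \<open>Q\<close> are matched by stored ones. With \<open>Q\<close> as a parameter,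
  passing from one loop to the next only means rewriting \<open>proc\<close>.\<close>

definition dp :: "(nat \<Rightarrow> nat \<Rightarrow> nat) \<Rightarrow> (nat \<Rightarrow> nat) \<Rightarrow> nat \<Rightarrow> (nat \<times> nat) set \<Rightarrow>
    ((nat \<Rightarrow> nat) \<Rightarrow> bool) \<Rightarrow> bool" where
  "dp X m a S Q \<longleftrightarrow> prep m X \<and> trie X m S \<and>
     (\<forall>J v. (J, v) \<in> S \<longrightarrow> 1 \<le> v \<and> v \<le> a \<and> reach k n (le X) (dig N J) (v - 1) \<and> Q (dig N J)) \<and>
     (\<exists>J. (J, a) \<in> S) \<and>
     (\<forall>js v. reach k n (le X) js v \<longrightarrow> Q js \<longrightarrow> (\<exists>v'\<ge>Suc v. (code N k js, v') \<in> S))"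

lemma dp_cong:
  assumes "dp X m a S Q" "\<And>js v. reach k n (le X) js v \<Longrightarrow> Q js \<longleftrightarrow> Q' js"
  shows "dp X m a S Q'"
  using assms(1) assms(2) unfolding dp_def by blast

lemma reach_lessN: "reach k n (le X) js v \<Longrightarrow> js i < N"
  using reach_le[of k n "le X" js v i] n_bounds by simp

text \<open>By \<open>insert0_surj\<close>, the numbers below \<open>N ^ (k - 1)\<close> cover all
  choices for the other piles.\<close>

lemma proc_next_m:
  assumes r: "reach k n (le X) js v" and m: "m < k"
  shows "proc t m (N ^ (k - 1)) js \<longleftrightarrow> proc t (Suc m) 0 js"
proof -
  have "\<exists>R'<N ^ (k - 1). code N k (js(m := 0)) = insert0 N m R'"
    using reach_lessN[OF r] m N2 by (intro insert0_surj) auto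
  then show ?thesis unfolding proc_def less_Suc_eq by blast
qed

text \<open>By \<open>reach_last\<close>, the largest position of a reachable tuple occurs on one
  pile only, so the passes over the \<open>k\<close> piles cover every tuple with maximum
  \<open>t\<close>.\<close>

lemma proc_next_t:
  assumes r: "reach k n (le X) js v" and t: "1 \<le> t"
  shows "proc t k 0 js \<longleftrightarrow> proc (Suc t) 0 0 js"
proof
  assume "proc t k 0 js"
  then show "proc (Suc t) 0 0 js" unfolding proc_def by (metis less_Suc_eq)
next
  assume "proc (Suc t) 0 0 js"
  then have le: "js i \<le> t" if "i < k" for i using that by (auto simp: proc_def less_Suc_eq_le)
  show "proc t k 0 js"
  proof (cases "\<forall>i<k. js i < t")
    case True
    then show ?thesis by (simp add: proc_def)
  next
    case False
    then obtain m where m: "m < k" "js m = t" using le by (meson le_neq_implies_less)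
    then obtain js0 where "js = js0(m := t)" "\<forall>i<k. js0 i < t"
      using reach_last[OF r m(1)] le t by auto
    then have "\<forall>i<k. i \<noteq> m \<longrightarrow> js i < t" by simp
    then show ?thesis unfolding proc_def using m by blast
  qed
qed

text \<open>A step adds a single choice of entries to those treated. If the tuple is reachable, its
  last box is \<open>t\<close> on pile \<open>m\<close>, because all other entries are
  smaller.\<close>

lemma proc_new:
  assumes r: "reach k n (le X) js v" and t: "1 \<le> t" and m: "m < k"
    and p: "proc t m (Suc R) js" "\<not> proc t m R js"
  shows "js m = t" "\<And>i. i < k \<Longrightarrow> i \<noteq> m \<Longrightarrow> js i < t" "code N k (js(m := 0)) = insert0 N m R"
    and "\<exists>js0 v0. v = Suc v0 \<and> reach k n (le X) js0 v0 \<and> js = js0(m := t) \<and>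
      (\<forall>i<k. js0 i < t) \<and> le X (js0 m) t"
proof -
  show a: "js m = t" "\<And>i. i < k \<Longrightarrow> i \<noteq> m \<Longrightarrow> js i < t" "code N k (js(m := 0)) = insert0 N m R"
    using p unfolding proc_def less_Suc_eq by blast+
  have "js i \<le> js m" if "i < k" for i using a(1) a(2)[OF that] by (cases "i = m") auto
  then show "\<exists>js0 v0. v = Suc v0 \<and> reach k n (le X) js0 v0 \<and> js = js0(m := t) \<and>
      (\<forall>i<k. js0 i < t) \<and> le X (js0 m) t"
    using reach_last[OF r m] a(1) t by simp
qed

lemma proc_mono: "proc t m R js \<Longrightarrow> proc t m (Suc R) js"
  unfolding proc_def using less_SucI by blast

text \<open>The tuple of this step would have \<open>t\<close> on two piles, or \<open>t\<close> in
  a place that is blank; it is not reachable, so nothing has to be stored.\<close>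

lemma dp_skip:
  assumes dp: "dp X m a S (proc t mm R)" and t: "1 \<le> t" and mm: "mm < k" and R: "R < N ^ (k - 1)"
    and bad: "i < k" "dig N (insert0 N mm R) i = t"
  shows "dp X m a S (proc t mm (Suc R))"
proof (rule dp_cong[OF dp])
  fix js v assume r: "reach k n (le X) js v"
  show "proc t mm R js \<longleftrightarrow> proc t mm (Suc R) js"
  proof (rule iffI, erule proc_mono, rule ccontr)
    assume p: "proc t mm (Suc R) js" "\<not> proc t mm R js"
    note q = proc_new[OF r t mm p]
    have "dig N (insert0 N mm R) i = (js(mm := 0)) i"
      unfolding q(3)[symmetric] using reach_lessN[OF r] N2 bad(1) by (intro dig_code) auto
    then show False using q(2)[OF bad(1)] bad(2) t by (cases "i = mm") auto
  qed
qed

text \<open>Take the last box \<open>t\<close> away from \<open>js\<close>. The predecessor has all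
  entries below \<open>t\<close>, hence was treated before, and is stored with a value of at least
  \<open>v\<close>, the offset making up for the box removed. It agrees with \<open>js\<close> on
  the other piles, so the query sees it.\<close>

lemma query_complete:
  assumes dp: "dp X m a S (proc t mm R)" and t: "1 \<le> t" and mm: "mm < k"
    and q: "\<And>J v. (J, v) \<in> S \<Longrightarrow> rst J mm = insert0 N mm R \<Longrightarrow> le X (dig N J mm) t \<Longrightarrow> v \<le> b"
    and r: "reach k n (le X) js v" and p: "proc t mm (Suc R) js" "\<not> proc t mm R js"
  shows "v \<le> b" "1 \<le> v"
proof -
  note P = proc_new[OF r t mm p]
  obtain js0 v0 where js0: "v = Suc v0" "reach k n (le X) js0 v0" "js = js0(mm := t)"
      "\<And>i. i < k \<Longrightarrow> js0 i < t" "le X (js0 mm) t" using P(4) by blast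
  have "proc t mm R js0" using js0(4) by (simp add: proc_def)
  then obtain v' where v': "v' \<ge> Suc v0" "(code N k js0, v') \<in> S"
    using dp js0(2) unfolding dp_def by blast
  have d: "dig N (code N k js0) = js0"
    using reach_lessN[OF js0(2)] reach_zero[OF js0(2)] by (rule dig_of_code)
  have "code N k js0 < N ^ k" using reach_lessN[OF js0(2)] by (rule code_less)
  then have "rst (code N k js0) mm = code N k (js0(mm := 0))" using rst_code mm d by simp
  also have "js0(mm := 0) = js(mm := 0)" using js0(3) by simp
  finally have "rst (code N k js0) mm = insert0 N mm R" unfolding P(3) .
  from q[OF v'(2) this] have "v' \<le> b" using d js0(5) by simp
  then show "v \<le> b" "1 \<le> v" using v' js0(1) by simp_all
qed

lemma dp_none:
  assumes dp: "dp X m a S (proc t mm R)" and t: "1 \<le> t" and mm: "mm < k"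
    and q: "\<And>J v. (J, v) \<in> S \<Longrightarrow> rst J mm = insert0 N mm R \<Longrightarrow> le X (dig N J mm) t \<Longrightarrow> v \<le> 0"
  shows "dp X m a S (proc t mm (Suc R))"
proof (rule dp_cong[OF dp])
  fix js v assume r: "reach k n (le X) js v"
  show "proc t mm R js \<longleftrightarrow> proc t mm (Suc R) js"
  proof (rule iffI, erule proc_mono, rule ccontr)
    assume "proc t mm (Suc R) js" "\<not> proc t mm R js"
    then show False using query_complete[OF dp t mm q r] by simp
  qed
qed

lemma dp_insert:
  assumes dp: "dp X m a S (proc t mm R)" and t: "1 \<le> t" "t \<le> n" and mm: "mm < k" and R: "R < N ^ (k - 1)"
    and ok: "\<And>i. i < k \<Longrightarrow> dig N (insert0 N mm R) i \<noteq> t"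
    and q: "\<And>J v. (J, v) \<in> S \<Longrightarrow> rst J mm = insert0 N mm R \<Longrightarrow> le X (dig N J mm) t \<Longrightarrow> v \<le> b"
    and b: "(J, b) \<in> S" "rst J mm = insert0 N mm R" "le X (dig N J mm) t"
    and J': "J' = insert0 N mm R + t * N ^ mm"
  shows "J' < N ^ k" "\<And>i. i < k \<Longrightarrow> dig N J' i \<le> n"
    "dp X (ins X m J' (b + 1) k) (max a (b + 1)) (insert (J', b + 1) S) (proc t mm (Suc R))"
proof -
  have pr: "prep m X" and tr: "trie X m S"
    and S: "\<And>J v. (J, v) \<in> S \<Longrightarrow> 1 \<le> v \<and> v \<le> a \<and> reach k n (le X) (dig N J) (v - 1) \<and> proc t mm R (dig N J)"
    and am: "\<exists>J. (J, a) \<in> S"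
    and com: "\<And>js v. reach k n (le X) js v \<Longrightarrow> proc t mm R js \<Longrightarrow> \<exists>v'\<ge>Suc v. (code N k js, v') \<in> S"
    using dp unfolding dp_def by blast+
  have Jk: "J < N ^ k" using trieD(1)[OF tr b(1)] .
  have rJ: "rst J mm = code N k ((dig N J)(mm := 0))" using rst_code[OF Jk mm] .
  have dJ: "dig N (insert0 N mm R) i = dig N J i" if "i < k" "i \<noteq> mm" for i
    using dig_code[of k "(dig N J)(mm := 0)" N i] dig_less that N2 unfolding b(2)[symmetric] rJ by simp
  \<comment> \<open>The predecessor found has only entries below \<open>t\<close>, although the
    query did not ask for this. An entry \<open>t\<close> on an earlier pile is excluded by
    \<open>ok\<close>. An entry \<open>t\<close> on pile \<open>mm\<close> would mean that the tuple
    was treated in a step \<open>R' < R\<close>, against the injectivity of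
    \<open>insert0\<close>.\<close>
  have lt: "dig N J i < t" if "i < k" for i
  proof -
    have "proc t mm R (dig N J)" using S[OF b(1)] by blast
    then consider "\<forall>i<k. dig N J i < t" | m' where "m' < k" "dig N J m' = t" "m' < mm" |
      R' where "R' < R" "code N k ((dig N J)(mm := 0)) = insert0 N mm R'"
      unfolding proc_def by blast
    then show ?thesis
    proof cases
      case 1
      then show ?thesis using that by blast
    next
      case 2
      then show ?thesis using dJ[of m'] ok[of m'] by simp
    next
      case 3
      then have "insert0 N mm R = insert0 N mm R'" using b(2) rJ by simp
      then show ?thesis using insert0_inj[of N mm R R'] 3 N2 by simp
    qed
  qed
  let ?js = "(dig N J)(mm := t)"
  have J'c: "J' = code N k ?js" using J' b(2) rJ code_upd[OF mm, of N "dig N J" t] by simp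
  have jsN: "?js i < N" for i using dig_less t n_bounds by simp
  have js0: "?js i = 0" if "k \<le> i" for i using dig_zero[OF Jk that] mm that by simp
  have d': "dig N J' = ?js" unfolding J'c using jsN js0 by (rule dig_of_code)
  show J'k: "J' < N ^ k" unfolding J'c using jsN by (rule code_less)
  have re: "reach k n (le X) ?js (Suc (b - 1))"
    using S[OF b(1)] mm t lt b(3) by (intro reach_step) auto
  show dn: "dig N J' i \<le> n" for i unfolding d' using reach_le[OF re] .
  have b1: "1 \<le> b" using S[OF b(1)] by blast
  have zc: "code N k (?js(mm := 0)) = insert0 N mm R" using b(2) rJ by simp
  have pn: "proc t mm (Suc R) ?js"
  proof -
    have "\<forall>i<k. i \<noteq> mm \<longrightarrow> ?js i < t" using lt by simp
    then show ?thesis unfolding proc_def using zc mm by (metis fun_upd_same lessI)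
  qed
  have "prep (ins X m J' (b + 1) k) X"
    by (rule prep_cong[OF pr]) (rule ins_low[OF pr dn J'k])
  moreover have "trie X (ins X m J' (b + 1) k) (insert (J', b + 1) S)"
    using pr dn J'k tr by (rule trie_insert)
  moreover have "1 \<le> v \<and> v \<le> max a (b + 1) \<and> reach k n (le X) (dig N J2) (v - 1) \<and> proc t mm (Suc R) (dig N J2)"
    if "(J2, v) \<in> insert (J', b + 1) S" for J2 v
  proof (cases "(J2, v) \<in> S")
    case True
    then show ?thesis using S[OF True] proc_mono by auto
  next
    case False
    then have "J2 = J'" "v = b + 1" using that by auto
    then show ?thesis using re d' pn b1 by simp
  qed
  moreover have "\<exists>J. (J, max a (b + 1)) \<in> insert (J', b + 1) S"
    using am by (cases "a \<le> b + 1") (auto simp: max_def)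
  moreover have "\<exists>v'\<ge>Suc v. (code N k js, v') \<in> insert (J', b + 1) S"
    if r: "reach k n (le X) js v" and p: "proc t mm (Suc R) js" for js v
  proof (cases "proc t mm R js")
    case True
    then show ?thesis using com[OF r] by blast
  next
    case False
    note P = proc_new[OF r t(1) mm p False]
    have "code N k js = code N k (js(mm := 0)) + t * N ^ mm"
      using code_upd[OF mm, of N js t] P(1) by (metis fun_upd_triv)
    then have "code N k js = J'" using P(3) J' by simp
    moreover have "v \<le> b" using query_complete(1)[OF dp t(1) mm q r p False] .
    ultimately show ?thesis by auto
  qed
  ultimately show "dp X (ins X m J' (b + 1) k) (max a (b + 1)) (insert (J', b + 1) S) (proc t mm (Suc R))"
    unfolding dp_def by blast
qed

end

section \<open>One step and the whole loop\<close>

definition step_time :: "nat \<Rightarrow> nat \<Rightarrow> nat \<Rightarrow> nat" where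
  "step_time k d U = (k + 1) * U + k * 130 + 200"

context ram begin

definition U :: nat where "U = L ^ d * (80 * d + 60)"

lemma digits_spec:
  assumes g: "glob r" and J: "r 18 = J" and z: "r 17 = 0"
  shows "runs w (digits_prog k) r m 0
    (\<lambda>t r' m'. t \<le> k * 30 + 10 \<and> (\<forall>j<17. r' j = r j) \<and> m' = m \<and>
      (r' 17 = 0 \<longleftrightarrow> (\<forall>i<k. dig N J i \<noteq> r 11)))"
proof -
  have gr: "r 5 = N" using g by (simp add: glob_def)
  let ?I = "\<lambda>i r' m'. (\<forall>j<17. r' j = r j) \<and> m' = m \<and> r' 19 = i \<and> r' 18 = J div N ^ i \<and>
     (r' 17 = 0 \<longleftrightarrow> (\<forall>c<i. dig N J c \<noteq> r 11))"
  show ?thesis unfolding digits_prog_def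
  proof (rule runs_For[where I = ?I and B = k and T = 20], goal_cases)
    case (4 i r' m')
    then have r': "\<And>j. j < 17 \<Longrightarrow> r' j = r j" "m' = m" "r' 19 = i" "r' 18 = J div N ^ i"
      and z: "r' 17 = 0 \<longleftrightarrow> (\<forall>c<i. dig N J c \<noteq> r 11)" by blast+
    have e: "J div N ^ i div N = J div N ^ Suc i" by (simp add: div_mult2_eq mult.commute[of N])
    have dg: "J div N ^ i mod N = dig N J i" by (simp add: dig_def)
    have s: "(\<forall>c<Suc i. dig N J c \<noteq> r 11) \<longleftrightarrow> (\<forall>c<i. dig N J c \<noteq> r 11) \<and> dig N J i \<noteq> r 11"
      by (auto simp: less_Suc_eq)
    show ?case
    proof (cases "dig N J i = r 11")
      case True
      then show ?thesis unfolding s by (simp add: ev r' gr dg e del: power_Suc)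
    next
      case False
      then show ?thesis unfolding s z[symmetric] by (simp add: ev r' gr dg e del: power_Suc)
    qed
  qed (use J z kdw in \<open>simp_all add: ev\<close>)
qed

lemma step_spec:
  assumes g: "glob r" and dp: "dp X m (r 16) S (proc t mm R)"
    and r: "r 11 = t" "1 \<le> t" "t \<le> n" "r 12 = mm" "mm < k" "r 13 = N ^ mm" "r 14 = R" "R < N ^ (k - 1)"
  shows "runs w (step_prog k d) r m 0 (\<lambda>t' r' m'. t' \<le> step_time k d U \<and> (\<forall>j<15. r' j = r j) \<and>
    (\<exists>S'. dp X m' (r' 16) S' (proc t mm (Suc R))))"
proof -
  let ?J = "insert0 N mm R"
  have gr: "r 5 = N" "r 4 = M" using g by (simp_all add: glob_def)
  have N0: "0 < N" using N2 by simp
  have Jk: "?J < N ^ k" using insert0_less r(5,8) N0 by blast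
  have JM: "?J < M" using Jk powN by linarith
  have Pm: "N ^ mm * N \<le> N ^ k"
    using r(5) N2 power_increasing[of "Suc mm" k N] by (simp add: mult.commute)
  have EJ: "eval_binop w Mult (N ^ mm) N = N ^ mm * N"
     "eval_binop w Mult (R div N ^ mm) (N ^ mm * N) = R div N ^ mm * (N ^ mm * N)"
     "eval_binop w Add (R mod N ^ mm) (R div N ^ mm * (N ^ mm * N)) = ?J"
  proof -
    have "R div N ^ mm * (N ^ mm * N) \<le> ?J" "R mod N ^ mm \<le> ?J" by (simp_all add: insert0_def)
    then show "eval_binop w Mult (N ^ mm) N = N ^ mm * N"
     "eval_binop w Mult (R div N ^ mm) (N ^ mm * N) = R div N ^ mm * (N ^ mm * N)"
     "eval_binop w Add (R mod N ^ mm) (R div N ^ mm * (N ^ mm * N)) = ?J"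
      unfolding insert0_def[of N mm R] using Pm powN JM
      by (intro ev_Mult ev_Add; unfold insert0_def; linarith)+
  qed
  have pr: "prep m X" and tr: "trie X m S" using dp by (simp_all add: dp_def)
  have tM: "t < M" using r(3) n_bounds by linarith
  let ?Q = "\<lambda>t' r' m'. t' \<le> step_time k d U \<and> (\<forall>j<15. r' j = r j) \<and>
    (\<exists>S'. dp X m' (r' 16) S' (proc t mm (Suc R)))"
  have rest: "runs w (search_prog k d) r1 m t1 ?Q"
    if r1: "\<And>j. j < 15 \<Longrightarrow> r1 j = r j" "r1 15 = ?J" "r1 16 = r 16" and t1: "t1 \<le> k * 30 + 50"
      and ok: "\<And>i. i < k \<Longrightarrow> dig N ?J i \<noteq> t" for r1 t1
  proof -
    let ?r2 = "r1(30 := 7 + mm, 31 := ?J, 32 := m (adr 4 t))"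
    have g2: "glob ?r2" using g by (rule glob_cong) (simp add: r1)
    have kM: "k \<le> M" using powN(1) less_exp[of k] power_mono[of 2 N k] N2 by linarith
    have E7: "eval_binop w Add 7 mm = 7 + mm" using kM r(5) M8 by (intro ev_Add; linarith)
    have q: "runs w (query_prog d) ?r2 m 0 (\<lambda>t' r' m'. t' \<le> L ^ d * (80 * d + 60) + 10 \<and>
     (\<forall>j<33. r' j = ?r2 j) \<and> m' = m \<and>
     (\<forall>(J, v)\<in>S. rst J mm = ?r2 31 \<and> le X (dig N J mm) t \<longrightarrow> v \<le> r' 33) \<and>
     (r' 33 = 0 \<or> (\<exists>J. (J, r' 33) \<in> S \<and> rst J mm = ?r2 31 \<and> le X (dig N J mm) t)))"
      using g2 pr r(3) _ _ r(5) _ tr by (rule query_trie) (simp_all add: Jk)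
    have "runs w (query_prog d ;; extend_prog k d) ?r2 m (t1 + 20) ?Q"
      unfolding runs_Seq
    proof (rule runs_call[OF q], goal_cases)
      case a: (1 t3 r3 m3)
      then have r3: "\<And>j. j < 15 \<Longrightarrow> r3 j = r j" "r3 15 = ?J" "r3 16 = r 16" and m3: "m3 = m"
        and t3: "t3 \<le> U + 10" using r1 by (simp_all add: U_def)
      have qv: "\<And>J v. (J, v) \<in> S \<Longrightarrow> rst J mm = ?J \<Longrightarrow> le X (dig N J mm) t \<Longrightarrow> v \<le> r3 33"
        using a by auto
      define b where "b = r3 33"
      show ?case
      proof (cases "b = 0")
        case True
        then have "dp X m (r 16) S (proc t mm (Suc R))"
          using qv dp_none[OF dp r(2) r(5)] unfolding b_def by auto
        then show ?thesis using True t1 t3 r3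
          by (auto simp: extend_prog_def b_def m3 step_time_def)
      next
        case False
        then obtain J where J: "(J, b) \<in> S" "rst J mm = ?J" "le X (dig N J mm) t"
          using a by (auto simp: b_def)
        let ?J' = "?J + t * N ^ mm"
        have ins: "?J' < N ^ k" "\<And>i. i < k \<Longrightarrow> dig N ?J' i \<le> n"
          "dp X (ins X m ?J' (b + 1) k) (max (r 16) (b + 1)) (insert (?J', b + 1) S) (proc t mm (Suc R))"
          by (rule dp_insert[OF dp r(2,3,5,8) _ _ J refl]; use ok qv b_def in blast)+
        \<comment> \<open>The answer stands for \<open>b - 1\<close> boxes and is thus at most
          \<open>n + 1\<close>, so that adding 1 to it is exact.\<close>
        have bn: "b \<le> Suc n"
        proof -
          have "reach k n (le X) (dig N J) (b - 1)" using dp J(1) unfolding dp_def by blast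
          from reach_bound[OF this, of n] reach_le[OF this] show ?thesis by simp
        qed
        have E: "eval_binop w Add b 1 = b + 1" "eval_binop w Mult t (N ^ mm) = t * N ^ mm"
          "eval_binop w Add ?J (t * N ^ mm) = ?J'"
        proof -
          have "?J' \<le> M" using ins(1) powN(1) by linarith
          then have "?J \<le> M" "t * N ^ mm \<le> M" by simp_all
          then show "eval_binop w Mult t (N ^ mm) = t * N ^ mm"
            "eval_binop w Add ?J (t * N ^ mm) = ?J'"
            by (intro ev_Add ev_Mult; linarith)+
          show "eval_binop w Add b 1 = b + 1" using bn n_bounds by (intro ev_Add; linarith)
        qed
        let ?r4 = "(if r 16 < b + 1 then r3(21 := b + 1, 16 := b + 1) else r3(21 := b + 1))(20 := ?J')"
        have r4: "\<And>j. j < 15 \<Longrightarrow> ?r4 j = r j" "?r4 16 = max (r 16) (b + 1)" "?r4 20 = ?J'" "?r4 21 = b + 1"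
          using r3 by simp_all
        have g4: "glob ?r4" using g by (rule glob_cong) (use r4 in simp)
        have i4: "runs w (insert_prog k d) ?r4 m 0 (\<lambda>t' r' m'. t' \<le> k * (U + 80) + 10 \<and> ?Q 0 r' m')"
        proof (rule runs_conseq[OF insert_spec[OF g4 pr]], goal_cases)
          case a5: (3 t5 r5 m5)
          then have "r5 16 = max (r 16) (b + 1)" "m5 = ins X m ?J' (b + 1) k" using r4 by simp_all
          then have "\<exists>S'. dp X m5 (r5 16) S' (proc t mm (Suc R))" using ins(3) by metis
          moreover have "r5 j = r j" if "j < 15" for j
            using a5[THEN conjunct2, THEN conjunct1, rule_format, of j] r4(1)[OF that] that
            by (simp only:)
          moreover have "t5 \<le> k * (U + 80) + 10" using a5 by (simp add: U_def)
          ultimately show ?case by blast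
        qed (use ins(1,2) r4 in simp_all)
        have bound: "t1 + 20 + t3 + 30 + t' \<le> step_time k d U" if "t' \<le> k * (U + 80) + 10" for t'
          using t1 t3 that by (simp add: step_time_def algebra_simps)
        have i5: "runs w (insert_prog k d) ?r4 m t6 ?Q" if "t6 \<le> t1 + 20 + t3 + 30" for t6
          by (rule runs_call[OF i4]) (use bound that in fastforce)
        show ?thesis
        proof (cases "r 16 < b + 1")
          case True
          then show ?thesis using i5[unfolded if_P[OF True]] False
            by (simp add: extend_prog_def ev r3 r E m3 b_def[symmetric] del: One_nat_def)
        next
          case F: False
          then show ?thesis using i5[unfolded if_not_P[OF F]] False
            by (simp add: extend_prog_def ev r3 r E m3 b_def[symmetric] del: One_nat_def)
        qed
      qed
    qed
    then have "runs w (query_prog d ;; extend_prog k d) ?r2 m t6 ?Q" if "t6 \<le> t1 + 20" for t6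
      using that unfolding runs_def by (blast intro: order.trans add_le_mono1)
    then show ?thesis unfolding search_prog_def
      by (subst runs_Seq, subst runs_Assign, subst runs_Seq, subst runs_Assign, subst runs_Seq, subst runs_Assign)
        (simp add: ev r1 gr r E7 tM del: runs_Seq runs_Cond)
  qed
  have start: "runs w locate_prog r m 0 (\<lambda>t' r' m'. t' \<le> 20 \<and>
      m' = m \<and> r' = r(15 := ?J, 17 := 0, 18 := ?J))"
    using r by (simp add: locate_prog_def ev gr EJ)
  show ?thesis
    unfolding step_prog_def
  proof -
    let ?r1 = "r(15 := ?J, 17 := 0, 18 := ?J)"
    have g1: "glob ?r1" using g by (rule glob_cong) simp
    note ds = digits_spec[OF g1, of ?J m]
    have dg: "runs w (digits_prog k ;; Cond (Reg 17) Skip (search_prog k d)) ?r1 m t0 ?Q" if "t0 \<le> 20" for t0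
      unfolding runs_Seq
    proof (rule runs_call[OF ds], goal_cases)
      case a: (3 t' r' m')
      then have r': "\<And>j. j < 15 \<Longrightarrow> r' j = r j" "r' 15 = ?J" "r' 16 = r 16" "m' = m" by simp_all
      have tt: "t0 + t' + 2 \<le> k * 30 + 50" using a that by simp
      show ?case
      proof (cases "r' 17 = 0")
        case True
        then have "\<And>i. i < k \<Longrightarrow> dig N ?J i \<noteq> t" using a r by auto
        from rest[OF r'(1-3) tt this] show ?thesis using True r' by simp
      next
        case False
        then obtain i where "i < k" "dig N ?J i = t" using a r by auto
        from dp_skip[OF dp r(2,5,8) this] show ?thesis
          using False r' tt by (auto simp: step_time_def)
      qed
    qed simp_all
    show "runs w (locate_prog ;; digits_prog k ;; Cond (Reg 17) Skip (search_prog k d)) r m 0 ?Q"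
      by (subst runs_Seq, rule runs_conseq[OF start], elim conjE, hypsubst, rule dg)
  qed
qed

definition main_time :: "nat" where
  "main_time = n * (k * (N ^ (k - 1) * (step_time k d U + 10) + 40) + 50) + k * (U + 80) + 100"

lemma main_spec:
  assumes g: "glob r" and pr: "prep m X" and z: "trie0 m" and le0: "\<And>t. le X 0 t"
  shows "runs w (main_prog k d) r m 0 (\<lambda>t r' m'. t \<le> main_time \<and>
    (\<exists>js. reach k n (le X) js (r' 0)) \<and> (\<forall>js v. reach k n (le X) js v \<longrightarrow> v \<le> r' 0))" (is "runs _ _ _ _ _ ?Q")
proof -
  have gr: "r 0 = n" "r 5 = N" "r 7 = N ^ (k - 1)" using g by (simp_all add: glob_def)
  let ?I = "\<lambda>i r' m'. (\<forall>j<10. r' j = r j) \<and> r' 10 = i \<and> (\<exists>S. dp X m' (r' 16) S (proc (Suc i) 0 0))"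
  let ?T2 = "N ^ (k - 1) * (step_time k d U + 10) + 30"
  let ?T1 = "k * (N ^ (k - 1) * (step_time k d U + 10) + 40) + 40"
  have N0: "0 < N" using N2 by simp
  have d0: "dig N 0 i = 0" for i by (simp add: dig_def)
  have Nk: "0 < N ^ k" using N0 by simp
  have t0: "trie X m {}" unfolding trie_def
  proof (intro conjI allI impI)
    fix i J z' assume "i < k" "J < N ^ k" "z' < D"
    then have "m (cell i J z') = 0"
      using z cell_bound unfolding trie0_def cell_def by simp
    then show "m (cell i J z') = 0 \<or> (\<exists>J'. (J', m (cell i J z')) \<in> {} \<and> J = rst J' i \<and>
      (\<exists>l<L ^ d. z' = nodez (X (dig N J' i)) 0 l))" by blast
  qed simp_all
  \<comment> \<open>Before box 1, the treated tuples are those with all entries below 1, that is,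
    the empty piles; their value 0 is stored as 1.\<close>
  have dp0: "dp X (ins X m 0 1 k) 1 {(0, 1)} (proc 1 0 0)"
    unfolding dp_def
  proof (intro conjI allI impI)
    show "prep (ins X m 0 1 k) X"
      by (rule prep_cong[OF pr]) (rule ins_low[OF pr], simp_all add: d0 N0)
    show "trie X (ins X m 0 1 k) {(0, 1)}"
      using trie_insert[OF pr _ Nk t0, of 1] d0 by simp
    fix js v assume re: "reach k n (le X) js v" and p: "proc 1 0 0 js"
    then have j0: "js i = 0" if "i < k" for i using that unfolding proc_def by auto
    have "v \<le> 0" using reach_bound[OF re, of 0] j0 by simp
    moreover have "code N k js = 0" using j0 by (simp add: code_def)
    ultimately show "\<exists>v'\<ge>Suc v. (code N k js, v') \<in> {(0, 1)}" by simp
  next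
    fix J v assume "(J, v) \<in> {(0::nat, 1::nat)}"
    then have "J = 0" "v = 1" by auto
    moreover have "dig N 0 = (\<lambda>_. 0)" using d0 by auto
    ultimately show "1 \<le> v" "v \<le> 1" "reach k n (le X) (dig N J) (v - 1)" "proc 1 0 0 (dig N J)"
      using reach_0[of k n "le X"] by (simp_all add: proc_def)
  qed simp
  let ?r0 = "r(16 := 1, 20 := 0, 21 := 1)"
  have g0: "glob ?r0" using g by (rule glob_cong) simp
  have loop: "runs w (For 10 (Reg 0) (round_prog k d) ;; Assign 0 (Bin Sub (Reg 16) (Const 1))) r1 m1 t1 ?Q"
    if r1: "\<And>j. j < 10 \<Longrightarrow> r1 j = r j" "r1 16 = 1" and dp1: "dp X m1 1 {(0, 1)} (proc 1 0 0)"
      and t1: "t1 \<le> k * (U + 80) + 30" for r1 m1 t1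
    unfolding runs_Seq
  proof (rule runs_For[where I = ?I and B = n and T = ?T1], goal_cases)
    case 1
    then show ?case using r1 dp1 by auto
  next
    case (3 i r' m')
    then show ?case by (simp add: gr)
  next
    case (4 i r' m')
    then have i: "i < n" and r': "\<And>j. j < 10 \<Longrightarrow> r' j = r j" "r' 10 = i"
      and dp: "\<exists>S. dp X m' (r' 16) S (proc (Suc i) 0 0)" by blast+
    let ?J = "\<lambda>mm r'' m''. (\<forall>j<10. r'' j = r j) \<and> r'' 10 = i \<and> r'' 11 = Suc i \<and> r'' 12 = mm \<and>
      r'' 13 = N ^ mm \<and> (\<exists>S. dp X m'' (r'' 16) S (proc (Suc i) mm 0))"
    let ?r2 = "r'(11 := i + 1, 13 := 1)"
    have "runs w (For 12 (Const k)
         (For 14 (Reg 7) (step_prog k d) ;;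
          Assign 13 (Bin Mult (Reg 13) (Reg 5)))) ?r2 m' t2
        (\<lambda>t r'' m''. t \<le> ?T1 \<and> r'' 10 = i \<and> ?I (Suc i) (r''(10 := Suc i)) m'')" if "t2 \<le> 20" for t2
    proof (rule runs_For[where I = ?J and B = k and T = ?T2], goal_cases)
      case 1
      then show ?case using dp r' by simp
    next
      case (4 mm r'' m'')
      then have mm: "mm < k" and r'': "\<And>j. j < 10 \<Longrightarrow> r'' j = r j" "r'' 10 = i" "r'' 11 = Suc i" "r'' 12 = mm"
        "r'' 13 = N ^ mm" and dp: "\<exists>S. dp X m'' (r'' 16) S (proc (Suc i) mm 0)" by blast+
      let ?K = "\<lambda>R r3 m3. (\<forall>j<14. r3 j = r'' j) \<and> r3 14 = R \<and>
        (\<exists>S. dp X m3 (r3 16) S (proc (Suc i) mm R))"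
      show ?case unfolding runs_Seq
      proof (rule runs_For[where I = ?K and B = "N ^ (k - 1)" and T = "step_time k d U"], goal_cases)
        case 1
        then show ?case using dp by simp
      next
        case 2
        have "N ^ (k - 1) \<le> N ^ k" using N0 by (intro power_increasing) auto
        then show ?case using powN by (intro limM) linarith
      next
        case (3 R r3 m3)
        then show ?case using r'' gr by simp
      next
        case (4 R r3 m3)
        then have R: "R < N ^ (k - 1)" and r3: "\<And>j. j < 14 \<Longrightarrow> r3 j = r'' j" "r3 14 = R"
          and "\<exists>S. dp X m3 (r3 16) S (proc (Suc i) mm R)" by blast+
        then obtain S where S: "dp X m3 (r3 16) S (proc (Suc i) mm R)" by blast
        have g3: "glob r3" using g by (rule glob_cong) (simp add: r3 r'')
        have "runs w (step_prog k d) r3 m3 0 (\<lambda>t' r' m'. t' \<le> step_time k d U \<and> (\<forall>j<15. r' j = r3 j) \<and>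
            (\<exists>S'. dp X m' (r' 16) S' (proc (Suc i) mm (Suc R))))"
          using i mm R r3 r'' by (intro step_spec[OF g3 S]) simp_all
        then show ?case
          by (rule runs_conseq) (simp add: r3)
      next
        case (5 t4 r4 m4)
        then have r4: "\<And>j. j < 14 \<Longrightarrow> r4 j = r'' j"
          and t4: "t4 \<le> N ^ (k - 1) * (step_time k d U + 1 + 7) + 6" by simp_all
        obtain S where S: "dp X m4 (r4 16) S (proc (Suc i) mm (N ^ (k - 1)))" using 5 by blast
        have S': "dp X m4 (r4 16) S (proc (Suc i) (Suc mm) 0)"
          by (rule dp_cong[OF S]) (rule proc_next_m[OF _ mm])
        have "N ^ mm * N \<le> N ^ k"
          using mm N2 power_increasing[of "Suc mm" k N] by (simp add: mult.commute)
        then have E: "eval_binop w Mult (N ^ mm) N = N ^ Suc mm"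
          unfolding power_Suc2 using powN by (intro ev_Mult; linarith)
        have "t4 + 4 \<le> ?T2" using t4 by (simp add: algebra_simps)
        then show ?case using S' r4 r''
          by (auto simp: ev gr E simp del: power_Suc)
      qed
    next
      case (5 t4 r4 m4)
      then have r4: "\<And>j. j < 10 \<Longrightarrow> r4 j = r j" "r4 10 = i" "r4 11 = Suc i"
        and t4: "t4 \<le> t2 + k * (?T2 + 1 + 7) + 6" by simp_all
      obtain S where S: "dp X m4 (r4 16) S (proc (Suc i) k 0)" using 5 by blast
      have S': "dp X m4 (r4 16) S (proc (Suc (Suc i)) 0 0)"
        by (rule dp_cong[OF S]) (rule proc_next_t, simp_all)
      have "t4 \<le> ?T1" using t4 that by (simp add: algebra_simps)
      then show ?case using S' r4 by auto
    qed (use kdw in simp_all)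
    then show ?case using i unfolding round_prog_def
      by (simp add: ev r' E_Suc del: One_nat_def)
  next
    case (5 t4 r4 m4)
    then have t4: "t4 \<le> t1 + n * (?T1 + 1 + 7) + 6" by simp
    obtain S where S: "dp X m4 (r4 16) S (proc (Suc n) 0 0)" using 5 by blast
    obtain J where J: "(J, r4 16) \<in> S" using S unfolding dp_def by blast
    have a: "1 \<le> r4 16" "reach k n (le X) (dig N J) (r4 16 - 1)" using S J unfolding dp_def by blast+
    have an: "r4 16 \<le> Suc n" using reach_bound[OF a(2), of n] reach_le[OF a(2)] by simp
    have E: "eval_binop w Sub (r4 16) 1 = r4 16 - 1"
      using a(1) an n_bounds by (intro ev_Sub; linarith)
    \<comment> \<open>After the last round every reachable tuple is treated, since its entries are
      at most \<open>n\<close>.\<close>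
    have "v \<le> r4 16 - 1" if re: "reach k n (le X) js v" for js v
    proof -
      have "proc (Suc n) 0 0 js" using reach_le[OF re] by (simp add: proc_def less_Suc_eq_le)
      then obtain v' where "v' \<ge> Suc v" "(code N k js, v') \<in> S"
        using S re unfolding dp_def by blast
      moreover then have "v' \<le> r4 16" using S unfolding dp_def by blast
      ultimately show ?thesis by linarith
    qed
    moreover have "t4 + 4 \<le> main_time" using t4 t1 by (simp add: main_time_def algebra_simps)
    ultimately show ?case using a(2) by (auto simp: ev E simp del: One_nat_def)
  qed (use n_bounds in auto)
  have ins: "runs w (insert_prog k d) ?r0 m 0 (\<lambda>t r' m'. t \<le> k * (U + 80) + 10 \<and>
     (\<forall>j<22. r' j = ?r0 j) \<and> m' = ins X m 0 1 k)"
    unfolding U_def by (rule runs_conseq[OF insert_spec[OF g0 pr]]) (simp_all add: d0 N0)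
  have "runs w (insert_prog k d ;; For 10 (Reg 0)
      (round_prog k d) ;;
    Assign 0 (Bin Sub (Reg 16) (Const 1))) ?r0 m t0 ?Q" if "t0 \<le> 10" for t0
    by (subst runs_Seq, rule runs_call[OF ins], rule loop) (use dp0 that in auto)
  then show ?thesis unfolding main_prog_def
    by (subst runs_Seq, subst runs_Assign, subst runs_Seq, subst runs_Assign, subst runs_Seq, subst runs_Assign)
      (simp add: ev del: runs_Seq One_nat_def)
qed

end

section \<open>The complete program\<close>

definition power_prog :: "nat \<Rightarrow> exp \<Rightarrow> nat \<Rightarrow> com" where
  "power_prog x e c = Assign x (Const 1) ;; For 10 (Const c) (Assign x (Bin Mult (Reg x) e))"

definition table_prog :: com where
  "table_prog =
    Assign 11 (Const 1) ;;
    For 10 (Reg 2)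
      (Store (At (Const 2) (Reg 10)) (Reg 11) ;; Assign 11 (Bin Add (Reg 11) (Reg 11)))"

text \<open>\<open>L\<close> is found by doubling in a counted loop of \<open>n + 2\<close> rounds,
  of which only the first \<open>L\<close> act; linear time is affordable here. Register 4 has to be
  set before \<open>table_prog\<close>, which addresses memory through it.\<close>

definition init_prog :: "nat \<Rightarrow> nat \<Rightarrow> com" where
  "init_prog k d =
    Assign 5 (Const 1) ;; Assign 2 (Const 0) ;; Assign 11 (Bin Add (Reg 0) (Const 2)) ;;
    For 10 (Reg 11)
      (Cond (Bin Less (Reg 5) (Reg 11))
        (Assign 5 (Bin Add (Reg 5) (Reg 5)) ;; Assign 2 (Bin Add (Reg 2) (Const 1))) Skip) ;;
    power_prog 3 (Reg 2) d ;;
    power_prog 4 (Bin Add (Reg 5) (Reg 5)) (k + d) ;;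
    power_prog 6 (Bin Add (Reg 5) (Reg 5)) d ;;
    power_prog 7 (Reg 5) (k - 1) ;;
    table_prog"

definition boxes_prog :: "nat \<Rightarrow> nat \<Rightarrow> com" where
  "boxes_prog k d = init_prog k d ;; prep_prog d ;; main_prog k d"

lemma nth_concat_uniform:
  "(\<forall>b\<in>set bs. length b = d) \<Longrightarrow> p < length bs \<Longrightarrow> c < d \<Longrightarrow>
    p * d + c < length (concat bs) \<and> concat bs ! (p * d + c) = bs ! p ! c"
proof (induction bs arbitrary: p)
  case (Cons b bs)
  show ?case
  proof (cases p)
    case 0
    then show ?thesis using Cons.prems by (simp add: nth_append)
  next
    case (Suc q)
    then have "q * d + c < length (concat bs) \<and> concat bs ! (q * d + c) = bs ! q ! c"
      using Cons by simp
    then show ?thesis using Suc Cons.prems by (simp add: nth_append add.assoc)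
  qed
qed simp

lemma length_concat_uniform: "(\<forall>b\<in>set bs. length b = d) \<Longrightarrow> length (concat bs) = length bs * d"
  by (induction bs) simp_all

text \<open>The coefficients that arise in \<open>total_time_le\<close> when each part of the
  running time is bounded by a multiple of \<open>N ^ k * L ^ d\<close>.\<close>

definition time_factor :: "nat \<Rightarrow> nat \<Rightarrow> nat" where
  "time_factor k d = 80 * d + 60 * (k + d) + 60 * k + 380 + (140 * d + 140) + (640 * d + 300) + 200 * d + 100 +
     (k * (k + 1) * (80 * d + 60) + k * (130 * k + 210) + (40 * k + 50) + k * (80 * d + 60) + 80 * k + 100)"

context ram begin

lemma power_spec:
  assumes x: "x \<noteq> 10" and c: "eval w (Const c) undefined = c" "c < 2 ^ w"
    and e: "\<And>r'. (\<forall>j. j \<noteq> x \<longrightarrow> j \<noteq> 10 \<longrightarrow> r' j = r j) \<Longrightarrow> eval w e (r', m) = b"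
    and b: "\<And>i. i \<le> c \<Longrightarrow> b ^ i \<le> M"
  shows "runs w (power_prog x e c) r m 0 (\<lambda>t r' m'. t \<le> c * (cost e + 20) + 10 \<and> m' = m \<and>
    (\<forall>j. j \<noteq> x \<longrightarrow> j \<noteq> 10 \<longrightarrow> r' j = r j) \<and> r' x = b ^ c)"
proof -
  let ?I = "\<lambda>i r' m'. m' = m \<and> (\<forall>j. j \<noteq> x \<longrightarrow> j \<noteq> 10 \<longrightarrow> r' j = r j) \<and> r' 10 = i \<and> r' x = b ^ i"
  have cc: "eval w (Const c) s = c" for s using c(1) by (simp add: eval.simps(1))
  show ?thesis unfolding power_prog_def runs_Seq runs_Assign
  proof (rule runs_For[where I = ?I and B = c and T = "cost e + 5"], goal_cases)
    case 1
    then show ?case using x by (simp add: ev)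
  next
    case (4 i r' m')
    then have i: "i < c" and r': "m' = m" "\<forall>j. j \<noteq> x \<longrightarrow> j \<noteq> 10 \<longrightarrow> r' j = r j" "r' 10 = i" "r' x = b ^ i"
      by blast+
    have E: "eval_binop w Mult (b ^ i) b = b ^ Suc i"
      unfolding power_Suc2 using b[of "Suc i"] i by (intro ev_Mult) (simp add: mult.commute)
    show ?case using e[OF r'(2)] r' x E by (simp del: power_Suc)
  next
    case (5 t r' m')
    then show ?case by (simp add: algebra_simps)
  qed (use c cc in auto)
qed

definition init_time :: nat where
  "init_time = n * 40 + L * 40 + d * 60 + (k + d) * 60 + k * 60 + 300"

lemma init_spec:
  assumes r: "r 0 = n" and min: "\<And>l. l < L \<Longrightarrow> 2 ^ l < n + 2"
  shows "runs w (init_prog k d) r m 0 (\<lambda>t r' m'. t \<le> init_time \<and> glob r' \<and> pow_ok m' \<and> same {2} m m')"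
proof -
  \<comment> \<open>Minimality of \<open>L\<close> shows that \<open>n + 2\<close> rounds of
    doubling suffice.\<close>
  have Ln: "L \<le> n + 2"
  proof (rule ccontr)
    assume "\<not> L \<le> n + 2"
    then have "2 ^ (n + 2) < n + 2" by (intro min) simp
    then show False using less_exp[of "n + 2"] by simp
  qed
  have nM: "n + 2 \<le> M" "2 * N \<le> M" "L \<le> M" "L < N" using nN N2M LN by linarith+
  define P where "P t r' m' \<longleftrightarrow> t \<le> init_time \<and> glob r' \<and> pow_ok m' \<and> same {2} m m'" for t r' m'
  have N0: "0 < N" using N2 by simp
  \<comment> \<open>The pieces are verified from the last to the first, each together with all that
    follows, so that \<open>P\<close> is the only postcondition.\<close>
  let ?p4 = "power_prog 7 (Reg 5) (k - 1) ;; table_prog"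
  let ?p3 = "power_prog 6 (Bin Add (Reg 5) (Reg 5)) d ;; ?p4"
  let ?p2 = "power_prog 4 (Bin Add (Reg 5) (Reg 5)) (k + d) ;; ?p3"
  let ?p1 = "power_prog 3 (Reg 2) d ;; ?p2"
  have pow5: "runs w table_prog r1 m t1 P"
    if g: "glob r1" and t1: "t1 \<le> n * 40 + d * 60 + (k + d) * 60 + k * 60 + 250" for r1 t1
  proof -
    have gr: "r1 2 = L" "r1 4 = M" using g by (simp_all add: glob_def)
    let ?I = "\<lambda>i r' m'. (\<forall>j<10. r' j = r1 j) \<and> r' 10 = i \<and> i \<le> L \<and> r' 11 = 2 ^ i \<and> same {2} m m' \<and>
      (\<forall>l<i. m' (adr 2 l) = 2 ^ l)"
    show ?thesis unfolding table_prog_def runs_Seq runs_Assign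
    proof (rule runs_For[where I = ?I and B = L and T = 20], goal_cases)
      case 1
      then show ?case by (simp add: ev same_refl)
    next
      case (4 i r' m')
      then have i: "i < L" and r': "\<And>j. j < 10 \<Longrightarrow> r' j = r1 j" "r' 10 = i" "r' 11 = 2 ^ i"
        and sm: "same {2} m m'" and po: "\<And>l. l < i \<Longrightarrow> m' (adr 2 l) = 2 ^ l" by blast+
      have iM: "i < M" using i nM by linarith
      have "(2::nat) ^ Suc i \<le> N" unfolding N_def using i by (intro power_increasing) auto
      then have E: "eval_binop w Add (2 ^ i) (2 ^ i) = 2 ^ Suc i"
        using nM ev_Add[of "2 ^ i" "2 ^ i"] by simp
      let ?m = "m'(adr 2 i := 2 ^ i)"
      have sm2: "same {2} m ?m"
        using iM by (intro same_trans[OF sm same_store[of 2 "{2}"]]) auto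
      have po2: "\<forall>l<Suc i. ?m (adr 2 l) = 2 ^ l"
        using po iM by (auto simp: less_Suc_eq adr_eq)
      show ?case using i iM sm2 po2
        by (simp add: ev r' gr E del: power_Suc)
    next
      case (5 t' r' m')
      have "glob r'" using g by (rule glob_cong) (use 5 in simp)
      moreover have "t' \<le> init_time" using 5 t1 by (simp add: init_time_def)
      ultimately show ?case using 5 by (simp add: P_def pow_ok_def)
    qed (use nM limM gr in auto)
  qed
  have p4: "runs w ?p4 r1 m t1 P"
    if g: "r1 0 = n" "r1 5 = N" "r1 2 = L" "r1 3 = L ^ d" "r1 4 = M" "r1 6 = D"
      and t1: "t1 \<le> n * 40 + d * 60 + (k + d) * 60 + 220" for r1 t1
  proof (subst runs_Seq, rule runs_call[OF power_spec[where b = N]], goal_cases)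
    case (5 i)
    note that = this
    show ?case
    proof -
      have "N ^ i \<le> N ^ k" using that N0 by (intro power_increasing) auto
      then show ?thesis using powN by linarith
    qed
  next
    case a: (6 t' r' m')
    have tt: "t1 + t' \<le> n * 40 + d * 60 + (k + d) * 60 + k * 60 + 250"
    proof -
      have "(k - 1) * (cost (Reg 5) + 20) \<le> k * 60" by (intro mult_le_mono) auto
      then show ?thesis using a t1 by linarith
    qed
    have "glob r'" using a g by (simp add: glob_def)
    from pow5[OF this tt] show ?case
      using a by simp
  qed (use kdw g in \<open>simp_all del: One_nat_def\<close>)
  have E2: "eval_binop w Add N N = 2 * N" using ev_Add[of N N] nM by simp
  have pD: "(2 * N) ^ i \<le> M" if "i \<le> k + d" for i
    unfolding M_def using that N0 by (intro power_increasing) auto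
  have p3: "runs w ?p3 r1 m t1 P"
    if g: "r1 0 = n" "r1 5 = N" "r1 2 = L" "r1 3 = L ^ d" "r1 4 = M"
      and t1: "t1 \<le> n * 40 + d * 30 + (k + d) * 60 + 200" for r1 t1
  proof (subst runs_Seq, rule runs_call[OF power_spec[where b = "2 * N"]], goal_cases)
    case (5 i)
    note that = this
    show ?case using pD that by simp
  next
    case a: (6 t' r' m')
    then have "m' = m" by blast
    then show ?case
      using a g t1 p4[of r' "t1 + t'"] by (simp add: D_def)
  qed (use kdw g E2 in simp_all)
  have p2: "runs w ?p2 r1 m t1 P"
    if g: "r1 0 = n" "r1 5 = N" "r1 2 = L" "r1 3 = L ^ d"
      and t1: "t1 \<le> n * 40 + d * 30 + 180" for r1 t1
  proof (subst runs_Seq, rule runs_call[OF power_spec[where b = "2 * N"]], goal_cases)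
    case (5 i)
    note that = this
    show ?case using pD that .
  next
    case a: (6 t' r' m')
    then have "m' = m" by blast
    then show ?case
      using a g t1 p3[of r' "t1 + t'"] by (simp add: M_def)
  qed (use kdw g E2 in simp_all)
  have p1: "runs w ?p1 r1 m t1 P"
    if g: "r1 0 = n" "r1 5 = N" "r1 2 = L" and t1: "t1 \<le> n * 40 + 160" for r1 t1
  proof (subst runs_Seq, rule runs_call[OF power_spec[where b = L]], goal_cases)
    case (5 i)
    note that = this
    show ?case
      using power_increasing[OF that L1] Ld by linarith
  next
    case a: (6 t' r' m')
    then have "m' = m" by blast
    then show ?case
      using a g t1 p2[of r' "t1 + t'"] by simp
  qed (use kdw g in simp_all)
  let ?I = "\<lambda>i r' m'. m' = m \<and> r' 0 = n \<and> r' 11 = n + 2 \<and> r' 10 = i \<and> r' 5 = 2 ^ min i L \<and> r' 2 = min i L"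
  have En: "eval_binop w Add n 2 = n + 2" using ev_Add[of n 2] nM by simp
  have "runs w (init_prog k d) r m 0 P"
    unfolding init_prog_def
  proof (subst runs_Seq, subst runs_Assign, subst runs_Seq, subst runs_Assign, subst runs_Seq,
      subst runs_Assign, subst runs_Seq, rule runs_For[where I = ?I and B = "n + 2" and T = 25], goal_cases)
    case 1
    then show ?case using r by (simp add: ev En)
  next
    case 2
    show ?case using nM by (intro limM) linarith
  next
    case (4 i r' m')
    then have r': "m' = m" "r' 0 = n" "r' 11 = n + 2" "r' 10 = i" "r' 5 = 2 ^ min i L" "r' 2 = min i L" by blast+
    show ?case
    proof (cases "i < L")
      case True
      have "(2::nat) ^ Suc i \<le> N" unfolding N_def using True by (intro power_increasing) auto
      then have E: "eval_binop w Add (2 ^ i) (2 ^ i) = 2 ^ Suc i"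
        using nM ev_Add[of "2 ^ i" "2 ^ i"] by simp
      have E1: "eval_binop w Add i 1 = i + 1" using True nM M8 by (intro ev_Add; linarith)
      show ?thesis using True min[OF True] E1
        by (simp add: ev r' E min_def del: power_Suc One_nat_def)
    next
      case False
      have "\<not> 2 ^ L < n + 2" using nL by simp
      then show ?thesis using False by (simp add: ev r' min_def)
    qed
  next
    case (5 t' r' m')
    then have "r' 0 = n" "r' 5 = N" "r' 2 = L" "m' = m" using Ln by (simp_all add: N_def min_def)
    moreover have "t' \<le> n * 40 + 160" using 5 by simp
    ultimately show ?case using p1 by blast
  qed simp
  then show ?thesis unfolding P_def .
qed

definition total_time :: nat where
  "total_time = init_time + (n * (L * (140 * d + 140) + 640 * d + 300) + 200 * d + 100) + main_time"

lemma boxes_spec: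
  assumes min: "\<And>l. l < L \<Longrightarrow> 2 ^ l < n + 2" and bs: "length bs = n" "\<forall>b\<in>set bs. length b = d"
  shows "\<exists>t s. exec w (boxes_prog k d) (input_state bs) t s \<and> t \<le> total_time \<and> fst s 0 = max_nested_boxes k bs"
proof -
  obtain r m where rm: "input_state bs = (r, m)" by fastforce
  have r: "r 0 = n" and m: "m a = (if a < n * d then concat bs ! a else 0)" for a
    using rm bs length_concat_uniform[OF bs(2)] by (auto simp: input_state_def)
  define B where "B p c = bs ! p ! c" for p c
  have ndM: "n * d \<le> M"
  proof -
    have "n * d \<le> d * N" using nN by (simp add: mult.commute)
    then show ?thesis using dN powN by linarith
  qed
  have inB: "input B m"
    unfolding input_def
  proof (intro allI impI)
    fix p c assume "p < n" "c < d"
    then show "m (p * d + c) = B p c"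
      using nth_concat_uniform[OF bs(2), of p c] bs(1) length_concat_uniform[OF bs(2)]
      by (simp add: m B_def)
  qed
  have z: "m (adr a y) = 0" if "1 \<le> a" for a y
  proof -
    have "1 * M \<le> a * M" using that by (rule mult_le_mono1)
    then have "n * d \<le> adr a y" using ndM unfolding adr_def by linarith
    then show ?thesis by (simp add: m)
  qed
  let ?post = "\<lambda>t r' (m'::nat \<Rightarrow> nat). t \<le> total_time \<and> r' 0 = max_nested_boxes k bs"
  have "runs w (boxes_prog k d) r m 0 ?post"
    unfolding boxes_prog_def runs_Seq
  proof (rule runs_conseq[OF init_spec[of r m]], goal_cases)
    case a1: (3 t1 r1 m1)
    have in1: "input B m1" using inB input_cong[of B m "{2}" m1] a1 by simp
    have z1: "m1 (adr a y) = 0" if "3 \<le> a" "y < M" for a y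
      using z[of a y] sameD[of "{2}" m m1 a y] a1 that by simp
    show ?case
    proof (rule runs_call[OF prep_spec[OF _ in1]], goal_cases)
      case a2: (4 t2 r2 m2)
      then obtain X where X: "prep m2 X" "bij_betw (out m2) {1..n} {1..n}" "\<And>t. le X 0 t"
        "\<And>p t. p \<in> {1..n} \<Longrightarrow> t \<in> {1..n} \<Longrightarrow> le X p t \<longleftrightarrow> (\<forall>c<d. B (out m2 p - 1) c \<le> B (out m2 t - 1) c)"
        "\<And>p t. 1 \<le> p \<Longrightarrow> p < t \<Longrightarrow> t \<le> n \<Longrightarrow> le X t p \<Longrightarrow> le X p t"
        unfolding prepared_def by blast
      define ord where "ord p = out m2 p - 1" for p
      have on: "out m2 p \<in> {1..n}" if "p \<in> {1..n}" for p using X(2) that bij_betwE by blast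
      have bij1: "bij_betw (\<lambda>u. u - 1) {1..n} {..<n}"
        by (rule bij_betw_byWitness[where f' = Suc]) auto
      have bij: "bij_betw ord {1..n} {..<n}"
        using bij_betw_trans[OF X(2) bij1] by (simp add: ord_def[abs_def] comp_def)
      interpret T: topological n bs ord "le X"
      proof
        fix p t assume pt: "1 \<le> p" "p \<le> n" "1 \<le> t" "t \<le> n"
        then have "ord p < n" "ord t < n" using bij bij_betwE by fastforce+
        then have "length (bs ! ord p) = d" "length (bs ! ord t) = d" using bs by simp_all
        then show "le X p t \<longleftrightarrow> fits (bs ! ord p) (bs ! ord t)"
          using X(4)[of p t] pt by (simp add: fits_def list_all2_conv_all_nth B_def ord_def)
      qed (use bs bij X in auto)
      have g2: "glob r2" using a1 a2 by (auto intro: glob_cong)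
      show ?case
      proof (rule runs_call[OF main_spec[OF g2 X(1) _ X(3)]], goal_cases)
        case a3: (2 t3 r3 m3)
        then obtain js where "reach k n (le X) js (r3 0)" by blast
        then have "max_nested_boxes k bs = r3 0"
          using a3 by (intro T.max_nested_boxes_eqI) blast+
        moreover have "t1 + t2 + t3 \<le> total_time" using a1 a2 a3 by (simp add: total_time_def)
        ultimately show ?case by simp
      qed (use a2 in blast)
    qed (use a1 z1 in auto)
  qed (use r min in blast)+
  then show ?thesis unfolding runs_def rm by auto
qed

lemma total_time_le:
  "total_time \<le> time_factor k d * (N ^ k * L ^ d)"
proof -
  define W where "W = N ^ k * L ^ d"
  have Nk: "N * 1 \<le> W" "N * L \<le> W"
  proof -
    have "N ^ 1 \<le> N ^ k" using k1 N2 by (intro power_increasing) auto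
    moreover have "L ^ 1 \<le> L ^ d" using d1 L1 by (intro power_increasing) auto
    moreover have "1 \<le> L ^ d" using L1 by simp
    ultimately show "N * 1 \<le> W" "N * L \<le> W" unfolding W_def
      using mult_le_mono[of N "N ^ k" 1 "L ^ d"] mult_le_mono[of N "N ^ k" L "L ^ d"] by simp_all
  qed
  have "1 \<le> N" using N2 by simp
  then have "1 * L \<le> N * L" by (rule mult_le_mono1)
  then have b: "L \<le> W" "n \<le> W" "1 \<le> W" "n * L \<le> W"
    using Nk n_bounds N2 mult_le_mono1[of n N L] by linarith+
  \<comment> \<open>The loop over \<open>t\<close> takes the place of the missing factor: for each
    pile, \<open>n\<close> rounds over \<open>N ^ (k - 1)\<close> choices are at most
    \<open>N ^ k\<close> steps.\<close>
  have "n * N ^ (k - 1) \<le> N * N ^ (k - 1)" using n_bounds by (intro mult_le_mono1) simp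
  also have "\<dots> = N ^ k" using k1 by (simp flip: power_Suc)
  finally have a: "n * N ^ (k - 1) \<le> N ^ k" .
  have U: "n * N ^ (k - 1) * U \<le> (80 * d + 60) * W"
    using mult_le_mono1[OF a, of U] by (simp add: U_def W_def mult_ac)
  have a': "n * N ^ (k - 1) \<le> W"
    using mult_le_mono[OF a, of 1 "L ^ d"] L1 by (simp add: W_def)
  have U1: "U \<le> (80 * d + 60) * W"
  proof -
    have "1 \<le> N ^ k" using N2 by simp
    then show ?thesis using mult_le_mono1[of 1 "N ^ k" U] by (simp add: U_def W_def mult_ac)
  qed
  have "init_time \<le> n * 40 + L * 40 + (60 * d + 60 * (k + d) + 60 * k + 300) * 1"
    by (simp add: init_time_def)
  also have "\<dots> \<le> W * 40 + W * 40 + (60 * d + 60 * (k + d) + 60 * k + 300) * W"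
    using b by (intro add_mono mult_le_mono) auto
  also have "\<dots> \<le> (80 * d + 60 * (k + d) + 60 * k + 380) * W" by (simp add: algebra_simps)
  finally have i: "init_time \<le> (80 * d + 60 * (k + d) + 60 * k + 380) * W" .
  have "n * (L * (140 * d + 140) + 640 * d + 300) + 200 * d + 100 =
     (140 * d + 140) * (n * L) + (640 * d + 300) * n + (200 * d + 100) * 1" by (simp add: algebra_simps)
  also have "\<dots> \<le> (140 * d + 140) * W + (640 * d + 300) * W + (200 * d + 100) * W"
    using b by (intro add_mono mult_le_mono) auto
  finally have p: "n * (L * (140 * d + 140) + 640 * d + 300) + 200 * d + 100 \<le>
     (140 * d + 140) * W + (640 * d + 300) * W + (200 * d + 100) * W" .
  have "main_time = k * (k + 1) * (n * N ^ (k - 1) * U) + k * (130 * k + 210) * (n * N ^ (k - 1)) +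
     (40 * k + 50) * n + k * U + (80 * k + 100) * 1"
    by (simp add: main_time_def step_time_def algebra_simps)
  also have "\<dots> \<le> k * (k + 1) * ((80 * d + 60) * W) + k * (130 * k + 210) * W +
     (40 * k + 50) * W + k * ((80 * d + 60) * W) + (80 * k + 100) * W"
    using b U a' U1 by (intro add_mono mult_le_mono2) auto
  finally have m: "main_time \<le> k * (k + 1) * ((80 * d + 60) * W) + k * (130 * k + 210) * W +
     (40 * k + 50) * W + k * ((80 * d + 60) * W) + (80 * k + 100) * W" .
  have "total_time \<le> (80 * d + 60 * (k + d) + 60 * k + 380) * W +
     ((140 * d + 140) * W + (640 * d + 300) * W + (200 * d + 100) * W) +
     (k * (k + 1) * ((80 * d + 60) * W) + k * (130 * k + 210) * W +
     (40 * k + 50) * W + k * ((80 * d + 60) * W) + (80 * k + 100) * W)"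
    unfolding total_time_def by (rule add_mono[OF add_mono[OF i p] m])
  also have "\<dots> = time_factor k d * W"
    by (simp only: time_factor_def add_mult_distrib mult.assoc add.assoc)
  finally show ?thesis unfolding W_def .
qed

end

section \<open>Asymptotic bound\<close>

definition levels :: "nat \<Rightarrow> nat" where
  "levels n = (LEAST L. n + 2 \<le> 2 ^ L)"

text \<open>By minimality, half of \<open>2 ^ levels n\<close> is at most \<open>n + 1\<close>, so
  rounding up to a power of two costs a bounded factor.\<close>

lemma levels: "n + 2 \<le> 2 ^ levels n" "l < levels n \<Longrightarrow> 2 ^ l < n + 2" "2 ^ levels n \<le> 2 * (n + 1)"
proof -
  have "n + 2 \<le> 2 ^ (n + 2)" using less_exp[of "n + 2"] by (rule less_imp_le)
  then show a: "n + 2 \<le> 2 ^ levels n" unfolding levels_def by (rule LeastI)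
  show b: "2 ^ l < n + 2" if "l < levels n" for l
    using not_less_Least[of l "\<lambda>L. n + 2 \<le> 2 ^ L"] that unfolding levels_def by simp
  have "levels n \<noteq> 0" using a by (intro notI) simp
  then obtain l where l: "levels n = Suc l" by (cases "levels n") auto
  then have "2 ^ l < n + 2" using b by simp
  then show "2 ^ levels n \<le> 2 * (n + 1)" unfolding l by simp
qed

text \<open>From \<open>x \<le> exp x\<close> at \<open>x = L * ln 2 / (2 * d)\<close>: the
  \<open>d\<close>-th power of the right-hand side is the square root of \<open>2 ^ L\<close>, which
  absorbs any fixed power of the logarithm.\<close>

lemma power_le_sqrt_exp2:
  fixes d L :: nat
  assumes "1 \<le> d"
  shows "real L ^ d \<le> (2 * real d / ln 2) ^ d * (2 ^ L) powr (1 / 2)"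
proof -
  have d: "real d > 0" using assms by simp
  let ?x = "real L * ln 2 / (2 * real d)"
  have l: "ln (2::real) > 0" by simp
  have "?x \<le> exp ?x" using exp_ge_add_one_self[of ?x] by linarith
  then have "?x ^ d \<le> exp ?x ^ d" using l d by (intro power_mono) auto
  also have "exp ?x ^ d = exp (real d * ?x)" by (rule exp_of_nat_mult[symmetric])
  also have "real d * ?x = 1 / 2 * (real L * ln 2)" using d by simp
  also have "exp (1 / 2 * (real L * ln 2)) = (2 ^ L) powr (1 / 2)"
    by (simp add: powr_def ln_realpow)
  finally have x: "?x ^ d \<le> (2 ^ L) powr (1 / 2)" .
  have "real L = (2 * real d / ln 2) * ?x" using l d by simp
  then have "real L ^ d = (2 * real d / ln 2) ^ d * ?x ^ d" by (metis power_mult_distrib)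
  also have "\<dots> \<le> (2 * real d / ln 2) ^ d * (2 ^ L) powr (1 / 2)"
    using x l d by (intro mult_left_mono) auto
  finally show ?thesis .
qed

text \<open>\<open>L ^ d\<close> is traded for a square root of \<open>2 ^ L\<close>, which raises
  the exponent to \<open>k + 1 / 2\<close>, and \<open>2 ^ L \<le> 4 * n\<close> once
  \<open>n \<ge> 1\<close>.\<close>

lemma time_bigo:
  assumes "1 \<le> d"
  shows "(\<lambda>n. real (C * ((2 ^ levels n) ^ k * levels n ^ d))) \<in> O(\<lambda>n. real n powr (real k + 1 - 1 / 2))"
proof (rule bigoI)
  let ?c = "(2 * real d / ln 2) ^ d"
  let ?K = "real C * ?c * 4 powr (real k + 1 / 2)"
  have c: "0 \<le> ?c" by simp
  show "\<forall>\<^sub>F n in sequentially. norm (real (C * ((2 ^ levels n) ^ k * levels n ^ d))) \<le>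
      ?K * norm (real n powr (real k + 1 - 1 / 2))"
  proof (rule eventually_mono[OF eventually_ge_at_top[of 1]])
    fix n :: nat assume n: "1 \<le> n"
    have e: "real k + 1 - 1 / 2 = real k + 1 / 2" by simp
    let ?N = "(2::real) ^ levels n"
    have "real (2 ^ levels n) \<le> real (2 * (n + 1))" by (rule of_nat_mono) (rule levels(3))
    then have N: "?N \<le> 4 * real n" using n by simp
    have "real ((2 ^ levels n) ^ k * levels n ^ d) = ?N ^ k * real (levels n) ^ d" by simp
    also have "\<dots> \<le> ?N ^ k * (?c * ?N powr (1 / 2))"
      using power_le_sqrt_exp2[OF assms] by (intro mult_left_mono) auto
    also have "\<dots> = ?c * (?N powr real k * ?N powr (1 / 2))" by (simp add: powr_realpow)
    also have "\<dots> = ?c * ?N powr (real k + 1 / 2)" by (simp add: powr_add)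
    also have "\<dots> \<le> ?c * (4 * real n) powr (real k + 1 / 2)"
      using N c by (intro mult_left_mono powr_mono2) auto
    also have "\<dots> = ?c * 4 powr (real k + 1 / 2) * real n powr (real k + 1 / 2)"
      by (simp add: powr_mult)
    finally have "real C * real ((2 ^ levels n) ^ k * levels n ^ d) \<le>
        real C * (?c * 4 powr (real k + 1 / 2) * real n powr (real k + 1 / 2))"
      by (rule mult_left_mono) simp
    then show "norm (real (C * ((2 ^ levels n) ^ k * levels n ^ d))) \<le>
      ?K * norm (real n powr (real k + 1 - 1 / 2))"
      unfolding e by (simp add: mult.assoc)
  qed
qed

lemma boxes_prog_solves:
  assumes k: "1 \<le> k" and d: "1 \<le> d"
  shows "solves_nested_boxes k d (boxes_prog k d) (\<lambda>n. time_factor k d * ((2 ^ levels n) ^ k * levels n ^ d))"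
proof -
  show ?thesis
    unfolding solves_nested_boxes_def
  \<comment> \<open>The exponent has two parts, both relying on \<open>n + 2 \<ge> 2\<close>:
    \<open>8 + k + d < 2 ^ (8 + k + d)\<close>, and
    \<open>2 * 2 ^ levels n \<le> (n + 2) ^ 3\<close>, which is raised to the power
    \<open>k + d\<close>.\<close>
  proof (rule exI[of _ "8 + k + d + 3 * (k + d)"], intro allI impI)
    fix w n and bs :: "nat list list"
    assume w: "(n + 2) ^ (8 + k + d + 3 * (k + d)) \<le> (2::nat) ^ w" and n: "length bs = n"
      and b: "\<forall>b\<in>set bs. length b = d \<and> (\<forall>x\<in>set b. x < 2 ^ w)"
    let ?L = "levels n"
    have "2 * 2 ^ ?L \<le> 4 * (n + 2)" using levels(3)[of n] by simp
    also have "4 * (n + 2) \<le> (n + 2) ^ 2 * (n + 2)"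
      using power_mono[of 2 "n + 2" 2] by (intro mult_le_mono1) simp
    also have "\<dots> = (n + 2) ^ 3" by (simp add: eval_nat_numeral)
    finally have "(2 * 2 ^ ?L) ^ (k + d) \<le> ((n + 2) ^ 3) ^ (k + d)" by (rule power_mono) simp
    then have 1: "(2 * 2 ^ ?L) ^ (k + d) \<le> (n + 2) ^ (3 * (k + d))" by (simp only: power_mult)
    have "8 + k + d < 2 ^ (8 + k + d)" by (rule less_exp)
    also have "\<dots> \<le> (n + 2) ^ (8 + k + d)" by (rule power_mono) auto
    finally have "(8 + k + d) * (2 * 2 ^ ?L) ^ (k + d) < (n + 2) ^ (8 + k + d) * (n + 2) ^ (3 * (k + d))"
      using 1 by (intro mult_less_le_imp_less) auto
    also have "\<dots> \<le> 2 ^ w" using w by (simp only: power_add)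
    finally have big: "(8 + k + d) * (2 * 2 ^ ?L) ^ (k + d) < 2 ^ w" .
    interpret ram w k d n ?L by unfold_locales (use k d levels big in auto)
    have "\<exists>t s. exec w (boxes_prog k d) (input_state bs) t s \<and> t \<le> total_time \<and> fst s 0 = max_nested_boxes k bs"
      using levels(2) n b by (intro boxes_spec) auto
    moreover have "total_time \<le> time_factor k d * ((2 ^ ?L) ^ k * ?L ^ d)"
      using total_time_le unfolding N_def .
    ultimately show "\<exists>t s. exec w (boxes_prog k d) (input_state bs) t s \<and>
        t \<le> time_factor k d * ((2 ^ ?L) ^ k * ?L ^ d) \<and> fst s 0 = max_nested_boxes k bs"
      by (meson order.trans)
  qed
qed

theorem theorem5p6:
  fixes k d :: nat
  assumes "k \<ge> 1" and "d \<ge> 1"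
  shows "\<exists>\<epsilon>::real. \<epsilon> > 0 \<and>
    (\<exists>p T. solves_nested_boxes k d p T \<and>
      (\<lambda>n. real (T n)) \<in> O(\<lambda>n. real n powr (real k + 1 - \<epsilon>)))"
\<comment> \<open>Any \<epsilon> below 1 leaves room for the logarithms; the value 1/2 is the one
  for which \<open>power_le_sqrt_exp2\<close> is stated.\<close>
proof (intro exI[of _ "1 / 2"] exI conjI)
  show "solves_nested_boxes k d (boxes_prog k d) (\<lambda>n. time_factor k d * ((2 ^ levels n) ^ k * levels n ^ d))"
    using assms by (rule boxes_prog_solves)
  show "(\<lambda>n. real (time_factor k d * ((2 ^ levels n) ^ k * levels n ^ d))) \<in>
      O(\<lambda>n. real n powr (real k + 1 - 1 / 2))"
    using assms(2) by (rule time_bigo)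
qed simp

end
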